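(* Let \[ F(z)=\sum_{n\ge 0} a_n z^n\in \mathbb{C}[[z]] \] be a power series that is rational, and assume that $a_p=0$ for all sufficiently large primes $p$. Then there exist a polynomial $P(z)\in\mathbb{C}[z]$, integers $d_1,\dots,d_m>1$, and rational functions $H_1,\dots,H_m\in \mathbb{C}(z)$ such that \[ F(z)=P(z)+\sum_{j=1}^m H_j(z^{d_j}). \] In general one cannot take a single $d>1$: there exists a rational power series $F(z)=\sum_{n\ge 0} a_n z^n\in\mathbb{C}[[z]]$ with $a_p=0$ for all sufficiently large primes $p$ which is not of the form $P(z)+G(z^d)$ for any polynomial $P\in\mathbb{C}[z]$, any rational function $G\in\mathbb{C}(z)$, and any integer $d>1$.
   Context: A power series in $\mathbb{C}[[z]]$ is called rational if it is the power series expansion at $z=0$ of a rational function in $\mathbb{C}(z)$. *)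

theory Defs
  imports "HOL-Computational_Algebra.Computational_Algebra" "HOL-Computational_Algebra.Field_as_Ring"
begin

(* The embedding of C(z) into C((z)). The target is the Laurent rather than the power series
   ring because a rational function may have a pole at 0. *)
definition fls_of_ratfun :: "complex poly fract \<Rightarrow> complex fls" where
  "fls_of_ratfun R = (case quot_of_fract R of (p, q) \<Rightarrow>
     fps_to_fls (fps_of_poly p) / fps_to_fls (fps_of_poly q))"

(* The value does not depend on the fraction being in lowest terms. *)
lemma fls_of_ratfun_Fract:
  assumes "q \<noteq> 0"
  shows "fls_of_ratfun (Fract p q) =
    fps_to_fls (fps_of_poly p) / fps_to_fls (fps_of_poly q)"
proof -
  obtain r s where rs: "quot_of_fract (Fract p q) = (r, s)" by force
  have "s \<noteq> 0" "Fract r s = Fract p q"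
    using snd_quot_of_fract_nonzero[of "Fract p q"] Fract_quot_of_fract[of "Fract p q"]
    by (simp_all add: rs)
  hence "r * q = p * s"
    using assms by (simp add: eq_fract)
  hence "fps_to_fls (fps_of_poly r) * fps_to_fls (fps_of_poly q) =
      fps_to_fls (fps_of_poly p) * fps_to_fls (fps_of_poly s)"
    by (simp flip: fls_times_fps_to_fls fps_of_poly_mult)
  moreover have "fps_to_fls (fps_of_poly q) \<noteq> 0" "fps_to_fls (fps_of_poly s) \<noteq> 0"
    using \<open>q \<noteq> 0\<close> \<open>s \<noteq> 0\<close> fps_of_poly_eq_iff[of q 0] fps_of_poly_eq_iff[of s 0] by auto
  ultimately show ?thesis
    by (simp add: fls_of_ratfun_def rs frac_eq_eq)
qed

definition rational_fps :: "complex fps \<Rightarrow> bool" where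
  "rational_fps F \<longleftrightarrow> (\<exists>R. fps_to_fls F = fls_of_ratfun R)"

(* Substituting z^d into the Laurent expansion gives the expansion of the substituted fraction. *)
lemma fls_compose_power_fls_of_ratfun:
  assumes "q \<noteq> 0" "d > 0"
  shows "fls_compose_power (fls_of_ratfun (Fract p q)) d =
    fls_of_ratfun (Fract (pcompose p (monom 1 d)) (pcompose q (monom 1 d)))"
proof -
  have subst: "fls_compose_power (fps_to_fls (fps_of_poly r)) d =
      fps_to_fls (fps_of_poly (pcompose r (monom 1 d)))" for r :: "complex poly"
    using assms(2)
    by (simp add: fls_compose_power_fps_to_fls fps_of_poly_pcompose fps_of_poly_monom')
  have nz: "pcompose q (monom 1 d) \<noteq> 0"
    using assms by (simp add: pcompose_eq_0_iff degree_monom_eq)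
  have nz': "fps_to_fls (fps_of_poly r) \<noteq> 0" if "r \<noteq> 0" for r :: "complex poly"
    using that fps_of_poly_eq_iff[of r 0] by auto
  have "fls_compose_power (fls_of_ratfun (Fract p q)) d *
      fls_compose_power (fps_to_fls (fps_of_poly q)) d =
      fls_compose_power (fps_to_fls (fps_of_poly p)) d"
    using assms nz' by (simp add: fls_of_ratfun_Fract flip: fls_compose_power_mult)
  thus ?thesis
    using nz nz' by (simp add: fls_of_ratfun_Fract subst eq_divide_eq)
qed

end

theory Submission
  imports Defs "HOL-Analysis.Analysis" "HOL-Number_Theory.Number_Theory"
begin

text \<open>
A rational power series \<open>F = \<Sum> a n * z^n\<close> has coefficients that satisfy a linear recurrence. The
heart of the matter is that vanishing at all large primes forces \<open>a n = 0\<close> for \<^emph>\<open>all\<close> large \<open>n\<close>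
coprime to some fixed \<open>M > 1\<close> (lemma \<open>coprime_coeffs_vanish\<close>). Granted this, sort the remaining
exponents by their residue \<open>r\<close> modulo \<open>M\<close>. Each residue that occurs has \<open>g = gcd r M > 1\<close>, so its
part of \<open>F\<close> is a series in \<open>z^g\<close>; and this series is rational, because the subsequence of a linearly
recurrent sequence along an arithmetic progression is again linearly recurrent
(\<open>coprime_vanishing_decomposition\<close>).

For the vanishing, write the denominator of \<open>F\<close> as a product of factors \<open>1 - u * z\<close>. The finitely
many numbers that occur (the coefficients of the numerator, the \<open>u\<close> and their inverses) lie in a
subring \<open>R\<close> of the complex numbers with ideals \<open>R = I 0 \<supseteq> I 1 \<supseteq> I 2 \<supseteq> \<dots>\<close> such that
\<open>I i * I j \<subseteq> I (i + j)\<close>, the intersection of all \<open>I k\<close> is zero, and \<open>R / I 1\<close> is finite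
(\<open>filtered_ring_containing\<close>). Finiteness gives a common exponent \<open>N > 0\<close> with \<open>u^N \<equiv> 1\<close> modulo
\<open>I 1\<close> for all \<open>u\<close>, and an integer \<open>l > 0\<close> in \<open>I 1\<close>. Then \<open>u^(N * l^e) \<equiv> 1\<close> modulo \<open>I (e + 1)\<close>, and
modulo each \<open>I k\<close> the sequence \<open>a\<close> has, from a point on that does not depend on \<open>k\<close>, a period of the
form \<open>N * l^e\<close>. If \<open>n\<close> is coprime to \<open>N * l\<close>, then by Dirichlet's theorem some large prime \<open>p\<close> is
congruent to \<open>n\<close> modulo this period, so \<open>a n \<equiv> a p = 0\<close> modulo \<open>I k\<close>. This holds for every \<open>k\<close>, so
\<open>a n = 0\<close>. The argument takes the place of the Skolem-Mahler-Lech theorem. The filtered rings are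
built along a tower of simple extensions of the rationals: from powers of a prime, by polynomials in
an algebraic element, and by Taylor expansion in a transcendental one.

Dirichlet's theorem cannot be avoided. If \<open>r\<close> is coprime to \<open>M\<close> and only finitely many primes were
congruent to \<open>r\<close> modulo \<open>M\<close>, the statement would apply to \<open>z^r / (1 - z^M)\<close>; but this series has
arbitrarily large exponents that are coprime to any given \<open>d 1, \<dots>, d m\<close>. The proof below works
with the series \<open>L(s, \<chi>)\<close> at real \<open>s > 1\<close>. That
\<open>L(1, \<chi>) \<noteq> 0\<close> for nontrivial \<open>\<chi>\<close> has two parts. The product of all \<open>L(s, \<chi>)\<close> has logarithmic
derivative \<open>\<le> 0\<close>, so its absolute value cannot tend to 0 as \<open>s\<close> decreases to 1; as the trivial
character contributes only a simple pole, at most one \<open>\<chi>\<close> can vanish at 1, and that one equals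
its complex conjugate. A real \<open>\<chi>\<close> with \<open>L(1, \<chi>) = 0\<close> is excluded by its Lambert series, which would be bounded
near 1 although its power series has nonnegative coefficients that are at least 1 at all squares.

For the second claim take \<open>1 / (1 - z^2) + 1 / (1 - z^3)\<close>: its coefficients are nonzero at all powers
of 2 and at all powers of 3, so a single \<open>d\<close> would divide powers of both.
\<close>

unbundle no vec_syntax
hide_const (open) up_ring.coeff up_ring.monom module.smult

section \<open>Dirichlet characters\<close>

text \<open>
Characters of the unit group modulo \<open>m\<close>, extended by zero to functions on all natural numbers.
\<close>
definition dirichlet_char :: "nat \<Rightarrow> (nat \<Rightarrow> complex) \<Rightarrow> bool" where
  "dirichlet_char m \<chi> \<longleftrightarrow> \<chi> 1 = 1 \<and> (\<forall>a b. \<chi> (a * b) = \<chi> a * \<chi> b) \<and>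
     (\<forall>a. \<chi> (a + m) = \<chi> a) \<and> (\<forall>a. \<chi> a = 0 \<longleftrightarrow> \<not> coprime a m)"

definition periodic :: "nat \<Rightarrow> (nat \<Rightarrow> complex) \<Rightarrow> bool" where
  "periodic m f \<longleftrightarrow> (\<forall>a. f (a + m) = f a)"

lemma periodic_add_mult: "periodic m f \<Longrightarrow> f (a + k * m) = f a"
proof (induction k)
  case (Suc k)
  have "f (a + Suc k * m) = f ((a + k * m) + m)" by (simp add: algebra_simps)
  also have "\<dots> = f (a + k * m)" using Suc.prems unfolding periodic_def by blast
  finally show ?case using Suc by simp
qed simp

lemma periodic_mod: "periodic m f \<Longrightarrow> f (a mod m) = f a"
  using periodic_add_mult[of m f "a mod m" "a div m"] by (simp add: mult.commute)

lemma periodic_cong: "periodic m f \<Longrightarrow> [a = b] (mod m) \<Longrightarrow> f a = f b"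
  by (metis cong_def periodic_mod)

lemma cis_root_of_unity:
  assumes "h > 0"
  shows "cis (2 * pi * real l / real h) ^ h = 1"
proof -
  have "real h * (2 * pi * real l / real h) = 2 * pi * real l" using assms by simp
  thus ?thesis by (simp only: Complex.DeMoivre) (simp add: cis_multiple_2pi)
qed

lemma sum_inverse_roots_of_unity:
  assumes "j < h"
  shows "(\<Sum>l<h. inverse (cis (2 * pi * real l / real h)) ^ j) = (if j = 0 then of_nat h else 0)"
proof (cases "j = 0")
  case False
  define z where "z = cis (2 * pi * real j / real h)"
  have h: "h > 0" using assms by simp
  have inj: "inj_on (\<lambda>k. cis (2 * pi * real k / real h)) {..<h}"
    using Complex.bij_betw_roots_unity[OF h] by (simp add: bij_betw_def)
  have z1: "z \<noteq> 1"
    using inj_onD[OF inj, of j 0] assms False h by (auto simp: z_def)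
  have zh: "z ^ h = 1"
    using Complex.bij_betw_roots_unity[OF h] assms unfolding bij_betw_def z_def by blast
  have "inverse (cis (2 * pi * real l / real h)) ^ j = inverse z ^ l" for l
    by (simp add: z_def Complex.DeMoivre cis_inverse algebra_simps)
  hence "(\<Sum>l<h. inverse (cis (2 * pi * real l / real h)) ^ j) = (\<Sum>l<h. inverse z ^ l)" by simp
  also have "\<dots> = 0" using z1 zh
    by (subst geometric_sum) (auto simp: power_inverse)
  finally show ?thesis using False by simp
qed simp

text \<open>
For \<open>b\<close> a unit with \<open>b^h \<equiv> 1\<close> and \<open>w\<close> an \<open>h\<close>-th root of unity, this is \<open>h\<close> times the projection
of \<open>f\<close> to the \<open>w\<close>-eigenspace of the translation \<open>x \<mapsto> b * x\<close>.
\<close>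
definition eigenprojection :: "nat \<Rightarrow> nat \<Rightarrow> complex \<Rightarrow> (nat \<Rightarrow> complex) \<Rightarrow> nat \<Rightarrow> complex" where
  "eigenprojection h b w f x = (\<Sum>j<h. inverse w ^ j * f (b ^ j * x))"

lemma eigenprojection_eigen:
  assumes "periodic m f" "[b ^ h = 1] (mod m)" "w ^ h = 1" "h > 0"
  shows "eigenprojection h b w f (b * x) = w * eigenprojection h b w f x"
proof -
  define g where "g j = inverse w ^ j * f (b ^ j * x)" for j
  have w: "w \<noteq> 0" using assms by (auto simp: power_0_left)
  have "[b ^ h * x = 1 * x] (mod m)" using assms(2) by (rule cong_scalar_right)
  hence gh: "g h = g 0" using periodic_cong[OF assms(1)] assms(3)
    by (simp add: g_def power_inverse)
  have "eigenprojection h b w f (b * x) = (\<Sum>j<h. w * g (Suc j))"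
    unfolding eigenprojection_def g_def using w by (intro sum.cong) (auto simp: mult_ac)
  also have "\<dots> = w * (\<Sum>j<h. g (Suc j))" by (simp add: sum_distrib_left)
  also have "(\<Sum>j<h. g (Suc j)) = (\<Sum>j<h. g j)"
    using sum.lessThan_Suc_shift[of g h] sum.lessThan_Suc[of g h] gh by simp
  finally show ?thesis by (simp add: eigenprojection_def g_def)
qed

text \<open>
The sum over \<open>w\<close> kills every term with \<open>j \<noteq> 0\<close>. Consequently a nonzero \<open>f\<close> has a nonzero
projection for some \<open>w\<close>.
\<close>
lemma sum_eigenprojections:
  assumes "h > 0"
  shows "(\<Sum>l<h. eigenprojection h b (cis (2 * pi * real l / real h)) f x) = of_nat h * f x"
proof -
  have "(\<Sum>l<h. eigenprojection h b (cis (2 * pi * real l / real h)) f x) =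
        (\<Sum>j<h. (\<Sum>l<h. inverse (cis (2 * pi * real l / real h)) ^ j) * f (b ^ j * x))"
    unfolding eigenprojection_def by (subst sum.swap) (simp add: sum_distrib_right)
  also have "\<dots> = (\<Sum>j<h. (if j = 0 then of_nat h * f x else 0))"
    by (intro sum.cong refl) (subst sum_inverse_roots_of_unity, auto)
  also have "\<dots> = of_nat h * f x" using assms by (simp add: sum.delta)
  finally show ?thesis .
qed

text \<open>
The functions on the unit group modulo \<open>m\<close>, in the same encoding as the characters.
\<close>
definition unit_supported :: "nat \<Rightarrow> (nat \<Rightarrow> complex) \<Rightarrow> bool" where
  "unit_supported m f \<longleftrightarrow> periodic m f \<and> (\<forall>x. f x \<noteq> 0 \<longrightarrow> coprime x m)"

lemma unit_supported_eigenprojection: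
  assumes "unit_supported m f"
  shows "unit_supported m (eigenprojection h b w f)"
proof -
  have per: "periodic m f" and supp: "\<And>x. f x \<noteq> 0 \<Longrightarrow> coprime x m"
    using assms by (auto simp: unit_supported_def)
  have "f (b ^ j * (x + m)) = f (b ^ j * x)" for j x
    by (rule periodic_cong[OF per]) (simp add: cong_def algebra_simps)
  moreover have "coprime x m" if "eigenprojection h b w f x \<noteq> 0" for x
  proof -
    have "\<exists>j. f (b ^ j * x) \<noteq> 0"
    proof (rule ccontr)
      assume "\<not> ?thesis"
      hence "eigenprojection h b w f x = 0" by (simp add: eigenprojection_def)
      thus False using that by contradiction
    qed
    then obtain j where "f (b ^ j * x) \<noteq> 0" ..
    from supp[OF this] show ?thesis by (simp add: coprime_mult_left_iff)
  qed
  ultimately show ?thesis unfolding unit_supported_def periodic_def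
    by (auto simp: eigenprojection_def)
qed

lemma eigenprojection_nonzero:
  assumes "f x0 \<noteq> (0::complex)" "h > 0"
  obtains w where "w ^ h = 1" "\<exists>x. eigenprojection h b w f x \<noteq> 0"
proof -
  have "(\<Sum>l<h. eigenprojection h b (cis (2 * pi * real l / real h)) f x0) \<noteq> 0"
    using assms by (subst sum_eigenprojections) auto
  then obtain l where "l < h" "eigenprojection h b (cis (2 * pi * real l / real h)) f x0 \<noteq> 0"
    by (metis (no_types, lifting) lessThan_iff sum.neutral)
  moreover have "cis (2 * pi * real l / real h) ^ h = 1"
    using assms(2) by (rule cis_root_of_unity)
  ultimately show ?thesis using that by blast
qed

text \<open>
A character is, up to scaling, a nonzero function on the unit group that is an eigenfunction of all
translations. Start with the indicator function of 1. Since it is not invariant under translation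
by \<open>a\<close>, one of its projections for \<open>a\<close> with an eigenvalue \<open>w \<noteq> 1\<close> is nonzero. Projecting
successively for all other units keeps this eigenvalue, as translations commute.
\<close>
lemma dirichlet_char_separates:
  assumes m: "m > 0" and a: "coprime a m" "\<not> [a = 1] (mod m)"
  obtains \<chi> where "dirichlet_char m \<chi>" "\<chi> a \<noteq> 1"
proof -
  define h where "h = totient m"
  have h: "h > 0" using m by (simp add: h_def)
  have euler: "[b ^ h = 1] (mod m)" if "coprime b m" for b
    unfolding h_def using that by (rule euler_theorem)
  define f0 :: "nat \<Rightarrow> complex" where "f0 = (\<lambda>x. if [x = 1] (mod m) then 1 else 0)"
  have f0: "unit_supported m f0"
    unfolding unit_supported_def periodic_def f0_def
    using cong_imp_coprime[of 1 _ m] by (auto simp: cong_def)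
  have "\<exists>w f. w \<noteq> 1 \<and> unit_supported m f \<and> (\<exists>x. f x \<noteq> 0) \<and> (\<forall>x. f (a * x) = w * f x)"
  proof (rule ccontr)
    assume no: "\<not> ?thesis"
    define W where "W l = cis (2 * pi * real l / real h)" for l
    have Wh: "W l ^ h = 1" for l using h by (simp add: W_def cis_root_of_unity)
    have W1: "W l \<noteq> 1" if "0 < l" "l < h" for l
    proof
      assume "W l = 1"
      hence "W l = W 0" by (simp add: W_def)
      moreover have "inj_on W {..<h}"
        using Complex.bij_betw_roots_unity[OF h] unfolding bij_betw_def W_def[abs_def] by blast
      ultimately show False using that by (auto dest: inj_onD)
    qed
    have eig: "eigenprojection h a (W l) f0 (a * x) = W l * eigenprojection h a (W l) f0 x" for l x
      using f0 euler[OF a(1)] Wh h by (intro eigenprojection_eigen) (auto simp: unit_supported_def)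
    have "eigenprojection h a (W l) f0 x = 0" if "0 < l" "l < h" for l x
      using no W1[OF that] unit_supported_eigenprojection[OF f0] eig by blast
    hence "(\<Sum>l<h. eigenprojection h a (W l) f0 x) = (\<Sum>l<h. if l = 0 then eigenprojection h a (W 0) f0 x else 0)" for x
      by (intro sum.cong) auto
    hence "of_nat h * f0 x = eigenprojection h a (W 0) f0 x" for x
      using sum_eigenprojections[OF h, of a f0 x] h by (simp add: W_def sum.delta)
    hence "of_nat h * f0 (a * 1) = of_nat h * f0 1" using eig[of 0 1] by (simp add: W_def)
    thus False using h a by (simp add: f0_def)
  qed
  then obtain w f where w: "w \<noteq> 1" and f: "unit_supported m f" "\<exists>x. f x \<noteq> 0" "\<forall>x. f (a * x) = w * f x"
    by blast
  \<comment> \<open>Simultaneous eigenfunctions for a finite set \<open>B\<close> of units, by induction on \<open>B\<close>.\<close>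
  have "\<exists>g. unit_supported m g \<and> (\<exists>x. g x \<noteq> 0) \<and> (\<forall>x. g (a * x) = w * g x) \<and>
          (\<forall>b\<in>B. \<exists>v. \<forall>x. g (b * x) = v * g x)" if "finite B" "\<And>b. b \<in> B \<Longrightarrow> coprime b m" for B
    using that
  proof (induction B rule: finite_induct)
    case empty
    thus ?case using f by auto
  next
    case (insert b B)
    then obtain g where g: "unit_supported m g" "\<exists>x. g x \<noteq> 0" "\<forall>x. g (a * x) = w * g x"
        "\<forall>b\<in>B. \<exists>v. \<forall>x. g (b * x) = v * g x" by auto
    obtain v where v: "v ^ h = 1" "\<exists>x. eigenprojection h b v g x \<noteq> 0"
      using g(2) h eigenprojection_nonzero by metis
    let ?g = "eigenprojection h b v g"
    have comm: "?g (c * x) = u * ?g x" if "\<forall>x. g (c * x) = u * g x" for c u x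
    proof -
      have "g (b ^ j * (c * x)) = u * g (b ^ j * x)" for j
        using that by (metis mult.left_commute)
      thus ?thesis by (simp add: eigenprojection_def sum_distrib_left mult_ac)
    qed
    have "?g (b * x) = v * ?g x" for x
      using g(1) euler insert.prems v h by (intro eigenprojection_eigen) (auto simp: unit_supported_def)
    hence "\<forall>c\<in>insert b B. \<exists>u. \<forall>x. ?g (c * x) = u * ?g x"
      using comm g(4) by (metis insert_iff)
    thus ?case using unit_supported_eigenprojection[OF g(1)] v(2) comm[OF g(3)] by blast
  qed
  moreover have "finite {b. b \<le> m \<and> coprime b m}"
    "\<And>b. b \<in> {b. b \<le> m \<and> coprime b m} \<Longrightarrow> coprime b m" by auto
  ultimately have "\<exists>g. unit_supported m g \<and> (\<exists>x. g x \<noteq> 0) \<and> (\<forall>x. g (a * x) = w * g x) \<and>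
      (\<forall>b\<in>{b. b \<le> m \<and> coprime b m}. \<exists>v. \<forall>x. g (b * x) = v * g x)" by blast
  then obtain g where
     g: "unit_supported m g" "\<exists>x. g x \<noteq> 0" "\<forall>x. g (a * x) = w * g x"
        "\<And>b. b \<le> m \<Longrightarrow> coprime b m \<Longrightarrow> \<exists>v. \<forall>x. g (b * x) = v * g x"
    by blast
  have per: "periodic m g" and supp: "\<And>x. g x \<noteq> 0 \<Longrightarrow> coprime x m"
    using g(1) by (auto simp: unit_supported_def)
  have g4: "\<exists>v. \<forall>x. g (b * x) = v * g x" if "coprime b m" for b
  proof -
    have "coprime (b mod m) m" "b mod m \<le> m" using that m by (auto simp: less_imp_le)
    then obtain v where v: "\<forall>x. g (b mod m * x) = v * g x" using g(4) by blast
    have "g (b mod m * x) = g (b * x)" for x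
      by (rule periodic_cong[OF per]) (simp add: cong_def mod_mult_left_eq)
    thus ?thesis using v by metis
  qed
  obtain x0 where x0: "g x0 \<noteq> 0" using g(2) by blast
  have g1: "g 1 \<noteq> 0" using g4[OF supp[OF x0]] x0 by (metis mult.right_neutral mult_zero_right)
  define \<chi> where "\<chi> n = g n / g 1" for n
  have mult: "\<chi> (b * c) = \<chi> b * \<chi> c" for b c
  proof (cases "coprime b m")
    case True
    then obtain v where "\<forall>x. g (b * x) = v * g x" using g4 by blast
    hence "g (b * c) = v * g c" "g b = v * g 1" by (metis, metis mult.right_neutral)
    thus ?thesis using g1 by (simp add: \<chi>_def)
  next
    case False
    hence "g b = 0" "g (b * c) = 0" using supp coprime_mult_left_iff by blast+
    thus ?thesis by (simp add: \<chi>_def)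
  qed
  have nz: "\<chi> b \<noteq> 0" if "coprime b m" for b
  proof -
    have "\<chi> (b ^ h) = \<chi> 1" using periodic_cong[OF per euler[OF that]] by (simp add: \<chi>_def)
    moreover have "\<chi> (b ^ Suc k) = \<chi> b * \<chi> (b ^ k)" for k using mult by simp
    ultimately show ?thesis using h g1
      by (metis \<chi>_def divide_self_if gr0_implies_Suc mult_zero_left zero_neq_one)
  qed
  have "dirichlet_char m \<chi>"
    unfolding dirichlet_char_def
  proof (intro conjI allI)
    show "\<chi> 1 = 1" using g1 by (simp add: \<chi>_def)
    show "\<chi> (b + m) = \<chi> b" for b using per by (simp add: \<chi>_def periodic_def)
    show "\<chi> b = 0 \<longleftrightarrow> \<not> coprime b m" for b
      using nz[of b] supp[of b] by (cases "coprime b m") (auto simp: \<chi>_def)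
  qed (rule mult)
  moreover have "\<chi> a \<noteq> 1" using g(3) g1 w by (metis \<chi>_def divide_eq_1_iff mult.right_neutral mult_cancel_right1)
  ultimately show ?thesis using that by blast
qed

definition dirichlet_chars :: "nat \<Rightarrow> (nat \<Rightarrow> complex) set" where
  "dirichlet_chars m = {\<chi>. dirichlet_char m \<chi>}"

definition trivial_char :: "nat \<Rightarrow> nat \<Rightarrow> complex" where
  "trivial_char m n = (if coprime n m then 1 else 0)"

lemma dirichlet_char_trivial: "m > 0 \<Longrightarrow> dirichlet_char m (trivial_char m)"
proof -
  have "coprime (a + m) m \<longleftrightarrow> coprime a m" for a :: nat
    by (simp add: coprime_iff_gcd_eq_1 del: coprime_imp_gcd_eq_1)
  thus ?thesis by (auto simp: dirichlet_char_def trivial_char_def coprime_mult_left_iff)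
qed

lemma dirichlet_char_periodic: "dirichlet_char m \<chi> \<Longrightarrow> periodic m \<chi>"
  by (simp add: dirichlet_char_def periodic_def)

lemma dirichlet_char_mult: "dirichlet_char m \<chi> \<Longrightarrow> \<chi> (a * b) = \<chi> a * \<chi> b"
  by (simp add: dirichlet_char_def)

lemma dirichlet_char_power: "dirichlet_char m \<chi> \<Longrightarrow> \<chi> (a ^ k) = \<chi> a ^ k"
  by (induction k) (auto simp: dirichlet_char_def)

lemma dirichlet_char_power_totient:
  assumes "dirichlet_char m \<chi>" "coprime a m"
  shows "\<chi> a ^ totient m = 1"
  using periodic_cong[OF dirichlet_char_periodic[OF assms(1)] euler_theorem[OF assms(2)]] assms
  by (simp add: dirichlet_char_power) (simp add: dirichlet_char_def)

lemma dirichlet_char_norm_coprime: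
  assumes "m > 0" "dirichlet_char m \<chi>" "coprime a m"
  shows "norm (\<chi> a) = 1"
  using power_eq_1_iff[OF dirichlet_char_power_totient[OF assms(2,3)]] assms(1) by simp

lemma dirichlet_char_norm_le:
  assumes "m > 0" "dirichlet_char m \<chi>"
  shows "norm (\<chi> a) \<le> 1"
proof (cases "coprime a m")
  case False
  hence "\<chi> a = 0" using assms(2) by (simp add: dirichlet_char_def)
  thus ?thesis by simp
qed (simp add: dirichlet_char_norm_coprime[OF assms])

lemma finite_dirichlet_chars:
  assumes "m > 0" shows "finite (dirichlet_chars m)"
proof -
  let ?V = "insert 0 {z::complex. z ^ totient m = 1}"
  have "finite ?V" using assms by (simp add: finite_roots_unity Suc_leI)
  hence fin: "finite ({..<m} \<rightarrow>\<^sub>E ?V)" by (intro finite_PiE) auto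
  have inj: "inj_on (\<lambda>\<chi>. restrict \<chi> {..<m}) (dirichlet_chars m)"
  proof (rule inj_onI)
    fix \<chi> \<psi> assume *: "\<chi> \<in> dirichlet_chars m" "\<psi> \<in> dirichlet_chars m"
      "restrict \<chi> {..<m} = restrict \<psi> {..<m}"
    have "\<chi> (n mod m) = \<psi> (n mod m)" for n
      using *(3) assms by (metis lessThan_iff mod_less_divisor restrict_apply')
    thus "\<chi> = \<psi>" using * by (auto simp: dirichlet_chars_def periodic_mod dirichlet_char_periodic)
  qed
  have "(\<lambda>\<chi>. restrict \<chi> {..<m}) ` dirichlet_chars m \<subseteq> {..<m} \<rightarrow>\<^sub>E ?V"
  proof (rule image_subsetI)
    fix \<chi> assume "\<chi> \<in> dirichlet_chars m"
    hence "dirichlet_char m \<chi>" by (simp add: dirichlet_chars_def)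
    hence "\<chi> n \<in> ?V" for n
      using dirichlet_char_power_totient[of m \<chi> n] by (cases "coprime n m") (auto simp: dirichlet_char_def)
    thus "restrict \<chi> {..<m} \<in> {..<m} \<rightarrow>\<^sub>E ?V" by auto
  qed
  thus ?thesis using fin inj inj_on_finite by blast
qed

text \<open>
Multiplication by a character \<open>\<psi>\<close> with \<open>\<psi> n \<noteq> 1\<close> permutes the characters, so the sum is fixed
under multiplication by \<open>\<psi> n\<close>.
\<close>
lemma dirichlet_chars_orthogonality:
  assumes "m > 0"
  shows "(\<Sum>\<chi>\<in>dirichlet_chars m. \<chi> n) =
           (if [n = 1] (mod m) then of_nat (card (dirichlet_chars m)) else 0)"
proof (cases "coprime n m \<and> \<not> [n = 1] (mod m)")
  case True
  then obtain \<psi> where \<psi>: "dirichlet_char m \<psi>" "\<psi> n \<noteq> 1"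
    using dirichlet_char_separates[OF assms] by blast
  have h: "totient m > 0" using assms by simp
  define \<psi>' where "\<psi>' k = cnj (\<psi> k)" for k
  have inv: "\<psi> k * \<psi>' k = 1" if "coprime k m" for k
    using dirichlet_char_norm_coprime[OF assms \<psi>(1) that]
    by (simp add: \<psi>'_def complex_norm_square[symmetric])
  have \<psi>': "dirichlet_char m \<psi>'" using \<psi>(1) by (auto simp: dirichlet_char_def \<psi>'_def)
  have closed: "(\<lambda>k. \<alpha> k * \<beta> k) \<in> dirichlet_chars m" if "\<alpha> \<in> dirichlet_chars m" "dirichlet_char m \<beta>" for \<alpha> \<beta>
    using that by (auto simp: dirichlet_chars_def dirichlet_char_def)
  have cancel: "(\<lambda>k. \<alpha> k * \<beta> k * \<gamma> k) = \<alpha>"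
    if "\<alpha> \<in> dirichlet_chars m" "\<And>k. coprime k m \<Longrightarrow> \<beta> k * \<gamma> k = 1" for \<alpha> \<beta> \<gamma> :: "nat \<Rightarrow> complex"
    using that by (fastforce simp: dirichlet_chars_def dirichlet_char_def mult.assoc)
  have "(\<Sum>\<chi>\<in>dirichlet_chars m. \<chi> n * \<psi> n) = (\<Sum>\<chi>\<in>dirichlet_chars m. \<chi> n)"
    by (rule sum.reindex_bij_witness[of _ "\<lambda>\<chi> k. \<chi> k * \<psi>' k" "\<lambda>\<chi> k. \<chi> k * \<psi> k"])
       (use cancel[of _ \<psi> \<psi>'] cancel[of _ \<psi>' \<psi>] closed \<psi>(1) \<psi>' inv in \<open>auto simp: mult.commute\<close>)
  hence "(\<Sum>\<chi>\<in>dirichlet_chars m. \<chi> n) = (\<Sum>\<chi>\<in>dirichlet_chars m. \<chi> n * \<psi> n)" ..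
  also have "\<dots> = (\<Sum>\<chi>\<in>dirichlet_chars m. \<chi> n) * \<psi> n" by (simp add: sum_distrib_right)
  finally show ?thesis using \<psi>(2) True by simp
next
  case False
  show ?thesis
  proof (cases "[n = 1] (mod m)")
    case True
    hence "\<chi> n = 1" if "\<chi> \<in> dirichlet_chars m" for \<chi>
      using that periodic_cong[of m \<chi> n 1] dirichlet_char_periodic
      by (auto simp: dirichlet_chars_def) (auto simp: dirichlet_char_def)
    hence "(\<Sum>\<chi>\<in>dirichlet_chars m. \<chi> n) = (\<Sum>\<chi>\<in>dirichlet_chars m. 1)" by (rule sum.cong[OF refl])
    thus ?thesis using True by simp
  next
    case nc: False
    with False have "\<not> coprime n m" by blast
    hence "\<chi> n = 0" if "\<chi> \<in> dirichlet_chars m" for \<chi>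
      using that by (auto simp: dirichlet_chars_def dirichlet_char_def)
    hence "(\<Sum>\<chi>\<in>dirichlet_chars m. \<chi> n) = 0" by (rule sum.neutral[OF ballI])
    thus ?thesis using nc by simp
  qed
qed

lemma dirichlet_char_sum_zero:
  assumes "m > 0" "dirichlet_char m \<chi>" "\<chi> \<noteq> trivial_char m"
  shows "(\<Sum>n<m. \<chi> n) = 0"
proof -
  obtain a where a: "coprime a m" "\<chi> a \<noteq> 1"
    using assms(2,3) by (auto simp: trivial_char_def fun_eq_iff dirichlet_char_def split: if_splits)
  have "(\<Sum>n<m. \<chi> n) = (\<Sum>n<m. \<chi> (a * n mod m))"
  proof (rule sum.reindex_bij_betw[symmetric])
    have inj: "inj_on (\<lambda>n. a * n mod m) {..<m}"
      using a(1) by (intro inj_onI) (metis cong_def cong_mult_lcancel_nat lessThan_iff mod_less)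
    moreover have "(\<lambda>n. a * n mod m) ` {..<m} \<subseteq> {..<m}" using assms(1) by auto
    ultimately show "bij_betw (\<lambda>n. a * n mod m) {..<m} {..<m}"
      unfolding bij_betw_def by (simp add: endo_inj_surj)
  qed
  also have "\<dots> = (\<Sum>n<m. \<chi> a * \<chi> n)"
    using periodic_mod[OF dirichlet_char_periodic[OF assms(2)]] dirichlet_char_mult[OF assms(2)] by simp
  also have "\<dots> = \<chi> a * (\<Sum>n<m. \<chi> n)" by (simp add: sum_distrib_left)
  finally show ?thesis using a(2) by simp
qed

section \<open>Dirichlet series at real arguments\<close>

definition dirichlet_series :: "(nat \<Rightarrow> complex) \<Rightarrow> real \<Rightarrow> complex" where
  "dirichlet_series a s = (\<Sum>n. a n * of_real (real n powr -s))"

text \<open>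
This is the majorant for all Dirichlet series below: their coefficients are bounded by
\<open>1 + ln n\<close>. The logarithm is absorbed by half of the excess of \<open>s\<close> over 1.
\<close>
lemma summable_ln_powr:
  assumes "s > 1"
  shows "summable (\<lambda>n. (1 + ln (real n)) * real n powr -s)"
proof (rule summable_comparison_test')
  define d where "d = (s - 1) / 2"
  have d: "d > 0" "-(s - d) < -1" using assms by (auto simp: d_def field_simps)
  show "summable (\<lambda>n. real n powr -s + (1 / d) * real n powr -(s - d))"
    using assms d summable_real_powr_iff[of "-s"] summable_real_powr_iff[of "-(s - d)"]
    by (intro summable_add summable_mult) simp_all
  fix n :: nat assume n: "n \<ge> 1"
  have "ln (real n) * real n powr -s \<le> (real n powr d / d) * real n powr -s"
    using n d by (intro mult_right_mono ln_powr_bound) auto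
  also have "\<dots> = (1 / d) * real n powr -(s - d)" by (simp add: powr_add [symmetric])
  finally show "norm ((1 + ln (real n)) * real n powr -s) \<le> real n powr -s + (1 / d) * real n powr -(s - d)"
    using n by (simp add: algebra_simps)
qed

lemma dirichlet_series_norm_summable:
  fixes a :: "nat \<Rightarrow> complex"
  assumes "s > 1" "\<And>n. n > 0 \<Longrightarrow> norm (a n) \<le> 1 + ln (real n)"
  shows "summable (\<lambda>n. norm (a n * of_real (real n powr -s)))"
proof (rule summable_comparison_test'[OF summable_ln_powr[OF assms(1)]])
  fix n :: nat assume "n \<ge> 1"
  thus "norm (norm (a n * of_real (real n powr -s))) \<le> (1 + ln (real n)) * real n powr -s"
    using assms(2)[of n] by (simp add: norm_mult mult_right_mono)
qed

lemma dirichlet_series_has_sum: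
  assumes "s > 1" "\<And>n. n > 0 \<Longrightarrow> norm (a n) \<le> 1 + ln (real n)"
  shows "((\<lambda>n. a n * of_real (real n powr -s)) has_sum dirichlet_series a s) {1..}"
    and "(\<lambda>n. norm (a n * of_real (real n powr -s))) summable_on {1..}"
proof -
  let ?f = "\<lambda>n. a n * of_real (real n powr -s)"
  have "summable ?f" by (rule summable_norm_cancel[OF dirichlet_series_norm_summable[OF assms]])
  hence "(?f has_sum dirichlet_series a s) UNIV"
    unfolding dirichlet_series_def using assms
    by (intro norm_summable_imp_has_sum dirichlet_series_norm_summable) (auto simp: summable_sums)
  also have "?this \<longleftrightarrow> (?f has_sum dirichlet_series a s) {1..}"
  proof (rule has_sum_cong_neutral)
    fix n :: nat assume "n \<in> UNIV - {1..}"
    hence "n = 0" by auto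
    thus "?f n = 0" by simp
  qed auto
  finally show "(?f has_sum dirichlet_series a s) {1..}" .
  have "(\<lambda>n. norm (?f n)) summable_on UNIV"
    using dirichlet_series_norm_summable[of s a] assms
    by (intro norm_summable_imp_summable_on) auto
  thus "(\<lambda>n. norm (?f n)) summable_on {1..}" by (rule summable_on_subset_banach) auto
qed

text \<open>
The pairs \<open>(d, k)\<close> of positive integers are grouped by their product. Both Dirichlet convolution and
the power series of a Lambert series come from this rearrangement.
\<close>
lemma has_sum_divisors:
  fixes h :: "nat \<Rightarrow> nat \<Rightarrow> 'a::{topological_comm_monoid_add, t3_space}"
  assumes "((\<lambda>(d, k). h d k) has_sum S) ({1..} \<times> {1..})"
  shows "((\<lambda>n. \<Sum>d | d dvd n. h d (n div d)) has_sum S) {1..}"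
proof -
  have "((\<lambda>(n, d). h d (n div d)) has_sum S) (SIGMA n:{1..}. {d. d dvd n})"
  proof (subst has_sum_reindex_bij_witness[where i = "\<lambda>(d, k). (d * k, d)" and j = "\<lambda>(n, d). (d, n div d)"
      and T = "{1..} \<times> {1..}" and h = "\<lambda>(d, k). h d k" and s' = S])
    show "((\<lambda>(d, k). h d k) has_sum S) ({1..} \<times> {1..})" by fact
  qed (auto simp: Suc_le_eq elim!: dvdE intro!: Nat.gr0I)
  thus ?thesis
  proof (rule has_sum_SigmaD)
    fix n :: nat assume "n \<in> {1..}"
    hence "finite {d. d dvd n}" by simp
    thus "((\<lambda>d. case (n, d) of (n, d) \<Rightarrow> h d (n div d)) has_sum (\<Sum>d | d dvd n. h d (n div d))) {d. d dvd n}"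
      by simp
  qed
qed

lemma has_sum_Times_mult:
  fixes f g :: "nat \<Rightarrow> 'a::{banach, real_normed_field}"
  assumes "(f has_sum F) A" "(g has_sum G) B" "(\<lambda>n. norm (f n)) summable_on A" "(\<lambda>n. norm (g n)) summable_on B"
  shows "((\<lambda>(x, y). f x * g y) has_sum (F * G)) (A \<times> B)"
proof -
  have "(\<lambda>xy. norm (case xy of (x, y) \<Rightarrow> f x * g y)) summable_on A \<times> B"
    unfolding Infinite_Sum.abs_summable_on_Sigma_iff using assms
    by (auto simp: norm_mult abs_mult infsum_cmult_right intro!: summable_on_cmult_right summable_on_cmult_left)
  hence summable: "(\<lambda>(x, y). f x * g y) summable_on A \<times> B" by (rule Infinite_Sum.abs_summable_summable)
  show ?thesis
  proof (rule has_sum_SigmaI[OF _ _ summable])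
    fix x assume "x \<in> A"
    show "((\<lambda>y. case (x, y) of (x, y) \<Rightarrow> f x * g y) has_sum (f x * G)) B"
      using has_sum_cmult_right[OF assms(2)] by simp
  next
    show "((\<lambda>x. f x * G) has_sum (F * G)) A" by (rule has_sum_cmult_left) fact
  qed
qed

lemma dirichlet_series_mult:
  assumes "s > 1" "\<And>n. n > 0 \<Longrightarrow> norm (a n) \<le> 1 + ln (real n)"
    "\<And>n. n > 0 \<Longrightarrow> norm (b n) \<le> 1 + ln (real n)"
    "\<And>n. n > 0 \<Longrightarrow> norm (c n) \<le> 1 + ln (real n)"
    "\<And>n. n > 0 \<Longrightarrow> c n = (\<Sum>d | d dvd n. a d * b (n div d))"
  shows "dirichlet_series a s * dirichlet_series b s = dirichlet_series c s"
proof -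
  have "((\<lambda>(d, k). a d * of_real (real d powr -s) * (b k * of_real (real k powr -s)))
      has_sum (dirichlet_series a s * dirichlet_series b s)) ({1..} \<times> {1..})"
    using assms by (intro has_sum_Times_mult dirichlet_series_has_sum) auto
  from has_sum_divisors[OF this]
  have "((\<lambda>n. \<Sum>d | d dvd n. a d * of_real (real d powr -s) *
      (b (n div d) * of_real (real (n div d) powr -s))) has_sum (dirichlet_series a s * dirichlet_series b s)) {1..}" .
  also have "?this \<longleftrightarrow> ((\<lambda>n. c n * of_real (real n powr -s)) has_sum (dirichlet_series a s * dirichlet_series b s)) {1..}"
  proof (rule has_sum_cong)
    fix n :: nat assume n: "n \<in> {1..}"
    have "(\<Sum>d | d dvd n. a d * of_real (real d powr -s) * (b (n div d) * of_real (real (n div d) powr -s))) =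
          (\<Sum>d | d dvd n. a d * b (n div d) * of_real (real n powr -s))"
    proof (rule sum.cong[OF refl])
      fix d assume d: "d \<in> {d. d dvd n}"
      hence "real d powr -s * real (n div d) powr -s = real n powr -s"
        using n by (simp add: powr_mult[symmetric] flip: of_nat_mult)
      hence "(of_real (real d powr -s) * of_real (real (n div d) powr -s) :: complex) = of_real (real n powr -s)"
        by (metis of_real_mult)
      thus "a d * of_real (real d powr -s) * (b (n div d) * of_real (real (n div d) powr -s)) =
            a d * b (n div d) * of_real (real n powr -s)" by (simp add: mult_ac)
    qed
    thus "(\<Sum>d | d dvd n. a d * of_real (real d powr -s) * (b (n div d) * of_real (real (n div d) powr -s))) =
          c n * of_real (real n powr -s)" using n assms(5) by (simp add: sum_distrib_right)
  qed
  finally show ?thesis by (rule has_sum_unique) (rule dirichlet_series_has_sum(1)[OF assms(1,4)])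
qed

text \<open>
Termwise differentiation, justified by uniform convergence of the differentiated series on
\<open>{s0..}\<close> for some \<open>s0\<close> strictly between 1 and \<open>s\<close>.
\<close>
lemma real_dirichlet_series_deriv:
  assumes "s > 1" "\<And>n. \<bar>c n\<bar> \<le> (1::real)"
  shows "((\<lambda>s. \<Sum>n. c n * real n powr -s) has_field_derivative
           (\<Sum>n. -(ln (real n) * c n) * real n powr -s)) (at s)"
proof -
  define s0 where "s0 = (1 + s) / 2"
  have s0: "1 < s0" "s0 < s" using assms by (auto simp: s0_def)
  show ?thesis
  proof (rule has_field_derivative_series'(2)[where S = "{s0..}" and ?x0.0 = s])
    show "((\<lambda>s. c n * real n powr -s) has_field_derivative -(ln (real n) * c n) * real n powr -x)
        (at x within {s0..})" for n x
    proof (cases "n = 0")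
      case False
      have "((\<lambda>s. c n * exp (-s * ln (real n))) has_field_derivative
              c n * (exp (-x * ln (real n)) * (-1 * ln (real n)))) (at x within {s0..})"
        by (auto intro!: derivative_eq_intros)
      thus ?thesis using False by (simp add: powr_def mult_ac)
    qed simp
    show "uniformly_convergent_on {s0..} (\<lambda>n x. \<Sum>i<n. -(ln (real i) * c i) * real i powr -x)"
    proof (rule Weierstrass_m_test')
      show "summable (\<lambda>n. (1 + ln (real n)) * real n powr -s0)" using s0 by (intro summable_ln_powr)
      fix n :: nat and x assume x: "x \<in> {s0..}"
      show "norm (-(ln (real n) * c n) * real n powr -x) \<le> (1 + ln (real n)) * real n powr -s0"
      proof (cases "n = 0")
        case False
        hence "ln (real n) * \<bar>c n\<bar> \<le> ln (real n) * 1" by (intro mult_left_mono assms) auto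
        hence "ln (real n) * \<bar>c n\<bar> * real n powr -x \<le> (1 + ln (real n)) * real n powr -s0"
          using False x by (intro mult_mono) (auto intro!: powr_mono)
        thus ?thesis using False by (simp add: abs_mult)
      qed simp
    qed
    show "summable (\<lambda>n. c n * real n powr -s)"
    proof (rule summable_comparison_test'[OF summable_ln_powr[OF assms(1)]])
      fix n :: nat assume "n \<ge> 1"
      thus "norm (c n * real n powr -s) \<le> (1 + ln (real n)) * real n powr -s"
        using assms(2)[of n] by (auto simp: abs_mult intro!: mult_right_mono order.trans[OF assms(2)])
    qed
    show "s \<in> interior {s0..}" using s0 by simp
  qed (use s0 in auto)
qed

lemma dirichlet_series_deriv:
  assumes "s > 1" "\<And>n. norm (a n) \<le> 1"
  shows "(dirichlet_series a has_vector_derivative -dirichlet_series (\<lambda>n. of_real (ln (real n)) * a n) s) (at s)"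
proof -
  have le: "norm (of_real (ln (real n)) * a n) \<le> 1 + ln (real n)" if "n > 0" for n
  proof -
    have "ln (real n) * norm (a n) \<le> ln (real n) * 1" using that by (intro mult_left_mono assms) auto
    thus ?thesis using that by (simp add: norm_mult)
  qed
  have sm: "summable (\<lambda>n. of_real (ln (real n)) * a n * of_real (real n powr -s))"
    using le assms(1) by (intro summable_norm_cancel[OF dirichlet_series_norm_summable]) auto
  have sm': "summable (\<lambda>n. a n * of_real (real n powr -t))" if "t > 1" for t
  proof (rule summable_norm_cancel[OF dirichlet_series_norm_summable[OF that]])
    show "norm (a n) \<le> 1 + ln (real n)" if "n > 0" for n
      using assms(2)[of n] ln_ge_zero[of "real n"] that by linarith
  qed
  have nbhd: "\<forall>\<^sub>F t in nhds s. t > 1" using eventually_nhds_in_open[of "{1<..}" s] assms(1) by simp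
  have main: "((\<lambda>x. \<phi> (dirichlet_series a x)) has_field_derivative
      \<phi> (- dirichlet_series (\<lambda>n. of_real (ln (real n)) * a n) s)) (at s)"
    if lin: "bounded_linear \<phi>" and real: "\<And>z x. \<phi> (z * of_real x) = \<phi> z * x" and le_norm: "\<And>z. \<bar>\<phi> z\<bar> \<le> norm z"
    for \<phi> :: "complex \<Rightarrow> real"
  proof -
    have "\<bar>\<phi> (a n)\<bar> \<le> 1" for n using le_norm[of "a n"] assms(2)[of n] by linarith
    from real_dirichlet_series_deriv[OF assms(1) this]
    have "((\<lambda>s. \<Sum>n. \<phi> (a n) * real n powr -s) has_field_derivative
           (\<Sum>n. -(ln (real n) * \<phi> (a n)) * real n powr -s)) (at s)" .
    also have "(\<Sum>n. -(ln (real n) * \<phi> (a n)) * real n powr -s) =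
        (\<Sum>n. \<phi> (- (of_real (ln (real n)) * a n * of_real (real n powr -s))))"
      using real by (intro suminf_cong) (simp add: bounded_linear.linear[OF lin, THEN linear_neg] mult.commute[of _ "a _"])
    also have "\<dots> = \<phi> (- dirichlet_series (\<lambda>n. of_real (ln (real n)) * a n) s)"
      unfolding dirichlet_series_def suminf_minus[OF sm, symmetric]
      using sm by (intro bounded_linear.suminf[OF lin, symmetric]) (simp add: summable_minus_iff)
    finally have D: "((\<lambda>s. \<Sum>n. \<phi> (a n) * real n powr -s) has_field_derivative
        \<phi> (- dirichlet_series (\<lambda>n. of_real (ln (real n)) * a n) s)) (at s)" .
    have ev: "\<forall>\<^sub>F t in nhds s. \<phi> (dirichlet_series a t) = (\<Sum>n. \<phi> (a n) * real n powr -t)"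
      using nbhd by eventually_elim (simp add: dirichlet_series_def bounded_linear.suminf[OF lin sm'] real)
    show ?thesis using D DERIV_cong_ev[OF refl ev refl] by blast
  qed
  show ?thesis unfolding has_vector_derivative_complex_iff
    by (intro conjI main bounded_linear_Re bounded_linear_Im abs_Re_le_cmod abs_Im_le_cmod) auto
qed

section \<open>Nontrivial characters near 1\<close>

lemma char_block_sum:
  assumes "m > 0" "dirichlet_char m \<chi>" "\<chi> \<noteq> trivial_char m"
  shows "(\<Sum>k<N + m. \<chi> k) = (\<Sum>k<N. \<chi> k)"
proof (induction N)
  case 0
  show ?case using dirichlet_char_sum_zero[OF assms] by simp
next
  case (Suc N)
  have "\<chi> (N + m) = \<chi> N" using assms(2) by (simp add: dirichlet_char_def)
  thus ?case using Suc by simp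
qed

text \<open>
A full period of a nontrivial character sums to zero, so only an incomplete period counts.
\<close>
lemma char_sum_bound:
  assumes "m > 0" "dirichlet_char m \<chi>" "\<chi> \<noteq> trivial_char m"
  shows "norm (\<Sum>k<N. \<chi> k) \<le> real m"
proof (induction N rule: less_induct)
  case (less N)
  show ?case
  proof (cases "N < m")
    case True
    have "norm (\<Sum>k<N. \<chi> k) \<le> (\<Sum>k<N. 1)"
      by (intro sum_norm_le dirichlet_char_norm_le[OF assms(1,2)])
    thus ?thesis using True by simp
  next
    case False
    hence "(\<Sum>k<N. \<chi> k) = (\<Sum>k<N - m. \<chi> k)" using char_block_sum[OF assms, of "N - m"] by simp
    thus ?thesis using less[of "N - m"] False assms(1) by simp
  qed
qed

lemma summation_by_parts:
  fixes c :: "nat \<Rightarrow> 'a::real_vector"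
  assumes "a \<le> b"
  shows "(\<Sum>n=a..<b. f n *\<^sub>R c n) = f b *\<^sub>R (\<Sum>k<b. c k) - f a *\<^sub>R (\<Sum>k<a. c k)
           + (\<Sum>n=a..<b. (f n - f (Suc n)) *\<^sub>R (\<Sum>k<Suc n. c k))"
  using assms by (induction b rule: dec_induct) (auto simp: algebra_simps)

lemma abel_bound:
  fixes c :: "nat \<Rightarrow> 'a::real_normed_vector"
  assumes M: "\<And>N. norm (\<Sum>k<N. c k) \<le> M" and ab: "a \<le> b"
    and f: "\<And>n. a \<le> n \<Longrightarrow> f (Suc n) \<le> f n" "\<And>n. a \<le> n \<Longrightarrow> f n \<ge> 0"
  shows "norm (\<Sum>n=a..<b. f n *\<^sub>R c n) \<le> 2 * M * f a"
proof -
  have M0: "M \<ge> 0" using M[of 0] by simp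
  have "norm (\<Sum>n=a..<b. f n *\<^sub>R c n) \<le> norm (f b *\<^sub>R (\<Sum>k<b. c k)) + norm (f a *\<^sub>R (\<Sum>k<a. c k))
           + norm (\<Sum>n=a..<b. (f n - f (Suc n)) *\<^sub>R (\<Sum>k<Suc n. c k))"
  proof -
    have tri: "norm (x - y + z) \<le> norm x + norm y + norm z" for x y z :: 'a
      using norm_triangle_ineq[of "x - y" z] norm_triangle_ineq4[of x y] by linarith
    show ?thesis by (subst summation_by_parts[OF ab]) (rule tri)
  qed
  also have "\<dots> \<le> f b * M + f a * M + (\<Sum>n=a..<b. (f n - f (Suc n)) * M)"
    using f ab by (intro add_mono sum_norm_le) (auto intro!: mult_left_mono M simp del: sum.lessThan_Suc)
  also have "(\<Sum>n=a..<b. (f n - f (Suc n)) * M) = (f a - f b) * M"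
    using ab by (simp add: sum_distrib_right[symmetric] sum_Suc_diff'[of a b "\<lambda>n. - f n", simplified])
  finally show ?thesis by (simp add: algebra_simps)
qed

definition dirichlet_partial :: "(nat \<Rightarrow> complex) \<Rightarrow> real \<Rightarrow> nat \<Rightarrow> complex" where
  "dirichlet_partial a s N = (\<Sum>n<N. a n * of_real (real n powr -s))"

definition log_twist :: "(nat \<Rightarrow> complex) \<Rightarrow> nat \<Rightarrow> complex" where
  "log_twist a n = of_real (ln (real n)) * a n"

text \<open>
The weights \<open>ln n * n^(-s)\<close> decrease only from \<open>n = 3\<close> on (that is, beyond \<open>exp 1\<close>), so the term for
\<open>n = 2\<close> is estimated separately. What matters is that the bound is uniform in \<open>s \<ge> 1\<close> and in \<open>N\<close>.
\<close>
lemma log_twist_part_bound: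
  assumes "m > 0" "dirichlet_char m \<chi>" "\<chi> \<noteq> trivial_char m" "s \<ge> 1"
  shows "norm (dirichlet_partial (log_twist \<chi>) s N) \<le> 4 * real m + 1"
proof -
  define f where "f n = ln (real n) * real n powr -s" for n :: nat
  have eq: "log_twist \<chi> n * of_real (real n powr -s) = f n *\<^sub>R \<chi> n" for n
    by (simp add: log_twist_def f_def scaleR_conv_of_real)
  have le1: "norm (\<chi> n) \<le> 1" for n by (rule dirichlet_char_norm_le[OF assms(1,2)])
  have ln23: "ln (2::real) \<le> 1" "ln (3::real) \<le> 2" using ln_le_minus_one[of "2::real"] ln_le_minus_one[of "3::real"] by auto
  have pw: "real n powr -s \<le> 1" if "n > 0" for n
    using that assms(4) powr_mono[of "-s" 0 "real n"] by simp
  have f2: "\<bar>f 2\<bar> \<le> 1"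
    using mult_mono[OF ln23(1) pw[of 2]] by (simp add: f_def)
  have f3: "f 3 \<le> 2" using mult_mono[OF ln23(2) pw[of 3]] by (simp add: f_def)
  have decr: "f (Suc n) \<le> f n" if n: "n \<ge> 3" for n
  proof -
    have eq': "f k = (ln (real k) / real k) * real k powr (1 - s)" if "k > 0" for k
      using that by (simp add: f_def powr_diff powr_minus field_simps)
    have "exp 1 \<le> real n" using exp_le n by linarith
    hence "ln (real (Suc n)) / real (Suc n) \<le> ln (real n) / real n"
      by (intro ln_x_over_x_mono) auto
    moreover have "real (Suc n) powr (1 - s) \<le> real n powr (1 - s)"
      using n assms(4) by (intro powr_mono2') auto
    ultimately have "(ln (real (Suc n)) / real (Suc n)) * real (Suc n) powr (1 - s)
        \<le> (ln (real n) / real n) * real n powr (1 - s)"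
      using n by (intro mult_mono) auto
    thus ?thesis using eq'[of n] eq'[of "Suc n"] n by simp
  qed
  have nonneg: "f n \<ge> 0" if "n \<ge> 3" for n using that by (simp add: f_def)
  have "norm (dirichlet_partial (log_twist \<chi>) s N) \<le> 1 + 2 * real m * 2"
  proof (cases "N \<ge> 3")
    case True
    have "dirichlet_partial (log_twist \<chi>) s N = (\<Sum>n<3. f n *\<^sub>R \<chi> n) + (\<Sum>n=3..<N. f n *\<^sub>R \<chi> n)"
      unfolding dirichlet_partial_def eq using True
      by (simp add: lessThan_atLeast0 sum.atLeastLessThan_concat)
    also have "(\<Sum>n<3. f n *\<^sub>R \<chi> n) = f 2 *\<^sub>R \<chi> 2"
      by (simp add: numeral_3_eq_3 f_def numeral_2_eq_2)
    finally have "norm (dirichlet_partial (log_twist \<chi>) s N) \<le> norm (f 2 *\<^sub>R \<chi> 2) + norm (\<Sum>n=3..<N. f n *\<^sub>R \<chi> n)"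
      by (metis norm_triangle_ineq)
    also have "norm (f 2 *\<^sub>R \<chi> 2) \<le> 1" using mult_mono[OF f2 le1[of 2]] by simp
    also have "norm (\<Sum>n=3..<N. f n *\<^sub>R \<chi> n) \<le> 2 * real m * f 3"
      by (rule abel_bound[where f = f and c = \<chi>, OF char_sum_bound[OF assms(1-3)] True decr nonneg])
    also have "2 * real m * f 3 \<le> 2 * real m * 2" using f3 by (intro mult_left_mono) auto
    finally show ?thesis by simp
  next
    case False
    hence "N = 0 \<or> N = 1 \<or> N = 2" by auto
    hence "dirichlet_partial (log_twist \<chi>) s N = 0" unfolding dirichlet_partial_def eq
      by (auto simp: f_def numeral_2_eq_2)
    thus ?thesis by simp
  qed
  thus ?thesis by simp
qed

text \<open>
The derivative in \<open>s\<close> is minus the partial sum with coefficients \<open>\<chi> n * ln n\<close>, which has just been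
bounded uniformly. Working with partial sums avoids all questions of differentiability at 1.
\<close>
lemma dirichlet_partial_lipschitz:
  assumes "m > 0" "dirichlet_char m \<chi>" "\<chi> \<noteq> trivial_char m" "s \<ge> 1" "t \<ge> 1"
  shows "norm (dirichlet_partial \<chi> s N - dirichlet_partial \<chi> t N) \<le> (4 * real m + 1) * \<bar>s - t\<bar>"
proof -
  have D: "((\<lambda>s. dirichlet_partial \<chi> s N) has_vector_derivative -dirichlet_partial (log_twist \<chi>) x N) (at x within {1..})" for x
  proof -
    have "((\<lambda>s. \<chi> n * of_real (real n powr -s)) has_vector_derivative
        -(log_twist \<chi> n * of_real (real n powr -x))) (at x within {1..})" for n
    proof (cases "n = 0")
      case False
      have "((\<lambda>s. exp (-s * ln (real n))) has_real_derivative
              (exp (-x * ln (real n)) * (-1 * ln (real n)))) (at x within {1..})"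
        by (rule DERIV_cong, rule DERIV_chain2[OF DERIV_exp], rule derivative_intros, rule derivative_intros, rule derivative_intros, rule DERIV_const) simp
      hence "((\<lambda>s. \<chi> n * of_real (exp (-s * ln (real n)))) has_vector_derivative
         \<chi> n * of_real (exp (-x * ln (real n)) * (-1 * ln (real n)))) (at x within {1..})"
        by (intro has_vector_derivative_mult_right has_vector_derivative_of_real)
      thus ?thesis using False by (simp add: powr_def log_twist_def mult_ac)
    qed simp
    thus ?thesis unfolding dirichlet_partial_def sum_negf[symmetric] by (intro has_vector_derivative_sum)
  qed
  have "norm (dirichlet_partial \<chi> s N - dirichlet_partial \<chi> t N) \<le> (4 * real m + 1) * norm (s - t)"
  proof (rule differentiable_bound[where S = "{1..}"])
    show "((\<lambda>s. dirichlet_partial \<chi> s N) has_derivative (\<lambda>h. h *\<^sub>R -dirichlet_partial (log_twist \<chi>) x N)) (at x within {1..})" for x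
      using D[of x] by (simp add: has_vector_derivative_def)
    show "onorm (\<lambda>h. h *\<^sub>R -dirichlet_partial (log_twist \<chi>) x N) \<le> 4 * real m + 1" if "x \<in> {1..}" for x
      using log_twist_part_bound[OF assms(1-3), of x N] that
      by (intro onorm_bound) (auto simp: mult.commute intro!: mult_left_mono)
  qed (use assms in auto)
  thus ?thesis by simp
qed

definition L_one :: "(nat \<Rightarrow> complex) \<Rightarrow> complex" where
  "L_one \<chi> = (\<Sum>n. \<chi> n / of_nat n)"

lemma dirichlet_partial_one: "dirichlet_partial \<chi> 1 N = (\<Sum>n<N. \<chi> n / of_nat n)"
  unfolding dirichlet_partial_def by (intro sum.cong) (auto simp: powr_minus field_simps)

lemma L_one_summable:
  assumes "m > 0" "dirichlet_char m \<chi>" "\<chi> \<noteq> trivial_char m"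
  shows "summable (\<lambda>n. \<chi> n / of_nat n)"
proof (rule summable_Cauchy')
  show "\<forall>\<^sub>F M in sequentially. \<forall>n\<ge>M. norm (\<Sum>k=M..<n. \<chi> k / of_nat k) \<le> 2 * real m * (1 / real M)"
    using eventually_gt_at_top[of 0]
  proof eventually_elim
    case (elim M)
    show ?case
    proof safe
      fix n assume "M \<le> n"
      hence "norm (\<Sum>k=M..<n. (1 / real k) *\<^sub>R \<chi> k) \<le> 2 * real m * (1 / real M)"
        using elim by (intro abel_bound[OF char_sum_bound[OF assms]]) (auto simp: field_simps)
      thus "norm (\<Sum>k=M..<n. \<chi> k / of_nat k) \<le> 2 * real m * (1 / real M)"
        by (simp add: scaleR_conv_of_real)
    qed
  qed
  show "(\<lambda>M. 2 * real m * (1 / real M)) \<longlonglongrightarrow> 0"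
    using tendsto_mult_right_zero[OF lim_1_over_n] by simp
qed

lemma dirichlet_char_norm_le_ln:
  assumes "m > 0" "dirichlet_char m \<chi>" "n > 0"
  shows "norm (\<chi> n) \<le> 1 + ln (real n)" "norm (log_twist \<chi> n) \<le> 1 + ln (real n)"
proof -
  show "norm (\<chi> n) \<le> 1 + ln (real n)"
    using dirichlet_char_norm_le[OF assms(1,2), of n] ln_ge_zero[of "real n"] assms(3) by linarith
  have "ln (real n) * norm (\<chi> n) \<le> ln (real n) * 1"
    using assms(3) by (intro mult_left_mono dirichlet_char_norm_le[OF assms(1,2)]) auto
  thus "norm (log_twist \<chi> n) \<le> 1 + ln (real n)" using assms(3) by (simp add: log_twist_def norm_mult)
qed

lemma dirichlet_partial_tendsto:
  assumes "s > 1" "\<And>n. n > 0 \<Longrightarrow> norm (a n) \<le> 1 + ln (real n)"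
  shows "dirichlet_partial a s \<longlonglongrightarrow> dirichlet_series a s"
  unfolding dirichlet_partial_def[abs_def] dirichlet_series_def
  by (intro summable_LIMSEQ summable_norm_cancel[OF dirichlet_series_norm_summable[OF assms]])

text \<open>
This is used in two ways: it gives continuity at 1, and if \<open>L(1, \<chi>) = 0\<close> it says that \<open>L(s, \<chi>)\<close>
vanishes at least linearly.
\<close>
lemma L_near_one:
  assumes "m > 0" "dirichlet_char m \<chi>" "\<chi> \<noteq> trivial_char m" "s > 1"
  shows "norm (dirichlet_series \<chi> s - L_one \<chi>) \<le> (4 * real m + 1) * (s - 1)"
proof (rule tendsto_upperbound)
  have "dirichlet_partial \<chi> 1 \<longlonglongrightarrow> L_one \<chi>"
    unfolding dirichlet_partial_one[abs_def] L_one_def by (rule summable_LIMSEQ[OF L_one_summable[OF assms(1-3)]])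
  thus "(\<lambda>N. norm (dirichlet_partial \<chi> s N - dirichlet_partial \<chi> 1 N)) \<longlonglongrightarrow> norm (dirichlet_series \<chi> s - L_one \<chi>)"
    by (intro tendsto_norm tendsto_diff dirichlet_partial_tendsto[OF assms(4)] dirichlet_char_norm_le_ln[OF assms(1,2)])
  show "\<forall>\<^sub>F N in sequentially. norm (dirichlet_partial \<chi> s N - dirichlet_partial \<chi> 1 N) \<le> (4 * real m + 1) * (s - 1)"
    using dirichlet_partial_lipschitz[OF assms(1-3), of s 1] assms(4) by simp
qed simp

lemma log_twist_series_bound:
  assumes "m > 0" "dirichlet_char m \<chi>" "\<chi> \<noteq> trivial_char m" "s > 1"
  shows "norm (dirichlet_series (log_twist \<chi>) s) \<le> 4 * real m + 1"
proof (rule tendsto_upperbound)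
  show "(\<lambda>N. norm (dirichlet_partial (log_twist \<chi>) s N)) \<longlonglongrightarrow> norm (dirichlet_series (log_twist \<chi>) s)"
    by (intro tendsto_norm dirichlet_partial_tendsto[OF assms(4)] dirichlet_char_norm_le_ln[OF assms(1,2)])
  show "\<forall>\<^sub>F N in sequentially. norm (dirichlet_partial (log_twist \<chi>) s N) \<le> 4 * real m + 1"
    using log_twist_part_bound[OF assms(1-3)] assms(4) by simp
qed simp

definition mangoldt_twist :: "(nat \<Rightarrow> complex) \<Rightarrow> nat \<Rightarrow> complex" where
  "mangoldt_twist \<chi> n = mangoldt n * \<chi> n"

lemma mangoldt_twist_norm_le:
  assumes "m > 0" "dirichlet_char m \<chi>" "n > 0"
  shows "norm (mangoldt_twist \<chi> n) \<le> 1 + ln (real n)"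
proof -
  have "norm (mangoldt_twist \<chi> n) \<le> mangoldt n * 1"
    unfolding mangoldt_twist_def norm_mult norm_mangoldt
    by (intro mult_left_mono dirichlet_char_norm_le[OF assms(1,2)] mangoldt_nonneg)
  thus ?thesis using mangoldt_le[OF assms(3)] by linarith
qed

text \<open>
The Dirichlet series form of \<open>-L'/L\<close>: summing the von Mangoldt function over the divisors of \<open>n\<close>
gives \<open>ln n\<close>, and \<open>\<chi>\<close> is completely multiplicative.
\<close>
lemma mangoldt_L_eq:
  assumes "m > 0" "dirichlet_char m \<chi>" "s > 1"
  shows "dirichlet_series (mangoldt_twist \<chi>) s * dirichlet_series \<chi> s = dirichlet_series (log_twist \<chi>) s"
proof (rule dirichlet_series_mult[OF assms(3)])
  fix n :: nat assume n: "n > 0"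
  have "(\<Sum>d | d dvd n. mangoldt_twist \<chi> d * \<chi> (n div d)) = (\<Sum>d | d dvd n. mangoldt d * \<chi> n)"
    by (intro sum.cong refl)
       (auto simp: mangoldt_twist_def mult.assoc simp flip: dirichlet_char_mult[OF assms(2)])
  also have "\<dots> = log_twist \<chi> n" using n
    by (simp add: sum_distrib_right[symmetric] mangoldt_sum log_twist_def)
  finally show "log_twist \<chi> n = (\<Sum>d | d dvd n. mangoldt_twist \<chi> d * \<chi> (n div d))" ..
qed (use mangoldt_twist_norm_le[OF assms(1,2)] dirichlet_char_norm_le_ln[OF assms(1,2)] in auto)

lemma L_deriv:
  assumes "m > 0" "dirichlet_char m \<chi>" "s > 1"
  shows "(dirichlet_series \<chi> has_vector_derivative
     -(dirichlet_series (mangoldt_twist \<chi>) s) * dirichlet_series \<chi> s) (at s)"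
  using dirichlet_series_deriv[OF assms(3), of \<chi>] dirichlet_char_norm_le[OF assms(1,2)]
    mangoldt_L_eq[OF assms] by (simp add: log_twist_def[abs_def])

section \<open>At most one L-series vanishes at 1\<close>

text \<open>
By orthogonality, averaging over the characters picks out the \<open>n\<close> that are inverse to \<open>b\<close> modulo
\<open>m\<close>. For \<open>b = 1\<close> this shows that the sum of the series is real and nonnegative.
\<close>
lemma average_mangoldt_series:
  assumes "m > 0" "s > 1"
  shows "(\<Sum>\<chi>\<in>dirichlet_chars m. \<chi> b * dirichlet_series (mangoldt_twist \<chi>) s) =
    of_real (real (card (dirichlet_chars m)) *
       (\<Sum>n. (if [b * n = 1] (mod m) then mangoldt n else 0) * real n powr -s))"
    "summable (\<lambda>n. (if [b * n = 1] (mod m) then mangoldt n else 0) * real n powr -s)"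
proof -
  let ?X = "dirichlet_chars m"
  have sm: "summable (\<lambda>n. mangoldt_twist \<chi> n * of_real (real n powr -s))" if "\<chi> \<in> ?X" for \<chi>
    using that mangoldt_twist_norm_le[OF assms(1)]
    by (intro summable_norm_cancel[OF dirichlet_series_norm_summable[OF assms(2)]]) (auto simp: dirichlet_chars_def)
  show sm2: "summable (\<lambda>n. (if [b * n = 1] (mod m) then mangoldt n else 0) * real n powr -s)"
  proof (rule summable_comparison_test'[OF summable_ln_powr[OF assms(2)]])
    fix n :: nat assume "n \<ge> 1"
    hence "mangoldt n \<le> 1 + ln (real n)" "0 \<le> 1 + ln (real n)"
      using mangoldt_le[of n] ln_ge_zero[of "real n"] by auto
    thus "norm ((if [b * n = 1] (mod m) then mangoldt n else 0) * real n powr -s) \<le>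
        (1 + ln (real n)) * real n powr -s"
      by (auto simp: abs_mult intro!: mult_right_mono)
  qed
  have "(\<Sum>\<chi>\<in>?X. \<chi> b * dirichlet_series (mangoldt_twist \<chi>) s) =
      (\<Sum>\<chi>\<in>?X. \<Sum>n. \<chi> b * (mangoldt_twist \<chi> n * of_real (real n powr -s)))"
    unfolding dirichlet_series_def using sm by (intro sum.cong refl suminf_mult[symmetric]) auto
  also have "\<dots> = (\<Sum>n. \<Sum>\<chi>\<in>?X. \<chi> b * (mangoldt_twist \<chi> n * of_real (real n powr -s)))"
    using sm by (intro suminf_sum[symmetric] summable_mult) auto
  also have "\<dots> = (\<Sum>n. of_real (real (card ?X) *
      ((if [b * n = 1] (mod m) then mangoldt n else 0) * real n powr -s)))"
  proof (rule suminf_cong)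
    fix n :: nat
    have "(\<Sum>\<chi>\<in>?X. \<chi> b * (mangoldt_twist \<chi> n * of_real (real n powr -s))) =
        (\<Sum>\<chi>\<in>?X. \<chi> (b * n)) * (mangoldt n * of_real (real n powr -s))"
      unfolding sum_distrib_right
      by (intro sum.cong refl) (auto simp: mangoldt_twist_def dirichlet_chars_def dirichlet_char_mult)
    also have "\<dots> = of_real (real (card ?X) *
      ((if [b * n = 1] (mod m) then mangoldt n else 0) * real n powr -s))"
      by (subst dirichlet_chars_orthogonality[OF assms(1)]) auto
    finally show "(\<Sum>\<chi>\<in>?X. \<chi> b * (mangoldt_twist \<chi> n * of_real (real n powr -s))) = \<dots>" .
  qed
  also have "\<dots> = of_real (\<Sum>n. real (card ?X) *
      ((if [b * n = 1] (mod m) then mangoldt n else 0) * real n powr -s))"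
    using sm2 by (intro suminf_of_real[symmetric] summable_mult)
  also have "\<dots> = of_real (real (card ?X) * (\<Sum>n. (if [b * n = 1] (mod m) then mangoldt n else 0) * real n powr -s))"
    using sm2 by (subst suminf_mult) auto
  finally show "(\<Sum>\<chi>\<in>?X. \<chi> b * dirichlet_series (mangoldt_twist \<chi>) s) = \<dots>" .
qed

definition L_product :: "nat \<Rightarrow> real \<Rightarrow> complex" where
  "L_product m s = (\<Prod>\<chi>\<in>dirichlet_chars m. dirichlet_series \<chi> s)"

lemma L_product_deriv:
  assumes "m > 0" "s > 1"
  shows "(L_product m has_vector_derivative
     -(\<Sum>\<chi>\<in>dirichlet_chars m. dirichlet_series (mangoldt_twist \<chi>) s) * L_product m s) (at s)"
proof -
  have "((\<lambda>s. \<Prod>\<chi>\<in>F. dirichlet_series \<chi> s) has_vector_derivative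
     -(\<Sum>\<chi>\<in>F. dirichlet_series (mangoldt_twist \<chi>) s) * (\<Prod>\<chi>\<in>F. dirichlet_series \<chi> s)) (at s)"
    if "finite F" "F \<subseteq> dirichlet_chars m" for F
    using that
  proof (induction F rule: finite_induct)
    case (insert \<chi> F)
    hence "dirichlet_char m \<chi>" by (simp add: dirichlet_chars_def)
    from has_vector_derivative_mult[OF L_deriv[OF assms(1) this assms(2)] insert.IH] insert
    show ?case by (simp add: algebra_simps)
  qed simp
  from this[OF finite_dirichlet_chars[OF assms(1)]] show ?thesis
    by (simp add: L_product_def[abs_def])
qed

text \<open>
The logarithmic derivative of the product is minus a nonnegative real number \<open>\<beta>\<close>, so the square of
the absolute value has derivative \<open>-2 * \<beta>\<close> times itself. In this form the statement makes sense and
holds also where a factor vanishes.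
\<close>
lemma L_product_norm_decreasing:
  assumes "m > 0" "1 < s" "s \<le> t"
  shows "norm (L_product m t) \<le> norm (L_product m s)"
proof -
  define N where "N x = (Re (L_product m x))\<^sup>2 + (Im (L_product m x))\<^sup>2" for x
  have "\<exists>y. (N has_real_derivative y) (at x) \<and> y \<le> 0" if x: "s \<le> x" "x \<le> t" for x
  proof -
    have x1: "x > 1" using x assms by simp
    define \<beta> where "\<beta> = real (card (dirichlet_chars m)) *
        (\<Sum>n. (if [1 * n = 1] (mod m) then mangoldt n else 0) * real n powr -x)"
    have "(\<Sum>\<chi>\<in>dirichlet_chars m. dirichlet_series (mangoldt_twist \<chi>) x) =
        (\<Sum>\<chi>\<in>dirichlet_chars m. \<chi> 1 * dirichlet_series (mangoldt_twist \<chi>) x)"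
      by (intro sum.cong refl) (auto simp: dirichlet_chars_def dirichlet_char_def)
    also have "\<dots> = of_real \<beta>" unfolding \<beta>_def by (rule average_mangoldt_series[OF assms(1) x1])
    finally have eq: "(\<Sum>\<chi>\<in>dirichlet_chars m. dirichlet_series (mangoldt_twist \<chi>) x) = of_real \<beta>" .
    have \<beta>: "\<beta> \<ge> 0" unfolding \<beta>_def using average_mangoldt_series(2)[OF assms(1) x1, of 1]
      by (intro mult_nonneg_nonneg suminf_nonneg) (auto simp: mangoldt_nonneg)
    have D: "(L_product m has_vector_derivative of_real (-\<beta>) * L_product m x) (at x)"
      using L_product_deriv[OF assms(1) x1] eq by simp
    define u v where "u y = Re (L_product m y)" and "v y = Im (L_product m y)" for y
    have "(u has_real_derivative -\<beta> * u x) (at x)" "(v has_real_derivative -\<beta> * v x) (at x)"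
      using has_field_derivative_Re[OF D] has_field_derivative_Im[OF D] by (simp_all add: u_def[abs_def] v_def[abs_def])
    hence "((\<lambda>y. u y * u y + v y * v y) has_real_derivative
        (-\<beta> * u x) * u x + (-\<beta> * u x) * u x + ((-\<beta> * v x) * v x + (-\<beta> * v x) * v x)) (at x)"
      by (intro DERIV_add DERIV_mult)
    moreover have "(-\<beta> * u x) * u x + (-\<beta> * u x) * u x + ((-\<beta> * v x) * v x + (-\<beta> * v x) * v x) = -2 * \<beta> * N x"
    proof -
      have "(-b * p) * p + (-b * p) * p + ((-b * q) * q + (-b * q) * q) = -2 * b * (p\<^sup>2 + q\<^sup>2)"
        for b p q :: real by (simp add: power2_eq_square algebra_simps)
      thus ?thesis by (simp only: N_def u_def v_def)
    qed
    ultimately have "(N has_real_derivative -2 * \<beta> * N x) (at x)"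
      by (simp only: N_def[abs_def] u_def v_def power2_eq_square)
    moreover have "-2 * \<beta> * N x \<le> 0" using \<beta> by (simp add: N_def)
    ultimately show ?thesis by blast
  qed
  from DERIV_nonpos_imp_nonincreasing[OF assms(3) this] have "N t \<le> N s" .
  thus ?thesis by (simp add: N_def cmod_def)
qed

text \<open>
The inductive step is Bernoulli's inequality \<open>(1 - 1 / x) powr (1 - s) \<ge> 1 + (s - 1) / x\<close>.
\<close>
lemma zeta_partial_bound:
  assumes "s > 1"
  shows "(\<Sum>n<Suc (Suc N). real n powr -s) \<le> 1 + (1 - real (Suc N) powr (1 - s)) / (s - 1)"
proof (induction N)
  case (Suc N)
  define x where "x = real (Suc (Suc N))"
  have x: "x > 1" by (simp add: x_def)
  have "1 + (s - 1) * (1 / x) \<le> exp ((s - 1) * (1 / x))" by (rule exp_ge_add_one_self)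
  also have "\<dots> \<le> exp ((1 - s) * ln (1 - 1 / x))"
  proof -
    have "ln (1 - 1 / x) \<le> - (1 / x)" using ln_le_minus_one[of "1 - 1 / x"] x by simp
    hence "(1 - s) * ln (1 - 1 / x) \<ge> (1 - s) * (-(1 / x))" using assms by (intro mult_left_mono_neg) auto
    also have "(1 - s) * (-(1 / x)) = (s - 1) * (1 / x)" by (metis minus_diff_eq minus_mult_commute)
    finally show ?thesis by simp
  qed
  also have "\<dots> = (1 - 1 / x) powr (1 - s)" using x by (simp add: powr_def)
  finally have "x powr (1 - s) * (1 + (s - 1) * (1 / x)) \<le> x powr (1 - s) * (1 - 1 / x) powr (1 - s)"
    by (intro mult_left_mono) auto
  also have "x powr (1 - s) * (1 - 1 / x) powr (1 - s) = (x * (1 - 1 / x)) powr (1 - s)"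
    using x by (simp add: powr_mult)
  also have "x * (1 - 1 / x) = real (Suc N)" using x by (simp add: field_simps x_def)
  also have "x powr (1 - s) * (1 + (s - 1) * (1 / x)) = x powr (1 - s) + (s - 1) * x powr -s"
    using x by (simp add: powr_diff powr_minus field_simps)
  finally have "x powr -s \<le> (real (Suc N) powr (1 - s) - x powr (1 - s)) / (s - 1)"
    using assms by (simp add: field_simps)
  moreover have "(\<Sum>n<Suc (Suc (Suc N)). real n powr -s) = (\<Sum>n<Suc (Suc N). real n powr -s) + x powr -s"
    unfolding x_def by (rule sum.lessThan_Suc)
  ultimately show ?case using Suc unfolding diff_divide_distrib x_def[symmetric] by linarith
qed simp

lemma L_upper_bound:
  assumes "m > 0" "dirichlet_char m \<chi>" "s > 1"
  shows "norm (dirichlet_series \<chi> s) \<le> 1 + 1 / (s - 1)"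
proof (rule tendsto_upperbound)
  show "(\<lambda>N. norm (dirichlet_partial \<chi> s N)) \<longlonglongrightarrow> norm (dirichlet_series \<chi> s)"
    by (intro tendsto_norm dirichlet_partial_tendsto[OF assms(3)] dirichlet_char_norm_le_ln[OF assms(1,2)])
  have "norm (dirichlet_partial \<chi> s N) \<le> 1 + 1 / (s - 1)" for N
  proof -
    have "norm (dirichlet_partial \<chi> s N) \<le> (\<Sum>n<N. real n powr -s)"
      unfolding dirichlet_partial_def using dirichlet_char_norm_le[OF assms(1,2)]
      by (intro sum_norm_le) (auto simp: norm_mult intro!: mult_left_le_one_le)
    also have "\<dots> \<le> (\<Sum>n<Suc (Suc N). real n powr -s)" by (intro sum_mono2) auto
    also have "\<dots> \<le> 1 + (1 - real (Suc N) powr (1 - s)) / (s - 1)" by (rule zeta_partial_bound[OF assms(3)])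
    also have "\<dots> \<le> 1 + 1 / (s - 1)" using assms(3) by (intro add_left_mono divide_right_mono) auto
    finally show ?thesis .
  qed
  thus "\<forall>\<^sub>F N in sequentially. norm (dirichlet_partial \<chi> s N) \<le> 1 + 1 / (s - 1)" by simp
qed simp

text \<open>
The terms beyond the first sum to at most \<open>1 / 4 + (1 / 2 - 1 / 3) + (1 / 3 - 1 / 4) + \<dots> = 3 / 4\<close>.
This anchors the monotone product at \<open>s = 2\<close>.
\<close>
lemma L_two_nonzero:
  assumes "m > 0" "dirichlet_char m \<chi>"
  shows "dirichlet_series \<chi> 2 \<noteq> 0"
proof -
  have part: "norm (dirichlet_partial \<chi> 2 (N + 3) - 1) \<le> 3 / 4 - 1 / real (N + 2)" for N
  proof (induction N)
    case 0
    have "{..<3::nat} = {0, 1, 2}" by auto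
    hence "dirichlet_partial \<chi> 2 3 = \<chi> 1 + \<chi> 2 * of_real (2 powr -2)" by (simp add: dirichlet_partial_def)
    moreover have "\<chi> 1 = 1" using assms(2) by (simp add: dirichlet_char_def)
    moreover have "(2::real) powr -2 = 1 / 4" by (simp add: powr_minus)
    ultimately have "norm (dirichlet_partial \<chi> 2 3 - 1) = norm (\<chi> 2) * (1 / 4)"
      by (simp add: norm_divide)
    also have "\<dots> \<le> 1 / 4" using dirichlet_char_norm_le[OF assms, of 2] by simp
    finally show ?case by simp
  next
    case (Suc N)
    have "dirichlet_partial \<chi> 2 (Suc N + 3) - 1 = (dirichlet_partial \<chi> 2 (N + 3) - 1) + \<chi> (N + 3) * of_real (real (N + 3) powr -2)"
      by (simp only: dirichlet_partial_def add_Suc sum.lessThan_Suc) simp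
    also have "norm \<dots> \<le> norm (dirichlet_partial \<chi> 2 (N + 3) - 1) + norm (\<chi> (N + 3) * of_real (real (N + 3) powr -2))"
      by (rule norm_triangle_ineq)
    also have "norm (\<chi> (N + 3) * of_real (real (N + 3) powr -2)) \<le> 1 * real (N + 3) powr -2"
      unfolding norm_mult using dirichlet_char_norm_le[OF assms] by (intro mult_mono) auto
    also have "real (N + 3) powr -2 = 1 / (real (N + 3))\<^sup>2"
      by (simp add: powr_minus field_simps)
    also have "1 * (1 / (real (N + 3))\<^sup>2) \<le> 1 / real (N + 2) - 1 / real (N + 3)"
    proof -
      have "1 / (real (N + 3))\<^sup>2 \<le> 1 / (real (N + 2) * real (N + 3))"
        unfolding power2_eq_square by (intro divide_left_mono mult_right_mono) auto
      also have "\<dots> = 1 / real (N + 2) - 1 / real (N + 3)" by (simp add: field_simps)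
      finally show ?thesis by simp
    qed
    finally show ?case using Suc by (simp add: add.commute)
  qed
  have "(\<lambda>N. norm (dirichlet_partial \<chi> 2 (N + 3) - 1)) \<longlonglongrightarrow> norm (dirichlet_series \<chi> 2 - 1)"
    by (intro tendsto_intros LIMSEQ_ignore_initial_segment dirichlet_partial_tendsto dirichlet_char_norm_le_ln[OF assms]) auto
  moreover have "norm (dirichlet_partial \<chi> 2 (N + 3) - 1) \<le> 3 / 4" for N
    using part[of N] by (rule order.trans) simp
  ultimately have "norm (dirichlet_series \<chi> 2 - 1) \<le> 3 / 4"
    by (intro tendsto_upperbound) (auto intro: always_eventually)
  thus ?thesis by auto
qed

lemma trivial_in_chars: "m > 0 \<Longrightarrow> trivial_char m \<in> dirichlet_chars m"
  by (simp add: dirichlet_chars_def dirichlet_char_trivial)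

text \<open>
Two zeros would make the product of all L-series at most of size \<open>(s - 1)^2 / (s - 1)\<close> near 1,
the denominator coming from the trivial character, while the product is bounded away from zero on
\<open>(1, 2]\<close> by its monotonicity.
\<close>
lemma at_most_one_zero:
  assumes m: "m > 0"
    and 1: "dirichlet_char m \<chi>\<^sub>1" "\<chi>\<^sub>1 \<noteq> trivial_char m" "L_one \<chi>\<^sub>1 = 0"
    and 2: "dirichlet_char m \<chi>\<^sub>2" "\<chi>\<^sub>2 \<noteq> trivial_char m" "L_one \<chi>\<^sub>2 = 0"
  shows "\<chi>\<^sub>1 = \<chi>\<^sub>2"
proof (rule ccontr)
  assume neq: "\<chi>\<^sub>1 \<noteq> \<chi>\<^sub>2"
  define Y where "Y = dirichlet_chars m - {trivial_char m, \<chi>\<^sub>1, \<chi>\<^sub>2}"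
  define C where "C = 4 * real m + 1"
  define K where "K = (\<Prod>\<chi>\<in>Y. norm (L_one \<chi>) + C)"
  have C: "C > 0" by (simp add: C_def)
  have K: "K > 0" unfolding K_def using C by (intro prod_pos) (auto intro: add_nonneg_pos)
  have X: "dirichlet_chars m = insert (trivial_char m) (insert \<chi>\<^sub>1 (insert \<chi>\<^sub>2 Y))"
    using 1 2 trivial_in_chars[OF m] by (auto simp: Y_def dirichlet_chars_def)
  have fin: "finite Y" using finite_dirichlet_chars[OF m] by (simp add: Y_def)
  have prod: "L_product m s = dirichlet_series (trivial_char m) s * (dirichlet_series \<chi>\<^sub>1 s *
      (dirichlet_series \<chi>\<^sub>2 s * (\<Prod>\<chi>\<in>Y. dirichlet_series \<chi> s)))" for s
  proof -
    have notin: "trivial_char m \<notin> insert \<chi>\<^sub>1 (insert \<chi>\<^sub>2 Y)" "\<chi>\<^sub>1 \<notin> insert \<chi>\<^sub>2 Y" "\<chi>\<^sub>2 \<notin> Y"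
      using 1 2 neq by (auto simp: Y_def)
    show ?thesis unfolding L_product_def X using fin notin by (simp only: prod.insert finite_insert simp_thms)
  qed
  define c where "c = norm (L_product m 2)"
  have c: "c > 0" unfolding c_def L_product_def using L_two_nonzero[OF m] finite_dirichlet_chars[OF m]
    by (simp add: dirichlet_chars_def)
  have upper: "norm (L_product m s) \<le> 2 * C\<^sup>2 * K * (s - 1)" if s: "1 < s" "s \<le> 2" for s
  proof -
    have "norm (L_product m s) \<le> (2 / (s - 1)) * ((C * (s - 1)) * ((C * (s - 1)) * K))"
      unfolding prod norm_mult
    proof (intro mult_mono)
      have "2 / (s - 1) = 1 / (s - 1) + 1 / (s - 1)" by (simp flip: add_divide_distrib)
      moreover have "1 \<le> 1 / (s - 1)" using s by simp
      ultimately have "1 + 1 / (s - 1) \<le> 2 / (s - 1)" by linarith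
      thus "norm (dirichlet_series (trivial_char m) s) \<le> 2 / (s - 1)"
        using L_upper_bound[OF m dirichlet_char_trivial[OF m] s(1)] by linarith
      show "norm (dirichlet_series \<chi>\<^sub>1 s) \<le> C * (s - 1)" "norm (dirichlet_series \<chi>\<^sub>2 s) \<le> C * (s - 1)"
        using L_near_one[OF m 1(1,2) s(1)] L_near_one[OF m 2(1,2) s(1)] 1 2 by (simp_all add: C_def)
      show "norm (\<Prod>\<chi>\<in>Y. dirichlet_series \<chi> s) \<le> K"
        unfolding K_def prod_norm[symmetric]
      proof (intro prod_mono conjI)
        fix \<chi> assume "\<chi> \<in> Y"
        hence \<chi>: "dirichlet_char m \<chi>" "\<chi> \<noteq> trivial_char m" by (auto simp: Y_def dirichlet_chars_def)
        have "norm (dirichlet_series \<chi> s) \<le> norm (L_one \<chi>) + norm (dirichlet_series \<chi> s - L_one \<chi>)"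
          by (metis add_diff_cancel_left' diff_add_cancel norm_triangle_ineq2 norm_triangle_sub)
        also have "norm (dirichlet_series \<chi> s - L_one \<chi>) \<le> C * (s - 1)"
          using L_near_one[OF m \<chi> s(1)] by (simp add: C_def)
        also have "C * (s - 1) \<le> C * 1" using s C by (intro mult_left_mono) auto
        finally show "norm (dirichlet_series \<chi> s) \<le> norm (L_one \<chi>) + C" by simp
      qed auto
    qed (use s C K in auto)
    also have "\<dots> = 2 * C\<^sup>2 * K * (s - 1)" using s by (simp add: power2_eq_square field_simps)
    finally show ?thesis .
  qed
  \<comment> \<open>At this distance from 1 the upper bound is at most \<open>c / 2\<close>.\<close>
  define e where "e = min 1 (c / (4 * C\<^sup>2 * K))"
  have e: "e > 0" "e \<le> 1" "e \<le> c / (4 * C\<^sup>2 * K)" using c C K by (auto simp: e_def)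
  have "c \<le> norm (L_product m (1 + e))"
    unfolding c_def using e by (intro L_product_norm_decreasing[OF m]) auto
  also have "\<dots> \<le> 2 * C\<^sup>2 * K * e" using upper[of "1 + e"] e by simp
  also have "\<dots> \<le> 2 * C\<^sup>2 * K * (c / (4 * C\<^sup>2 * K))" using e C K by (intro mult_left_mono) auto
  also have "\<dots> = c / 2" using C K by (simp add: field_simps)
  finally show False using c by simp
qed

text \<open>
The conjugate of \<open>\<chi>\<close> vanishes at 1 together with \<open>\<chi>\<close>, so it cannot be a second character.
\<close>
lemma zero_imp_real_char:
  assumes "m > 0" "dirichlet_char m \<chi>" "\<chi> \<noteq> trivial_char m" "L_one \<chi> = 0"
  shows "cnj (\<chi> n) = \<chi> n"
proof -
  define \<psi> where "\<psi> k = cnj (\<chi> k)" for k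
  have "dirichlet_char m \<psi>" using assms(2) by (simp add: dirichlet_char_def \<psi>_def)
  moreover have "\<psi> \<noteq> trivial_char m"
  proof
    assume "\<psi> = trivial_char m"
    hence "cnj (\<psi> k) = cnj (trivial_char m k)" for k by simp
    hence "\<chi> = trivial_char m" by (auto simp: \<psi>_def trivial_char_def fun_eq_iff)
    thus False using assms(3) by simp
  qed
  moreover have "L_one \<psi> = 0"
  proof -
    have "L_one \<psi> = (\<Sum>n. cnj (\<chi> n / of_nat n))" by (simp add: L_one_def \<psi>_def)
    also have "\<dots> = cnj (L_one \<chi>)" unfolding L_one_def
      by (rule bounded_linear.suminf[OF bounded_linear_cnj L_one_summable[OF assms(1-3)], symmetric])
    finally show ?thesis using assms(4) by simp
  qed
  ultimately have "\<psi> = \<chi>" using at_most_one_zero assms by blast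
  thus ?thesis by (metis \<psi>_def)
qed

section \<open>Real characters and Lambert series\<close>

lemma divisors_prime_power_times:
  fixes p M :: nat
  assumes "prime p" "\<not> p dvd M" "M > 0"
  shows "bij_betw (\<lambda>(i, e). p ^ i * e) ({..k} \<times> {e. e dvd M}) {d. d dvd p ^ k * M}"
  unfolding bij_betw_def
proof
  have mult: "multiplicity p (p ^ i * e) = i" if "e dvd M" for i e
  proof -
    have "\<not> p dvd e" "e \<noteq> 0" using that assms by (auto dest: dvd_trans)
    thus ?thesis using assms(1)
      by (simp add: prime_elem_multiplicity_mult_distrib not_dvd_imp_multiplicity_0)
  qed
  show "inj_on (\<lambda>(i, e). p ^ i * e) ({..k} \<times> {e. e dvd M})"
  proof (rule inj_onI, clarify)
    fix i e j f assume e: "e dvd M" "f dvd M" and eq: "p ^ i * e = p ^ j * f"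
    have "i = j" using mult[OF e(1), of i] mult[OF e(2), of j] eq by simp
    thus "i = j \<and> e = f" using eq assms(1) by (auto simp: prime_gt_0_nat)
  qed
  show "(\<lambda>(i, e). p ^ i * e) ` ({..k} \<times> {e. e dvd M}) = {d. d dvd p ^ k * M}"
  proof (intro equalityI subsetI)
    fix d assume "d \<in> (\<lambda>(i, e). p ^ i * e) ` ({..k} \<times> {e. e dvd M})"
    thus "d \<in> {d. d dvd p ^ k * M}" by (auto intro!: mult_dvd_mono le_imp_power_dvd)
  next
    fix d assume "d \<in> {d. d dvd p ^ k * M}"
    hence d: "d dvd p ^ k * M" by simp
    have "p ^ k * M > 0" using assms by (simp add: prime_gt_0_nat)
    hence d0: "d \<noteq> 0" using d by (metis dvd_0_left less_irrefl)
    have "\<not> is_unit p" using assms(1) by (simp add: prime_nat_iff)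
    then obtain e where e: "d = p ^ multiplicity p d * e" "\<not> p dvd e"
      using multiplicity_decompose'[OF d0] by blast
    define i where "i = multiplicity p d"
    have "coprime (p ^ k) e" using assms(1) e(2) by (simp add: prime_imp_coprime)
    moreover have "e dvd p ^ k * M" using d e(1) by (metis dvd_mult_right)
    ultimately have eM: "e dvd M" by (simp add: coprime_commute coprime_dvd_mult_right_iff)
    have "multiplicity p d \<le> multiplicity p (p ^ k * M)"
      using d \<open>p ^ k * M > 0\<close> by (intro dvd_imp_multiplicity_le) auto
    also have "\<dots> = k" using mult[of M k] by simp
    finally have "i \<le> k" by (simp add: i_def)
    thus "d \<in> (\<lambda>(i, e). p ^ i * e) ` ({..k} \<times> {e. e dvd M})"
      using eM e(1) by (force simp: i_def[symmetric])
  qed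
qed

text \<open>
The divisor sum of a completely multiplicative function is multiplicative. Splitting off one prime
power at a time reduces its sign to the geometric sums in the next lemma.
\<close>
lemma divisor_sum_prime_power_times:
  fixes c :: "nat \<Rightarrow> real"
  assumes c: "c 1 = 1" "\<And>a b. c (a * b) = c a * c b" and p: "prime p" "\<not> p dvd M" "M > 0"
  shows "(\<Sum>d | d dvd p ^ k * M. c d) = (\<Sum>i\<le>k. c p ^ i) * (\<Sum>d | d dvd M. c d)"
proof -
  have pow: "c (p ^ i) = c p ^ i" for i by (induction i) (use c in auto)
  have "(\<Sum>d | d dvd p ^ k * M. c d) = (\<Sum>(i, e)\<in>{..k} \<times> {e. e dvd M}. c (p ^ i * e))"
    by (subst sum.reindex_bij_betw[OF divisors_prime_power_times[OF p], symmetric]) (simp add: case_prod_unfold)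
  also have "\<dots> = (\<Sum>i\<le>k. \<Sum>e | e dvd M. c p ^ i * c e)"
    by (simp add: sum.cartesian_product c(2) pow)
  finally show ?thesis by (simp add: sum_product)
qed

lemma sign_power_sum:
  assumes "x \<in> {-1, 0, 1::real}"
  shows "(\<Sum>i\<le>k. x ^ i) \<ge> 0" "even k \<Longrightarrow> (\<Sum>i\<le>k. x ^ i) \<ge> 1"
proof -
  have "(\<Sum>i\<le>k. (-1::real) ^ i) = (if even k then 1 else 0)" by (induction k) auto
  moreover have "(\<Sum>i\<le>k. (0::real) ^ i) = 1" by (induction k) auto
  ultimately show "(\<Sum>i\<le>k. x ^ i) \<ge> 0" "even k \<Longrightarrow> (\<Sum>i\<le>k. x ^ i) \<ge> 1" using assms by auto
qed

lemma prime_power_split: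
  fixes n :: nat
  assumes "n > 1"
  obtains p k M where "prime p" "\<not> p dvd M" "M > 0" "M < n" "n = p ^ k * M"
proof -
  obtain p where p: "prime p" "p dvd n" using assms by (metis prime_factor_nat less_irrefl)
  have n0: "n \<noteq> 0" "\<not> is_unit p" using assms p by (auto simp: prime_nat_iff)
  obtain M where M: "n = p ^ multiplicity p n * M" "\<not> p dvd M"
    using multiplicity_decompose'[OF n0] by blast
  have "M > 0" using M n0 by (intro Nat.gr0I) auto
  moreover have "multiplicity p n > 0" using p n0 assms by (simp add: prime_multiplicity_gt_zero_iff)
  hence "p ^ multiplicity p n > 1" using p(1) by (intro one_less_power) (auto simp: prime_gt_Suc_0_nat)
  hence "M < n" using M(1) \<open>M > 0\<close> by (metis mult.left_neutral mult_less_mono1)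
  ultimately show ?thesis using that p M by blast
qed

context
  fixes c :: "nat \<Rightarrow> real"
  assumes c: "c 1 = 1" "\<And>a b. c (a * b) = c a * c b" "\<And>n. c n \<in> {-1, 0, 1}"
begin

lemma divisor_sum_nonneg:
  assumes "n > 0" shows "(\<Sum>d | d dvd n. c d) \<ge> 0"
  using assms
proof (induction n rule: less_induct)
  case (less n)
  show ?case
  proof (cases "n = 1")
    case False
    then obtain p k M where *: "prime p" "\<not> p dvd M" "M > 0" "M < n" "n = p ^ k * M"
      using less.prems by (auto intro: prime_power_split[of n])
    have "(\<Sum>i\<le>k. c p ^ i) \<ge> 0" by (rule sign_power_sum(1)[OF c(3)])
    thus ?thesis unfolding \<open>n = p ^ k * M\<close>
      by (subst divisor_sum_prime_power_times[OF c(1,2) *(1,2,3)]) (use less.IH[of M] * in auto)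
  qed (use c in simp)
qed

lemma divisor_sum_square:
  assumes "n > 0" shows "(\<Sum>d | d dvd n\<^sup>2. c d) \<ge> 1"
  using assms
proof (induction n rule: less_induct)
  case (less n)
  show ?case
  proof (cases "n = 1")
    case False
    then obtain p k M where *: "prime p" "\<not> p dvd M" "M > 0" "M < n" "n = p ^ k * M"
      using less.prems by (auto intro: prime_power_split[of n])
    have ndvd: "\<not> p dvd M\<^sup>2" using * by (simp add: prime_dvd_power_iff)
    have M2: "M\<^sup>2 > 0" using * by simp
    have "n\<^sup>2 = p ^ (2 * k) * M\<^sup>2" unfolding \<open>n = p ^ k * M\<close> by (simp add: power_mult_distrib power_mult mult.commute)
    hence "(\<Sum>d | d dvd n\<^sup>2. c d) = (\<Sum>i\<le>2 * k. c p ^ i) * (\<Sum>d | d dvd M\<^sup>2. c d)"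
      using divisor_sum_prime_power_times[OF c(1,2) *(1) ndvd M2, of "2 * k"] by simp
    moreover have "(\<Sum>i\<le>2 * k. c p ^ i) \<ge> 1" by (rule sign_power_sum(2)[OF c(3)]) simp
    moreover have "(\<Sum>d | d dvd M\<^sup>2. c d) \<ge> 1" using less.IH * by blast
    ultimately show ?thesis using mult_mono[of 1 "\<Sum>i\<le>2 * k. c p ^ i" 1 "\<Sum>d | d dvd M\<^sup>2. c d"] by simp
  qed (use c in simp)
qed

text \<open>
With \<open>t = u^2\<close>, both series arise by summing \<open>c d * t^(d * k)\<close> over all \<open>d, k \<ge> 1\<close>, by rows or by
the value of \<open>d * k\<close>. The double series converges absolutely because \<open>2 * d * k \<ge> d + k\<close>. The
square root \<open>u\<close> of \<open>t\<close> is also what makes the inequality between means below polynomial.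
\<close>
lemma lambert_series:
  assumes "0 < u" "u < (1::real)"
  obtains S where "((\<lambda>d. c d * ((u\<^sup>2) ^ d / (1 - (u\<^sup>2) ^ d))) has_sum S) {1..}"
    "((\<lambda>n. (\<Sum>d | d dvd n. c d) * (u\<^sup>2) ^ n) has_sum S) {1..}"
proof -
  define t where "t = u\<^sup>2"
  have t: "0 < t" "t < 1" using assms by (auto simp: t_def power_less_one_iff)
  define h where "h d k = c d * t ^ (d * k)" for d k
  have c1: "\<bar>c n\<bar> \<le> 1" for n using c(3)[of n] by auto
  have gu: "((\<lambda>n. u ^ n) has_sum (u / (1 - u))) {1..}" using assms by (intro has_sum_geometric_from_1) auto
  hence "((\<lambda>(d, k). u ^ d * u ^ k) has_sum (u / (1 - u) * (u / (1 - u)))) ({1..} \<times> {1..})"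
    using assms by (intro has_sum_Times_mult) (auto dest: has_sum_imp_summable)
  hence "(\<lambda>(d, k). u ^ d * u ^ k) summable_on ({1..} \<times> {1..})" by (rule has_sum_imp_summable)
  hence "(\<lambda>x. norm ((\<lambda>(d, k). h d k) x)) summable_on ({1..} \<times> {1..})"
  proof (rule Infinite_Sum.abs_summable_on_comparison_test')
    fix x :: "nat \<times> nat" assume x: "x \<in> {1..} \<times> {1..}"
    obtain d k where dk: "x = (d, k)" by force
    have d: "d \<ge> 1" "k \<ge> 1" using x dk by auto
    have "d \<le> d * k" "k \<le> d * k" using d by simp_all
    hence "d + k \<le> 2 * (d * k)" by linarith
    hence "u ^ (2 * (d * k)) \<le> u ^ (d + k)" using assms by (intro power_decreasing) auto
    moreover have "\<bar>h d k\<bar> \<le> 1 * t ^ (d * k)" unfolding h_def abs_mult using c1 t by (intro mult_mono) auto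
    ultimately show "norm ((\<lambda>(d, k). h d k) x) \<le> (\<lambda>(d, k). u ^ d * u ^ k) x"
      by (simp add: dk t_def power_mult power_add)
  qed
  hence "(\<lambda>(d, k). h d k) summable_on ({1..} \<times> {1..})" by (rule Infinite_Sum.abs_summable_summable)
  then obtain S where S: "((\<lambda>(d, k). h d k) has_sum S) ({1..} \<times> {1..})" by (auto simp: summable_on_def)
  have "((\<lambda>d. c d * (t ^ d / (1 - t ^ d))) has_sum S) {1..}"
  proof (rule has_sum_SigmaD[OF S])
    fix d :: nat assume d: "d \<in> {1..}"
    have "t ^ d < 1" using d t by (simp add: power_less_one_iff)
    hence "((\<lambda>k. c d * (t ^ d) ^ k) has_sum (c d * (t ^ d / (1 - t ^ d)))) {1..}"
      using t by (intro has_sum_cmult_right has_sum_geometric_from_1) auto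
    thus "((\<lambda>k. (\<lambda>(d, k). h d k) (d, k)) has_sum (c d * (t ^ d / (1 - t ^ d)))) {1..}"
      by (simp add: h_def power_mult)
  qed
  moreover have "((\<lambda>n. (\<Sum>d | d dvd n. c d) * t ^ n) has_sum S) {1..}"
  proof -
    have "((\<lambda>n. \<Sum>d | d dvd n. h d (n div d)) has_sum S) {1..}" by (rule has_sum_divisors[OF S])
    also have "?this \<longleftrightarrow> ?thesis"
    proof (rule has_sum_cong)
      fix n :: nat assume "n \<in> {1..}"
      show "(\<Sum>d | d dvd n. h d (n div d)) = (\<Sum>d | d dvd n. c d) * t ^ n"
        unfolding sum_distrib_right by (intro sum.cong) (auto simp: h_def)
    qed
    finally show ?thesis .
  qed
  ultimately show ?thesis using that by (simp add: t_def)
qed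

end

text \<open>
The inequality between arithmetic and geometric mean for \<open>1, u^2, \<dots>, u^(2 * n)\<close>. The step from \<open>n\<close>
to \<open>n + 2\<close> adds the first and the last term, whose sum is at least twice the mean \<open>u^(n + 2)\<close>.
\<close>
lemma geometric_sum_amgm:
  assumes "u > (0::real)"
  shows "(\<Sum>i<Suc n. (u\<^sup>2) ^ i) \<ge> real (Suc n) * u ^ n"
proof (induction n rule: nat_induct2)
  case 1
  have "0 \<le> (1 - u)\<^sup>2" by simp
  thus ?case by (simp add: power2_eq_square algebra_simps)
next
  case (step n)
  have "(\<Sum>i<Suc (Suc (Suc n)). (u\<^sup>2) ^ i) = 1 + (\<Sum>i<Suc (Suc n). (u\<^sup>2) ^ Suc i)"
    by (subst sum.lessThan_Suc_shift) simp
  also have "(\<Sum>i<Suc (Suc n). (u\<^sup>2) ^ Suc i) = u\<^sup>2 * (\<Sum>i<Suc n. (u\<^sup>2) ^ i) + (u\<^sup>2) ^ Suc (Suc n)"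
    by (simp add: sum_distrib_left distrib_left)
  also have "1 + (u\<^sup>2 * (\<Sum>i<Suc n. (u\<^sup>2) ^ i) + (u\<^sup>2) ^ Suc (Suc n)) \<ge>
      1 + (u\<^sup>2 * (real (Suc n) * u ^ n) + (u\<^sup>2) ^ Suc (Suc n))"
    using step by (intro add_mono mult_left_mono) auto
  moreover have "1 + (u\<^sup>2) ^ Suc (Suc n) \<ge> 2 * u ^ Suc (Suc n)"
  proof -
    define x where "x = u ^ Suc (Suc n)"
    have "(u\<^sup>2) ^ Suc (Suc n) = x\<^sup>2" by (simp only: x_def power_mult[symmetric] mult.commute)
    moreover have "0 \<le> (1 - x)\<^sup>2" by simp
    ultimately show ?thesis by (simp only: x_def[symmetric] power2_diff) simp
  qed
  ultimately have "(\<Sum>i<Suc (Suc (Suc n)). (u\<^sup>2) ^ i) \<ge> u\<^sup>2 * (real (Suc n) * u ^ n) + 2 * u ^ Suc (Suc n)"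
    by linarith
  also have "u\<^sup>2 * (real (Suc n) * u ^ n) + 2 * u ^ Suc (Suc n) = real (Suc (n + 2)) * u ^ (n + 2)"
    by (simp add: power2_eq_square algebra_simps)
  finally show ?case by simp
qed simp

text \<open>
The difference between the \<open>n\<close>-th weight in the Lambert series and its limiting shape
\<open>1 / (n * (1 - t))\<close>, the latter being a multiple of the weight in \<open>L(1, \<chi>)\<close>. Both fractions are 0
for \<open>n = 0\<close>.
\<close>
definition lambert_gap :: "real \<Rightarrow> nat \<Rightarrow> real" where
  "lambert_gap t n = 1 / (real n * (1 - t)) - t ^ n / (1 - t ^ n)"

text \<open>
Write \<open>1 - t^k = (1 - t) * G k\<close>. Then monotonicity amounts to
\<open>n * (n + 1) * t^n \<le> G n * G (n + 1)\<close>, which follows from the inequality between means.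
\<close>
lemma lambert_gap_props:
  assumes "0 < u" "u < (1::real)" "n > 0"
  shows "lambert_gap (u\<^sup>2) n \<ge> 0" "lambert_gap (u\<^sup>2) (Suc n) \<le> lambert_gap (u\<^sup>2) n"
proof -
  define t where "t = u\<^sup>2"
  define G where "G k = (\<Sum>i<k. t ^ i)" for k
  have t: "0 < t" "t < 1" using assms by (auto simp: t_def power_less_one_iff)
  have G: "1 - t ^ k = (1 - t) * G k" for k unfolding G_def by (rule one_diff_power_eq)
  have Gge: "G k \<ge> real k * u ^ (k - 1)" if "k > 0" for k
    using geometric_sum_amgm[OF assms(1), of "k - 1"] that by (simp add: G_def t_def)
  have Gpos: "G k > 0" if "k > 0" for k
    using Gge[OF that] that assms(1) by (smt (verit) mult_pos_pos of_nat_0_less_iff zero_less_power)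
  have tn: "t ^ k = u ^ (2 * k)" for k by (simp add: t_def power_mult)
  have "t ^ n * real n \<le> G n"
  proof -
    have "u ^ (2 * n) * real n \<le> u ^ (n - 1) * real n"
      using assms by (intro mult_right_mono power_decreasing) auto
    thus ?thesis using Gge[OF assms(3)] by (simp add: tn mult.commute)
  qed
  hence "t ^ n / G n \<le> 1 / real n"
    using assms(3) Gpos[OF assms(3)] by (simp add: pos_divide_le_eq pos_le_divide_eq)
  hence "t ^ n / G n / (1 - t) \<le> 1 / real n / (1 - t)" using t by (intro divide_right_mono) auto
  hence "t ^ n / ((1 - t) * G n) \<le> 1 / (real n * (1 - t))" by (simp add: mult.commute)
  thus "lambert_gap (u\<^sup>2) n \<ge> 0" by (simp add: lambert_gap_def t_def[symmetric] G)
  have "(real n * u ^ (n - 1)) * (real (Suc n) * u ^ n) \<le> G n * G (Suc n)"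
    using Gge[OF assms(3)] Gge[of "Suc n"] Gpos[OF assms(3)] assms by (intro mult_mono) auto
  moreover have "u ^ (2 * n) \<le> u ^ (n - 1 + n)" using assms by (intro power_decreasing) auto
  hence "(real n * real (Suc n)) * u ^ (2 * n) \<le> (real n * real (Suc n)) * u ^ (n - 1 + n)"
    by (intro mult_left_mono) auto
  ultimately have key: "real n * real (Suc n) * t ^ n \<le> G n * G (Suc n)"
    by (simp add: tn power_add mult_ac)
  have "t ^ n / (1 - t ^ n) - t ^ Suc n / (1 - t ^ Suc n) = t ^ n * (1 - t) / ((1 - t ^ n) * (1 - t ^ Suc n))"
  proof -
    have "t ^ k < 1" if "k > 0" for k using that t by (simp add: power_less_one_iff)
    hence "1 - t ^ n \<noteq> 0" "1 - t ^ Suc n \<noteq> 0" using assms(3) by (metis diff_gt_0_iff_gt less_irrefl zero_less_Suc)+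
    thus ?thesis by (simp add: diff_frac_eq) (simp add: algebra_simps)
  qed
  also have "\<dots> = t ^ n / ((1 - t) * (G n * G (Suc n)))"
  proof -
    have "t ^ n * (1 - t) / (((1 - t) * G n) * ((1 - t) * G (Suc n))) =
        ((1 - t) * t ^ n) / ((1 - t) * ((1 - t) * (G n * G (Suc n))))" by (simp only: mult_ac)
    also have "\<dots> = t ^ n / ((1 - t) * (G n * G (Suc n)))"
      by (rule mult_divide_mult_cancel_left) (use t in simp)
    finally show ?thesis unfolding G .
  qed
  also have "\<dots> \<le> 1 / ((1 - t) * (real n * real (Suc n)))"
  proof -
    have "t ^ n * (real n * real (Suc n)) \<le> 1 * (G n * G (Suc n))" using key by (simp add: mult_ac)
    moreover have "G n * G (Suc n) > 0" "real n * real (Suc n) > 0"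
      using Gpos[OF assms(3)] Gpos[of "Suc n"] assms(3) by simp_all
    ultimately have "t ^ n / (G n * G (Suc n)) \<le> 1 / (real n * real (Suc n))"
      by (simp only: pos_divide_le_eq pos_le_divide_eq times_divide_eq_left)
    hence "t ^ n / (G n * G (Suc n)) / (1 - t) \<le> 1 / (real n * real (Suc n)) / (1 - t)"
      using t by (intro divide_right_mono) auto
    thus ?thesis by (simp add: mult_ac)
  qed
  also have "\<dots> = 1 / (real n * (1 - t)) - 1 / (real (Suc n) * (1 - t))"
  proof -
    have "1 / real n - 1 / real (Suc n) = 1 / (real n * real (Suc n))" using assms(3) by (simp add: field_simps)
    hence "(1 / real n - 1 / real (Suc n)) / (1 - t) = 1 / (real n * real (Suc n)) / (1 - t)" by simp
    thus ?thesis by (simp add: diff_divide_distrib mult_ac)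
  qed
  finally show "lambert_gap (u\<^sup>2) (Suc n) \<le> lambert_gap (u\<^sup>2) n"
    by (simp add: lambert_gap_def t_def[symmetric])
qed

text \<open>
If \<open>L(1, \<chi>) = 0\<close>, subtracting the zero series \<open>\<Sum> \<chi> n / (n * (1 - t))\<close> turns the Lambert series
into minus a sum with the decreasing weights \<open>lambert_gap\<close>, so it is bounded by \<open>2 * m\<close>. On the other
hand its power series has nonnegative coefficients, at least 1 at squares, so it is unbounded as
\<open>t\<close> tends to 1.
\<close>
theorem L_one_nonzero:
  assumes "m > 0" "dirichlet_char m \<chi>" "\<chi> \<noteq> trivial_char m"
  shows "L_one \<chi> \<noteq> 0"
proof
  assume zero: "L_one \<chi> = 0"
  define c where "c n = Re (\<chi> n)" for n
  have \<chi>: "\<chi> n = of_real (c n)" for n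
    using zero_imp_real_char[OF assms zero, of n] by (simp add: c_def complex_eq_iff)
  have c: "c 1 = 1" "c (a * b) = c a * c b" for a b
  proof -
    show "c 1 = 1" using assms(2) by (simp add: dirichlet_char_def c_def)
    have "complex_of_real (c (a * b)) = of_real (c a * c b)"
      using dirichlet_char_mult[OF assms(2), of a b] unfolding \<chi> by simp
    thus "c (a * b) = c a * c b" by (simp only: of_real_eq_iff)
  qed
  have c3: "c n \<in> {-1, 0, 1}" for n
  proof (cases "coprime n m")
    case True
    have "\<bar>c n\<bar> = 1" using dirichlet_char_norm_coprime[OF assms(1,2) True] \<chi>[of n] by simp
    thus ?thesis by auto
  next
    case False
    hence "\<chi> n = 0" using assms(2) by (simp add: dirichlet_char_def)
    thus ?thesis by (simp add: c_def)
  qed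
  \<comment> \<open>With these choices \<open>t^(k^2) \<ge> 1 / 2\<close> for all \<open>k \<le> K\<close>, so the squares alone contribute \<open>K / 2 > 2 * m\<close>.\<close>
  define K where "K = 4 * m + 1"
  define u where "u = root (2 * K\<^sup>2) (1 / 2)"
  have K: "2 * K\<^sup>2 > 0" by (simp add: K_def)
  have u: "0 < u" "u < 1" using K by (auto simp: u_def)
  have uK: "u ^ (2 * K\<^sup>2) = 1 / 2" unfolding u_def using K by (intro real_root_pow_pos2) auto
  define t where "t = u\<^sup>2"
  have t: "0 < t" "t < 1" using u by (auto simp: t_def power_less_one_iff)
  obtain S where S1: "((\<lambda>d. c d * (t ^ d / (1 - t ^ d))) has_sum S) {1..}"
    and S2: "((\<lambda>n. (\<Sum>d | d dvd n. c d) * t ^ n) has_sum S) {1..}"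
    using lambert_series[of c u] c c3 u unfolding t_def by blast
  have "(\<Sum>k\<in>{1..K}. (1 / 2 :: real)) \<le> (\<Sum>k\<in>{1..K}. (\<Sum>d | d dvd k\<^sup>2. c d) * t ^ (k\<^sup>2))"
  proof (rule sum_mono)
    fix k assume k: "k \<in> {1..K}"
    hence "k\<^sup>2 \<le> K\<^sup>2" by (intro power_mono) auto
    hence "u ^ (2 * K\<^sup>2) \<le> u ^ (2 * k\<^sup>2)" using u by (intro power_decreasing) auto
    hence "1 / 2 \<le> u ^ (2 * k\<^sup>2)" unfolding uK .
    hence "1 / 2 \<le> t ^ (k\<^sup>2)" by (simp add: t_def power_mult)
    thus "1 / 2 \<le> (\<Sum>d | d dvd k\<^sup>2. c d) * t ^ (k\<^sup>2)"
      using mult_mono[of 1 "\<Sum>d | d dvd k\<^sup>2. c d" "1 / 2" "t ^ (k\<^sup>2)"] divisor_sum_square[of c k] c c3 k by auto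
  qed
  also have "\<dots> = (\<Sum>n\<in>(\<lambda>k. k\<^sup>2) ` {1..K}. (\<Sum>d | d dvd n. c d) * t ^ n)"
    by (subst sum.reindex) (auto simp: inj_on_def power2_eq_iff_nonneg)
  also have "\<dots> \<le> S"
    using divisor_sum_nonneg[of c] c c3 t
    by (intro finite_sum_le_has_sum[OF S2]) (auto intro!: mult_nonneg_nonneg)
  finally have lower: "real K / 2 \<le> S" by simp
  have "((\<lambda>d. c d * (t ^ d / (1 - t ^ d))) has_sum S) {1..} \<longleftrightarrow>
        ((\<lambda>d. c d * (t ^ d / (1 - t ^ d))) has_sum S) UNIV"
    by (rule has_sum_cong_neutral) (auto simp: not_le)
  with S1 have s1: "(\<lambda>d. c d * (t ^ d / (1 - t ^ d))) sums S" by (blast intro: has_sum_imp_sums)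
  have "(\<lambda>n. \<chi> n / of_nat n) sums 0"
    using L_one_summable[OF assms] zero unfolding L_one_def by (metis summable_sums)
  hence "(\<lambda>n. Re (\<chi> n / of_nat n)) sums Re 0" by (rule sums_Re)
  hence "(\<lambda>n. c n / real n) sums 0" by (simp add: \<chi>)
  hence "(\<lambda>n. c n / real n * (1 / (1 - t))) sums (0 * (1 / (1 - t)))" by (rule sums_mult2)
  from sums_diff[OF this s1] have "(\<lambda>n. lambert_gap t n *\<^sub>R c n) sums (-S)"
    by (simp add: lambert_gap_def algebra_simps)
  hence "(\<lambda>N. norm (\<Sum>n<N. lambert_gap t n *\<^sub>R c n)) \<longlonglongrightarrow> norm (-S)"
    unfolding sums_def by (rule tendsto_norm)
  moreover have "norm (\<Sum>n<N. lambert_gap t n *\<^sub>R c n) \<le> 2 * real m" for N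
  proof (cases "N \<ge> 1")
    case True
    have "lambert_gap t 0 = 0" by (simp add: lambert_gap_def)
    hence "(\<Sum>n<N. lambert_gap t n *\<^sub>R c n) = (\<Sum>n=1..<N. lambert_gap t n *\<^sub>R c n)"
      using True by (simp add: lessThan_atLeast0 sum.atLeast_Suc_lessThan)
    also have "norm \<dots> \<le> 2 * real m * lambert_gap t 1"
    proof (rule abel_bound[OF _ True])
      show "norm (\<Sum>k<N. c k) \<le> real m" for N
        using char_sum_bound[OF assms, of N] by (simp add: \<chi> flip: of_real_sum)
    qed (use lambert_gap_props[OF u] in \<open>auto simp: t_def\<close>)
    also have "lambert_gap t 1 = 1" using t by (simp add: lambert_gap_def diff_divide_distrib[symmetric])
    finally show ?thesis by simp
  next
    case False
    hence "N = 0" by simp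
    thus ?thesis by simp
  qed
  ultimately have "norm (-S) \<le> 2 * real m"
    by (intro tendsto_upperbound) (auto intro: always_eventually)
  thus False using lower by (simp add: K_def)
qed

section \<open>Primes in arithmetic progressions\<close>

lemma log_derivative_bounded_near_one:
  assumes "m > 0" "dirichlet_char m \<chi>" "\<chi> \<noteq> trivial_char m"
  shows "\<exists>C. \<forall>\<^sub>F s in at_right 1. norm (dirichlet_series (mangoldt_twist \<chi>) s) \<le> C"
proof -
  define c where "c = norm (L_one \<chi>)"
  define M where "M = 4 * real m + 1"
  have c: "c > 0" using L_one_nonzero[OF assms] by (simp add: c_def)
  have M: "M > 0" by (simp add: M_def)
  have "\<forall>\<^sub>F s in at_right 1. s \<in> {1<..<1 + c / (2 * M)}"
    using c M by (intro eventually_at_right_real) auto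
  hence "\<forall>\<^sub>F s in at_right 1. norm (dirichlet_series (mangoldt_twist \<chi>) s) \<le> M / (c / 2)"
  proof eventually_elim
    case (elim s)
    hence s: "s > 1" "s - 1 \<le> c / (2 * M)" by auto
    have "M * (s - 1) \<le> M * (c / (2 * M))" using s M by (intro mult_left_mono) auto
    also have "\<dots> = c / 2" using M by simp
    finally have "norm (dirichlet_series \<chi> s - L_one \<chi>) \<le> c / 2"
      using L_near_one[OF assms s(1)] by (simp add: M_def)
    moreover have "norm (L_one \<chi>) - norm (dirichlet_series \<chi> s) \<le> norm (dirichlet_series \<chi> s - L_one \<chi>)"
      by (metis norm_minus_commute norm_triangle_ineq2)
    ultimately have L: "norm (dirichlet_series \<chi> s) \<ge> c / 2" by (simp add: c_def)
    have "norm (dirichlet_series (mangoldt_twist \<chi>) s) * (c / 2) \<le>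
        norm (dirichlet_series (mangoldt_twist \<chi>) s) * norm (dirichlet_series \<chi> s)"
      using L by (intro mult_left_mono) auto
    also have "\<dots> = norm (dirichlet_series (log_twist \<chi>) s)"
      using mangoldt_L_eq[OF assms(1,2) s(1)] by (simp flip: norm_mult)
    also have "\<dots> \<le> M" using log_twist_series_bound[OF assms s(1)] by (simp add: M_def)
    finally show ?case using c by (simp add: field_simps)
  qed
  thus ?thesis by blast
qed

text \<open>
The prime powers with exponent at least 2 contribute at most
\<open>\<Sum> ln p * (1 / p^2 + 1 / p^3 + \<dots>) \<le> \<Sum> 2 * ln p / p^2\<close>, so they do not matter for the divergence.
\<close>
lemma proper_prime_powers_bounded:
  "\<exists>C. \<forall>N. (\<Sum>n | n < N \<and> primepow n \<and> \<not> prime n. mangoldt n / real n) \<le> C"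
proof (intro exI allI)
  fix N :: nat
  let ?Q = "{n. n < N \<and> primepow n \<and> \<not> prime n}"
  define P where "P = {p. p < N \<and> prime p}"
  define I where "I = P \<times> {2..<N + 2}"
  have fin: "finite P" "finite I" by (auto simp: P_def I_def)
  have sub: "?Q \<subseteq> (\<lambda>(p, k). p ^ k) ` I"
  proof
    fix n assume n: "n \<in> ?Q"
    then obtain p k where pk: "prime p" "k > 0" "n = p ^ k" by (auto simp: primepow_def)
    have k: "k \<noteq> 1" using n pk by auto
    have p: "p > 1" using pk(1) by (simp add: prime_gt_Suc_0_nat)
    have "k < p ^ k" by (rule power_gt_expt) (use p in simp)
    moreover have "p \<le> p ^ k" using p pk(2) by (simp add: self_le_power)
    ultimately have "(p, k) \<in> I" using pk n k by (auto simp: I_def P_def)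
    thus "n \<in> (\<lambda>(p, k). p ^ k) ` I" using pk(3) by force
  qed
  have geom: "(\<Sum>k=2..<M + 2. x ^ k) \<le> 2 * x\<^sup>2" if x: "0 \<le> x" "x \<le> 1 / 2" for x :: real and M
  proof -
    have "(\<Sum>k=2..<M + 2. x ^ k) * (1 - x) = x\<^sup>2 - x ^ (M + 2)"
    proof (induction M)
      case (Suc M)
      have "(\<Sum>k=2..<Suc M + 2. x ^ k) = (\<Sum>k=2..<M + 2. x ^ k) + x ^ (M + 2)" by simp
      thus ?case using Suc.IH by (simp only: distrib_right) (simp add: algebra_simps)
    qed (simp add: power2_eq_square)
    also have "\<dots> \<le> x\<^sup>2" using x by simp
    finally have "(\<Sum>k=2..<M + 2. x ^ k) * (1 - x) \<le> x\<^sup>2" .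
    moreover have "(\<Sum>k=2..<M + 2. x ^ k) * (1 / 2) \<le> (\<Sum>k=2..<M + 2. x ^ k) * (1 - x)"
      using x by (intro mult_left_mono sum_nonneg) auto
    ultimately show ?thesis by linarith
  qed
  have "(\<Sum>n\<in>?Q. mangoldt n / real n) \<le> (\<Sum>n\<in>(\<lambda>(p, k). p ^ k) ` I. mangoldt n / real n)"
    using fin by (intro sum_mono2[OF _ sub]) (auto intro!: divide_nonneg_nonneg mangoldt_nonneg)
  also have "\<dots> \<le> sum ((\<lambda>n. mangoldt n / real n) \<circ> (\<lambda>(p, k). p ^ k)) I"
    using fin by (intro sum_image_le) (auto intro!: divide_nonneg_nonneg mangoldt_nonneg)
  also have "\<dots> = (\<Sum>(p, k)\<in>I. ln (real p) * (1 / real p) ^ k)"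
    by (intro sum.cong) (auto simp: I_def P_def power_one_over)
  also have "\<dots> = (\<Sum>p\<in>P. ln (real p) * (\<Sum>k=2..<N + 2. (1 / real p) ^ k))"
    unfolding I_def by (subst sum.cartesian_product[symmetric]) (simp only: sum_distrib_left)
  also have "\<dots> \<le> (\<Sum>p\<in>P. ln (real p) * (2 * (1 / real p)\<^sup>2))"
  proof (rule sum_mono)
    fix p assume "p \<in> P"
    hence p: "p \<ge> 2" by (auto simp: P_def prime_ge_2_nat)
    hence "1 / real p \<le> 1 / 2" by (intro divide_left_mono) auto
    thus "ln (real p) * (\<Sum>k=2..<N + 2. (1 / real p) ^ k) \<le> ln (real p) * (2 * (1 / real p)\<^sup>2)"
      using p by (intro mult_left_mono geom) auto
  qed
  also have "\<dots> \<le> (\<Sum>p\<in>P. 2 * ((1 + ln (real p)) * real p powr -2))"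
  proof (rule sum_mono)
    fix p assume "p \<in> P"
    hence p: "p \<ge> 2" by (auto simp: P_def prime_ge_2_nat)
    have "real p powr -2 = (1 / real p)\<^sup>2" by (simp add: powr_minus power_one_over inverse_eq_divide)
    thus "ln (real p) * (2 * (1 / real p)\<^sup>2) \<le> 2 * ((1 + ln (real p)) * real p powr -2)"
      using mult_right_mono[of "ln (real p)" "1 + ln (real p)" "(1 / real p)\<^sup>2"] by simp
  qed
  also have "\<dots> = 2 * (\<Sum>p\<in>P. (1 + ln (real p)) * real p powr -2)" by (simp add: sum_distrib_left)
  also have "\<dots> \<le> 2 * (\<Sum>n. (1 + ln (real n)) * real n powr -2)"
  proof (intro mult_left_mono sum_le_suminf summable_ln_powr ballI)
    fix n :: nat
    show "0 \<le> (1 + ln (real n)) * real n powr -2" by (cases "n = 0") auto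
  qed (use fin in auto)
  finally show "(\<Sum>n\<in>?Q. mangoldt n / real n) \<le> 2 * (\<Sum>n. (1 + ln (real n)) * real n powr -2)" .
qed

lemma progression_series_bounded:
  assumes m: "m > 0" and fin: "finite {p. prime p \<and> [b * p = 1] (mod m)}"
  shows "\<exists>C. \<forall>s>1. (\<Sum>n. (if [b * n = 1] (mod m) then mangoldt n else 0) * real n powr -s) \<le> C"
proof -
  define A where "A = {p. prime p \<and> [b * p = 1] (mod m)}"
  have finA: "finite A" using fin by (simp add: A_def)
  obtain C where C: "\<And>N. (\<Sum>n | n < N \<and> primepow n \<and> \<not> prime n. mangoldt n / real n) \<le> C"
    using proper_prime_powers_bounded by blast
  define g where "g s n = (if [b * n = 1] (mod m) then mangoldt n else 0) * real n powr -s" for s n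
  have "(\<Sum>n. g s n) \<le> (\<Sum>p\<in>A. mangoldt p / real p) + C" if s: "s > 1" for s
  proof (rule suminf_le_const)
    show "summable (g s)" unfolding g_def by (rule average_mangoldt_series(2)[OF m s])
    fix N :: nat
    let ?Q = "{n. n < N \<and> primepow n \<and> \<not> prime n}"
    have le: "g s n \<le> mangoldt n / real n" for n
    proof (cases "n = 0")
      case False
      hence "real n powr -s \<le> real n powr -1" using s by (intro powr_mono) auto
      hence "mangoldt n * real n powr -s \<le> mangoldt n * (1 / real n)"
        using False by (intro mult_left_mono mangoldt_nonneg) (auto simp: powr_minus field_simps)
      moreover have "0 \<le> mangoldt n / real n" by (intro divide_nonneg_nonneg mangoldt_nonneg) auto
      ultimately show ?thesis by (auto simp: g_def)
    qed (simp add: g_def)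
    have nonneg: "mangoldt n / real n \<ge> 0" for n by (intro divide_nonneg_nonneg mangoldt_nonneg) auto
    have "(\<Sum>n<N. g s n) = (\<Sum>n\<in>{n\<in>A. n < N} \<union> ?Q. g s n)"
    proof (rule sum.mono_neutral_right)
      show "\<forall>n\<in>{..<N} - ({n\<in>A. n < N} \<union> ?Q). g s n = 0"
        by (auto simp: g_def A_def mangoldt_def)
    qed auto
    also have "\<dots> \<le> (\<Sum>n\<in>{n\<in>A. n < N} \<union> ?Q. mangoldt n / real n)" by (intro sum_mono le)
    also have "\<dots> = (\<Sum>n\<in>{n\<in>A. n < N}. mangoldt n / real n) + (\<Sum>n\<in>?Q. mangoldt n / real n)"
      by (rule sum.union_disjoint) (auto simp: A_def)
    also have "(\<Sum>n\<in>{n\<in>A. n < N}. mangoldt n / real n) \<le> (\<Sum>p\<in>A. mangoldt p / real p)"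
      by (intro sum_mono2 finA nonneg) auto
    also have "(\<Sum>n\<in>?Q. mangoldt n / real n) \<le> C" by (rule C)
    finally show "(\<Sum>n<N. g s n) \<le> (\<Sum>p\<in>A. mangoldt p / real p) + C" by simp
  qed
  thus ?thesis unfolding g_def by blast
qed

text \<open>
Suppose that \<open>-L'/L\<close> is bounded by \<open>C\<close> near 1. In \<open>-L'\<close> all terms with \<open>n \<ge> K\<close> carry a weight
\<open>ln n \<ge> ln K\<close>, so \<open>ln K * L(s) - K * ln K \<le> -L'(s) \<le> C * L(s)\<close>. For \<open>ln K \<ge> C + 1\<close> this bounds
\<open>L(s)\<close>, contrary to the divergence of the harmonic series along \<open>1, m + 1, 2 * m + 1, \<dots>\<close>.
\<close>
lemma trivial_log_derivative_unbounded:
  assumes m: "m > 0"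
  shows "\<not> (\<forall>\<^sub>F s in at_right 1. norm (dirichlet_series (mangoldt_twist (trivial_char m)) s) \<le> C)"
proof
  assume bdd: "\<forall>\<^sub>F s in at_right 1. norm (dirichlet_series (mangoldt_twist (trivial_char m)) s) \<le> C"
  let ?\<chi> = "trivial_char m"
  note \<chi> = dirichlet_char_trivial[OF m]
  define e where "e n = (if coprime n m then 1 else 0 :: real)" for n
  have e: "?\<chi> n = of_real (e n)" "0 \<le> e n" "e n \<le> 1" for n by (auto simp: trivial_char_def e_def)
  obtain K where K: "ln (real K) \<ge> C + 1" "K \<ge> 1"
  proof
    have "exp (C + 1) \<le> real (nat \<lceil>exp (C + 1)\<rceil> + 1)"
      using real_nat_ceiling_ge[of "exp (C + 1)"] unfolding of_nat_add by linarith
    moreover from this have "real (nat \<lceil>exp (C + 1)\<rceil> + 1) > 0"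
      using exp_gt_zero[of "C + 1"] by linarith
    ultimately show "ln (real (nat \<lceil>exp (C + 1)\<rceil> + 1)) \<ge> C + 1"
      using ln_ge_iff by blast
  qed auto
  define E where "E = real K * ln (real K)"
  have bound: "\<forall>\<^sub>F s in at_right 1. (\<Sum>n<N. e n * real n powr -s) \<le> E" for N
    using bdd eventually_at_right_less[of 1]
  proof eventually_elim
    case (elim s)
    hence s: "s > 1" by simp
    define l where "l N = (\<Sum>n<N. e n * real n powr -s)" for N
    define L where "L = Re (dirichlet_series ?\<chi> s)"
    have part: "dirichlet_partial ?\<chi> s N = of_real (l N)" for N
      by (simp add: dirichlet_partial_def l_def e(1))
    have lim: "dirichlet_partial ?\<chi> s \<longlonglongrightarrow> dirichlet_series ?\<chi> s"
      by (intro dirichlet_partial_tendsto[OF s] dirichlet_char_norm_le_ln[OF m \<chi>])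
    have limL: "l \<longlonglongrightarrow> L" using tendsto_Re[OF lim] by (simp add: part L_def)
    have Im0: "Im (dirichlet_series ?\<chi> s) = 0"
      using tendsto_Im[OF lim] by (simp add: part LIMSEQ_const_iff)
    have inc: "incseq l" unfolding l_def using e(2) by (intro incseq_SucI) auto
    have lL: "l N \<le> L" for N by (rule incseq_le[OF inc limL])
    have L0: "L \<ge> 0" using lL[of 0] by (simp add: l_def)
    have normL: "norm (dirichlet_series ?\<chi> s) = L" using Im0 L0 by (simp add: cmod_def L_def)
    have D: "norm (dirichlet_series (log_twist ?\<chi>) s) \<le> C * L"
    proof -
      have "norm (dirichlet_series (log_twist ?\<chi>) s) = norm (dirichlet_series (mangoldt_twist ?\<chi>) s) * L"
        using mangoldt_L_eq[OF m \<chi> s] normL by (metis norm_mult)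
      also have "\<dots> \<le> C * L" using elim L0 by (intro mult_right_mono) auto
      finally show ?thesis .
    qed
    have limD: "(\<lambda>N. Re (dirichlet_partial (log_twist ?\<chi>) s N)) \<longlonglongrightarrow> Re (dirichlet_series (log_twist ?\<chi>) s)"
      by (intro tendsto_Re dirichlet_partial_tendsto[OF s] dirichlet_char_norm_le_ln[OF m \<chi>])
    have "ln (real K) * L - E \<le> Re (dirichlet_series (log_twist ?\<chi>) s)"
    proof (rule LIMSEQ_le)
      show "(\<lambda>N. ln (real K) * l N - E) \<longlonglongrightarrow> ln (real K) * L - E"
        by (intro tendsto_intros limL)
      show "(\<lambda>N. Re (dirichlet_partial (log_twist ?\<chi>) s N)) \<longlonglongrightarrow> Re (dirichlet_series (log_twist ?\<chi>) s)"
        by (rule limD)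
      show "\<exists>N0. \<forall>N\<ge>N0. ln (real K) * l N - E \<le> Re (dirichlet_partial (log_twist ?\<chi>) s N)"
      proof (intro exI allI impI)
        fix N assume N: "N \<ge> K"
        have "ln (real K) * l N - Re (dirichlet_partial (log_twist ?\<chi>) s N) =
            (\<Sum>n<N. (ln (real K) - ln (real n)) * (e n * real n powr -s))"
          by (simp add: l_def dirichlet_partial_def log_twist_def e(1) sum_distrib_left sum_subtractf[symmetric] algebra_simps)
        also have "\<dots> \<le> (\<Sum>n<N. if n < K then ln (real K) else 0)"
        proof (rule sum_mono)
          fix n :: nat
          show "(ln (real K) - ln (real n)) * (e n * real n powr -s) \<le> (if n < K then ln (real K) else 0)"
          proof (cases "n = 0")
            case True
            thus ?thesis using K by auto
          next
            case False
            have "real n powr -s \<le> real n powr 0" using s False by (intro powr_mono) auto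
            hence x: "0 \<le> e n * real n powr -s" "e n * real n powr -s \<le> 1"
              using e(2,3)[of n] False mult_mono[of "e n" 1 "real n powr -s" 1] by auto
            show ?thesis
            proof (cases "n < K")
              case True
              have "(ln (real K) - ln (real n)) * (e n * real n powr -s) \<le> (ln (real K) - 0) * 1"
                using x False True by (intro mult_mono) auto
              thus ?thesis using True by simp
            next
              case nK: False
              have "ln (real K) - ln (real n) \<le> 0" using nK K(2) by simp
              thus ?thesis using x nK by (simp add: mult_nonpos_nonneg)
            qed
          qed
        qed
        also have "\<dots> = (\<Sum>n<K. ln (real K))"
          using N by (intro sum.mono_neutral_cong_right) auto
        also have "\<dots> = E" by (simp add: E_def)
        finally show "ln (real K) * l N - E \<le> Re (dirichlet_partial (log_twist ?\<chi>) s N)" by simp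
      qed
    qed
    also have "\<dots> \<le> norm (dirichlet_series (log_twist ?\<chi>) s)" by (rule complex_Re_le_cmod)
    also have "\<dots> \<le> C * L" by (rule D)
    finally have "(ln (real K) - C) * L \<le> E" by (simp add: algebra_simps)
    moreover have "1 * L \<le> (ln (real K) - C) * L" using K L0 by (intro mult_right_mono) auto
    ultimately have "L \<le> E" by simp
    thus ?case using lL[of N] by (simp add: l_def)
  qed
  have bound1: "(\<Sum>n<N. e n / real n) \<le> E" for N
  proof (rule tendsto_upperbound[OF _ bound])
    have "((\<lambda>s. \<Sum>n<N. e n * real n powr -s) \<longlongrightarrow> (\<Sum>n<N. e n * real n powr -1)) (at_right 1)"
    proof (intro tendsto_sum tendsto_mult tendsto_const)
      fix n
      show "((\<lambda>s. real n powr -s) \<longlongrightarrow> real n powr -1) (at_right 1)"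
      proof (cases "n = 0")
        case False
        thus ?thesis by (intro tendsto_powr tendsto_const tendsto_minus tendsto_ident_at) simp
      qed simp
    qed
    thus "((\<lambda>s. \<Sum>n<N. e n * real n powr -s) \<longlongrightarrow> (\<Sum>n<N. e n / real n)) (at_right 1)"
      by (simp add: powr_minus field_simps)
  qed simp
  have "summable (\<lambda>n. e n / real n)"
    by (rule summableI_nonneg_bounded[OF _ bound1]) (simp add: e(2))
  moreover have "inj (\<lambda>j. m * j + 1)" using m by (auto simp: inj_on_def)
  ultimately have "summable ((\<lambda>n. e n / real n) \<circ> (\<lambda>j. m * j + 1))"
    by (intro summable_reindex) (auto simp: e(2))
  hence "summable (\<lambda>j. (1 / real m) * inverse (of_nat (Suc j)))"
  proof (rule summable_comparison_test')
    fix j :: nat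
    have "coprime (m * j + 1) m"
    proof (rule coprimeI)
      fix d assume "d dvd m * j + 1" "d dvd m"
      thus "d dvd 1" by (metis dvd_add_right_iff dvd_mult2)
    qed
    hence "e (m * j + 1) = 1" unfolding e_def by simp
    moreover have "1 / (real m * real (Suc j)) \<le> 1 / real (m * j + 1)"
      using m by (intro divide_left_mono) (auto simp: algebra_simps Suc_le_eq intro!: add_pos_nonneg)
    ultimately show "norm ((1 / real m) * inverse (of_nat (Suc j))) \<le> ((\<lambda>n. e n / real n) \<circ> (\<lambda>j. m * j + 1)) j"
      using m by (simp add: field_simps)
  qed
  hence "summable (\<lambda>j. inverse (real (Suc j)))" using m by (subst (asm) summable_cmult_iff) auto
  hence "summable (\<lambda>j. inverse (real j))" by (subst (asm) summable_Suc_iff)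
  thus False using not_summable_harmonic[where ?'a = real] by simp
qed

text \<open>
Let \<open>b\<close> be inverse to \<open>a\<close> modulo \<open>m\<close>. If there were finitely many such primes, then the average of
\<open>\<chi> b\<close> times the series \<open>-L'/L\<close> of \<open>\<chi>\<close> would be bounded near 1. The summands for
nontrivial \<open>\<chi>\<close> are bounded because \<open>L(1, \<chi>) \<noteq> 0\<close>. So the one for the trivial character would be
bounded as well, which it is not.
\<close>
theorem dirichlet_primes_in_progression:
  fixes a m :: nat
  assumes m: "m > 0" and a: "coprime a m"
  shows "infinite {p. prime p \<and> [p = a] (mod m)}"
proof
  assume fin: "finite {p. prime p \<and> [p = a] (mod m)}"
  obtain b where b: "[a * b = 1] (mod m)" using cong_solve_coprime_nat[OF a] by auto
  have "[p = a] (mod m)" if "[b * p = 1] (mod m)" for p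
  proof -
    have "[a * (b * p) = a * 1] (mod m)" using that by (rule cong_scalar_left)
    moreover have "[a * b * p = 1 * p] (mod m)" using b by (rule cong_scalar_right)
    ultimately show ?thesis by (simp add: mult.assoc) (metis cong_sym cong_trans)
  qed
  hence "{p. prime p \<and> [b * p = 1] (mod m)} \<subseteq> {p. prime p \<and> [p = a] (mod m)}" by auto
  hence "finite {p. prime p \<and> [b * p = 1] (mod m)}" using fin finite_subset by blast
  then obtain C where C: "\<And>s. s > 1 \<Longrightarrow>
      (\<Sum>n. (if [b * n = 1] (mod m) then mangoldt n else 0) * real n powr -s) \<le> C"
    using progression_series_bounded[OF m] by blast
  let ?X = "dirichlet_chars m"
  let ?B = "\<lambda>\<chi> s. dirichlet_series (mangoldt_twist \<chi>) s"
  define Y where "Y = ?X - {trivial_char m}"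
  have finY: "finite Y" "finite ?X" using finite_dirichlet_chars[OF m] by (auto simp: Y_def)
  have "\<forall>\<chi>\<in>Y. \<exists>c. \<forall>\<^sub>F s in at_right 1. norm (?B \<chi> s) \<le> c"
    using log_derivative_bounded_near_one[OF m] by (auto simp: Y_def dirichlet_chars_def)
  then obtain c where "\<forall>\<chi>\<in>Y. \<forall>\<^sub>F s in at_right 1. norm (?B \<chi> s) \<le> c \<chi>" by metis
  hence ev: "\<forall>\<^sub>F s in at_right 1. \<forall>\<chi>\<in>Y. norm (?B \<chi> s) \<le> c \<chi>"
    by (intro eventually_ball_finite finY)
  have cop: "coprime b m" using b by (metis cong_imp_coprime cong_sym coprime_1_left coprime_mult_left_iff)
  have "\<forall>\<^sub>F s in at_right 1. norm (?B (trivial_char m) s) \<le> real (card ?X) * C + (\<Sum>\<chi>\<in>Y. c \<chi>)"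
    using ev eventually_at_right_less[of 1]
  proof eventually_elim
    case (elim s)
    hence s: "s > 1" by simp
    define T where "T = (\<Sum>n. (if [b * n = 1] (mod m) then mangoldt n else 0) * real n powr -s)"
    have T0: "T \<ge> 0" unfolding T_def using average_mangoldt_series(2)[OF m s]
      by (intro suminf_nonneg) (auto simp: mangoldt_nonneg)
    have "of_real (real (card ?X) * T) = (\<Sum>\<chi>\<in>?X. \<chi> b * ?B \<chi> s)"
      unfolding T_def by (rule average_mangoldt_series(1)[OF m s, symmetric])
    also have "\<dots> = trivial_char m b * ?B (trivial_char m) s + (\<Sum>\<chi>\<in>Y. \<chi> b * ?B \<chi> s)"
      unfolding Y_def using finY trivial_in_chars[OF m] by (subst sum.remove[of _ "trivial_char m"]) auto
    finally have "?B (trivial_char m) s = of_real (real (card ?X) * T) - (\<Sum>\<chi>\<in>Y. \<chi> b * ?B \<chi> s)"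
      using cop by (simp add: trivial_char_def)
    hence "norm (?B (trivial_char m) s) \<le> norm (complex_of_real (real (card ?X) * T)) + norm (\<Sum>\<chi>\<in>Y. \<chi> b * ?B \<chi> s)"
      by (metis norm_triangle_ineq4)
    also have "norm (complex_of_real (real (card ?X) * T)) \<le> real (card ?X) * C"
      using T0 C[OF s] unfolding T_def[symmetric] norm_of_real by (simp add: abs_mult mult_left_mono)
    also have "norm (\<Sum>\<chi>\<in>Y. \<chi> b * ?B \<chi> s) \<le> (\<Sum>\<chi>\<in>Y. c \<chi>)"
    proof (rule sum_norm_le)
      fix \<chi> assume \<chi>: "\<chi> \<in> Y"
      have "norm (\<chi> b) * norm (?B \<chi> s) \<le> 1 * norm (?B \<chi> s)"
        using \<chi> by (intro mult_right_mono dirichlet_char_norm_le[OF m]) (auto simp: Y_def dirichlet_chars_def)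
      thus "norm (\<chi> b * ?B \<chi> s) \<le> c \<chi>" using elim \<chi> by (auto simp: norm_mult intro: order.trans)
    qed
    finally show ?case by simp
  qed
  thus False using trivial_log_derivative_unbounded[OF m] by blast
qed

section \<open>Filtered rings and algebraic extensions\<close>

definition complex_subfield :: "complex set \<Rightarrow> bool" where
  "complex_subfield K \<longleftrightarrow> 1 \<in> K \<and> (\<forall>x\<in>K. \<forall>y\<in>K. x - y \<in> K \<and> x * y \<in> K \<and> inverse x \<in> K)"

text \<open>
The model is the filtration of a finitely generated ring by the powers of a maximal ideal. An
abstract filtration is easier to carry along field extensions than the powers of an ideal.
\<close>
locale filtered_ring =
  fixes R :: "complex set" and I :: "nat \<Rightarrow> complex set"
  assumes one: "1 \<in> R"
    and I0: "I 0 = R"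
    and zero: "0 \<in> I k"
    and Suc_subset: "I (Suc k) \<subseteq> I k"
    and diff: "x \<in> I k \<Longrightarrow> y \<in> I k \<Longrightarrow> x - y \<in> I k"
    and mult: "x \<in> I i \<Longrightarrow> y \<in> I j \<Longrightarrow> x * y \<in> I (i + j)"
    and separated: "(\<And>k. x \<in> I k) \<Longrightarrow> x = 0"
    and finite_residues: "\<exists>T. finite T \<and> T \<subseteq> R \<and> (\<forall>x\<in>R. \<exists>t\<in>T. x - t \<in> I 1)"
begin

lemma antimono: "i \<le> j \<Longrightarrow> I j \<subseteq> I i"
  by (induction j rule: dec_induct) (use Suc_subset in auto)

lemma subset_R: "x \<in> I k \<Longrightarrow> x \<in> R"
  using antimono[of 0 k] I0 by auto

lemma uminus: "x \<in> I k \<Longrightarrow> -x \<in> I k"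
  using diff[OF zero, of x k] by simp

lemma add: "x \<in> I k \<Longrightarrow> y \<in> I k \<Longrightarrow> x + y \<in> I k"
  using diff[of x k "-y"] uminus by simp

lemma sum: "(\<And>i. i \<in> A \<Longrightarrow> f i \<in> I k) \<Longrightarrow> sum f A \<in> I k"
  by (induction A rule: infinite_finite_induct) (auto intro: zero add)

lemma mult_R: "x \<in> R \<Longrightarrow> y \<in> I k \<Longrightarrow> x * y \<in> I k"
  using mult[of x 0 y k] I0 by simp

lemma zero_R: "0 \<in> R" and diff_R: "x \<in> R \<Longrightarrow> y \<in> R \<Longrightarrow> x - y \<in> R"
  and add_R: "x \<in> R \<Longrightarrow> y \<in> R \<Longrightarrow> x + y \<in> R"
  and times_R: "x \<in> R \<Longrightarrow> y \<in> R \<Longrightarrow> x * y \<in> R"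
  using zero[of 0] diff[of _ 0] add[of _ 0] mult_R[of _ _ 0] by (simp_all add: I0)

lemma power_R: "x \<in> R \<Longrightarrow> x ^ n \<in> R"
  by (induction n) (auto intro: one times_R)

lemma of_nat_R: "of_nat n \<in> R"
  by (induction n) (auto intro: zero_R one add_R)

end

definition polys_over :: "complex set \<Rightarrow> complex poly set" where
  "polys_over A = {p. \<forall>i. coeff p i \<in> A}"

text \<open>
Division by a monic polynomial over \<open>R\<close> does not leave an ideal \<open>J\<close> of \<open>R\<close>. With \<open>J = R\<close> a field
this is ordinary division; with \<open>J = I k\<close> it makes the polynomials in an integral element a filtered
ring.
\<close>
lemma poly_division_monic:
  assumes J: "0 \<in> J" "\<And>x y. x \<in> J \<Longrightarrow> y \<in> J \<Longrightarrow> x - y \<in> J"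
    "\<And>x y. x \<in> J \<Longrightarrow> y \<in> R \<Longrightarrow> x * y \<in> J"
    and g: "g \<in> polys_over R" "lead_coeff g = 1" "degree g > 0" and f: "f \<in> polys_over J"
  shows "\<exists>s r. s \<in> polys_over J \<and> r \<in> polys_over J \<and> f = s * g + r \<and> degree r < degree g"
  using f
proof (induction "degree f" arbitrary: f rule: less_induct)
  case (less f)
  have add: "x + y \<in> J" if "x \<in> J" "y \<in> J" for x y
    using J(2)[OF that(1) J(2)[OF J(1) that(2)]] by simp
  show ?case
  proof (cases "degree f < degree g")
    case True
    thus ?thesis using less.prems J(1) by (intro exI[of _ 0] exI[of _ f]) (auto simp: polys_over_def)
  next
    case False
    define q where "q = monom (lead_coeff f) (degree f - degree g)"
    have q: "q \<in> polys_over J" using less.prems J(1) by (auto simp: q_def polys_over_def)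
    have coeff_qg: "coeff (q * g) n = (if n < degree f - degree g then 0 else lead_coeff f * coeff g (n - (degree f - degree g)))" for n
      by (simp add: q_def coeff_monom_mult)
    define f' where "f' = f - q * g"
    have f': "f' \<in> polys_over J"
      unfolding polys_over_def mem_Collect_eq
    proof
      fix n
      have "coeff (q * g) n \<in> J" unfolding coeff_qg
        using J less.prems g(1) by (auto simp: polys_over_def)
      thus "coeff f' n \<in> J" using less.prems J(2) by (auto simp: f'_def polys_over_def)
    qed
    have "coeff f' n = 0" if "n \<ge> degree f" for n
    proof (cases "n = degree f")
      case True
      thus ?thesis using False g(2) by (auto simp: f'_def coeff_qg)
    next
      case nf: False
      hence "degree g < n - (degree f - degree g)" "degree f < n" using that False by auto
      thus ?thesis by (simp add: f'_def coeff_qg coeff_eq_0)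
    qed
    hence "degree f' \<le> degree f - 1" using False g(3) by (intro degree_le) auto
    hence "degree f' < degree f" using False g(3) by linarith
    from less.hyps[OF this f'] obtain s r where
      sr: "s \<in> polys_over J" "r \<in> polys_over J" "f' = s * g + r" "degree r < degree g" by blast
    have "f = (s + q) * g + r" using sr(3) by (simp add: f'_def algebra_simps)
    moreover have "s + q \<in> polys_over J" using sr(1) q add by (auto simp: polys_over_def)
    ultimately show ?thesis using sr by blast
  qed
qed

text \<open>
The induction hypothesis for towers of fields. The condition \<open>R \<subseteq> K\<close> is what lets linear (or
algebraic) independence over \<open>K\<close> be used for elements of \<open>R\<close>.
\<close>
definition has_filtrations :: "complex set \<Rightarrow> bool" where
  "has_filtrations K \<longleftrightarrow> (\<forall>S. finite S \<and> S \<subseteq> K \<longrightarrow> (\<exists>R I. filtered_ring R I \<and> S \<subseteq> R \<and> R \<subseteq> K))"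

context
  fixes K assumes K: "complex_subfield K"
begin

lemma subfield_closed:
  "1 \<in> K" "0 \<in> K" "x \<in> K \<Longrightarrow> y \<in> K \<Longrightarrow> x - y \<in> K" "x \<in> K \<Longrightarrow> y \<in> K \<Longrightarrow> x * y \<in> K"
  "x \<in> K \<Longrightarrow> inverse x \<in> K" "x \<in> K \<Longrightarrow> -x \<in> K" "x \<in> K \<Longrightarrow> y \<in> K \<Longrightarrow> x + y \<in> K"
proof -
  show 1: "1 \<in> K" and diff: "x \<in> K \<Longrightarrow> y \<in> K \<Longrightarrow> x - y \<in> K" and "x \<in> K \<Longrightarrow> y \<in> K \<Longrightarrow> x * y \<in> K"
    "x \<in> K \<Longrightarrow> inverse x \<in> K" for x y
    using K by (auto simp: complex_subfield_def)
  show 0: "0 \<in> K" using diff[OF 1 1] by simp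
  show minus: "x \<in> K \<Longrightarrow> -x \<in> K" for x using diff[OF 0, of x] by simp
  show "x \<in> K \<Longrightarrow> y \<in> K \<Longrightarrow> x + y \<in> K" using diff[of x "-y"] minus[of y] by simp
qed

lemma subfield_sum: "(\<And>i. i \<in> A \<Longrightarrow> f i \<in> K) \<Longrightarrow> sum f A \<in> K"
  by (induction A rule: infinite_finite_induct) (auto intro: subfield_closed)

lemma subfield_power: "x \<in> K \<Longrightarrow> x ^ n \<in> K"
  by (induction n) (auto intro: subfield_closed)

lemma subfield_of_nat: "of_nat n \<in> K"
  by (induction n) (auto intro: subfield_closed)

lemma polys_over_closed:
  "p \<in> polys_over K \<Longrightarrow> q \<in> polys_over K \<Longrightarrow> p + q \<in> polys_over K"
  "p \<in> polys_over K \<Longrightarrow> q \<in> polys_over K \<Longrightarrow> p - q \<in> polys_over K"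
  "p \<in> polys_over K \<Longrightarrow> q \<in> polys_over K \<Longrightarrow> p * q \<in> polys_over K"
  "a \<in> K \<Longrightarrow> p \<in> polys_over K \<Longrightarrow> smult a p \<in> polys_over K"
  "p \<in> polys_over K \<Longrightarrow> -p \<in> polys_over K"
  "a \<in> K \<Longrightarrow> p \<in> polys_over K \<Longrightarrow> pCons a p \<in> polys_over K"
  "0 \<in> polys_over K" "1 \<in> polys_over K"
  by (auto simp: polys_over_def coeff_mult coeff_pCons intro!: subfield_closed subfield_sum split: nat.splits)

lemma polys_over_pcompose:
  "p \<in> polys_over K \<Longrightarrow> q \<in> polys_over K \<Longrightarrow> pcompose p q \<in> polys_over K"
proof (induction p)
  case (pCons a p)
  have "coeff (pCons a p) 0 \<in> K" "coeff (pCons a p) (Suc i) \<in> K" for i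
    using pCons.prems(1) unfolding polys_over_def by blast+
  hence "a \<in> K" "p \<in> polys_over K" by (auto simp: polys_over_def)
  thus ?case using pCons by (auto simp: pcompose_pCons intro!: polys_over_closed)
qed (auto intro: polys_over_closed)

definition field_adjoin :: "complex \<Rightarrow> complex set" where
  "field_adjoin x = {poly f x / poly g x | f g. f \<in> polys_over K \<and> g \<in> polys_over K \<and> poly g x \<noteq> 0}"

lemma field_adjoinI: "f \<in> polys_over K \<Longrightarrow> g \<in> polys_over K \<Longrightarrow> poly g x \<noteq> 0 \<Longrightarrow> poly f x / poly g x \<in> field_adjoin x"
  by (auto simp: field_adjoin_def)

lemma poly_in_field_adjoin: "f \<in> polys_over K \<Longrightarrow> poly f x \<in> field_adjoin x"
  using field_adjoinI[of f 1 x] polys_over_closed by simp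

lemma field_adjoin_contains: "x \<in> field_adjoin x" "K \<subseteq> field_adjoin x"
proof -
  have "poly [:0, 1:] x \<in> field_adjoin x"
    by (intro poly_in_field_adjoin polys_over_closed subfield_closed)
  thus "x \<in> field_adjoin x" by simp
  show "K \<subseteq> field_adjoin x"
  proof
    fix a assume "a \<in> K"
    hence "poly [:a:] x \<in> field_adjoin x" by (intro poly_in_field_adjoin polys_over_closed)
    thus "a \<in> field_adjoin x" by simp
  qed
qed

lemma complex_subfield_field_adjoin: "complex_subfield (field_adjoin x)"
  unfolding complex_subfield_def
proof (intro conjI ballI)
  show "1 \<in> field_adjoin x" using field_adjoin_contains subfield_closed by blast
next
  fix a b assume "a \<in> field_adjoin x" "b \<in> field_adjoin x"
  then obtain f g h k where *: "f \<in> polys_over K" "g \<in> polys_over K" "poly g x \<noteq> 0" "a = poly f x / poly g x"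
    "h \<in> polys_over K" "k \<in> polys_over K" "poly k x \<noteq> 0" "b = poly h x / poly k x"
    unfolding field_adjoin_def by blast
  have "a - b = poly (f * k - h * g) x / poly (g * k) x"
    unfolding *(4,8) using *(3,7) by (simp add: diff_frac_eq)
  also have "\<dots> \<in> field_adjoin x" using * by (intro field_adjoinI polys_over_closed) auto
  finally show "a - b \<in> field_adjoin x" .
  have "a * b = poly (f * h) x / poly (g * k) x" using * by simp
  also have "\<dots> \<in> field_adjoin x" using * by (intro field_adjoinI polys_over_closed) auto
  finally show "a * b \<in> field_adjoin x" .
  show "inverse a \<in> field_adjoin x"
  proof (cases "poly f x = 0")
    case True
    thus ?thesis using * field_adjoin_contains(2) subfield_closed(2) by auto
  next
    case False
    hence "inverse a = poly g x / poly f x" using * by simp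
    thus ?thesis using field_adjoinI[of g f x] * False by simp
  qed
qed

text \<open>
Divide the minimal polynomial by \<open>g\<close>: the remainder is nonzero at \<open>x\<close>, of smaller degree than \<open>g\<close>,
and a multiple of \<open>poly g x\<close>, so induction on the degree applies.
\<close>
lemma algebraic_inverse:
  assumes m: "m \<in> polys_over K" "lead_coeff m = 1" "degree m > 0" "poly m x = 0"
    and min: "\<And>p. p \<in> polys_over K \<Longrightarrow> p \<noteq> 0 \<Longrightarrow> poly p x = 0 \<Longrightarrow> degree m \<le> degree p"
    and g: "g \<in> polys_over K" "poly g x \<noteq> 0"
  shows "\<exists>h\<in>polys_over K. poly h x * poly g x = 1"
proof -
  have small: "\<exists>h\<in>polys_over K. poly h x * poly g x = 1"
    if "g \<in> polys_over K" "poly g x \<noteq> 0" "degree g < degree m" for g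
    using that
  proof (induction "degree g" arbitrary: g rule: less_induct)
    case (less g)
    define a where "a = lead_coeff g"
    have a: "a \<in> K" "a \<noteq> 0" using less.prems by (auto simp: a_def polys_over_def)
    show ?case
    proof (cases "degree g = 0")
      case True
      then obtain b where b: "g = [:b:]" by (auto elim: degree_eq_zeroE)
      have "[:inverse a:] \<in> polys_over K" using a by (intro polys_over_closed subfield_closed)
      thus ?thesis using a b by (intro bexI[of _ "[:inverse a:]"]) (auto simp: a_def)
    next
      case False
      define g' where "g' = smult (inverse a) g"
      have g': "g' \<in> polys_over K" "lead_coeff g' = 1" "degree g' = degree g" "degree g' > 0"
        using less.prems a False by (auto simp: g'_def a_def intro!: polys_over_closed subfield_closed)
      obtain s r where sr: "s \<in> polys_over K" "r \<in> polys_over K" "m = s * g' + r" "degree r < degree g'"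
        using poly_division_monic[of K K g' m] subfield_closed g' m by blast
      have eq: "poly r x = - (poly s x * (inverse a * poly g x))"
        using m(4) sr(3) by (simp add: g'_def eq_neg_iff_add_eq_0 algebra_simps)
      have "poly r x \<noteq> 0"
      proof
        assume 0: "poly r x = 0"
        have "r = 0"
          using min[OF sr(2) _ 0] sr(4) g'(3) less.prems(3) by linarith
        hence ms: "m = s * g'" using sr(3) by simp
        hence "poly s x = 0" using eq 0 a less.prems(2) by simp
        moreover have "s \<noteq> 0" "g' \<noteq> 0" using ms m(3) by auto
        ultimately have "degree m \<le> degree s" using min sr(1) by blast
        moreover have "degree m = degree s + degree g'" using ms \<open>s \<noteq> 0\<close> \<open>g' \<noteq> 0\<close> by (simp add: degree_mult_eq)
        ultimately show False using g'(4) by simp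
      qed
      then obtain h where h: "h \<in> polys_over K" "poly h x * poly r x = 1"
        using less.hyps[of r] sr g' less.prems(3) by auto
      have "poly (smult (- inverse a) (h * s)) x * poly g x = poly h x * poly r x"
        by (simp add: eq)
      thus ?thesis using h sr(1) a
        by (intro bexI[of _ "smult (- inverse a) (h * s)"] polys_over_closed subfield_closed) auto
    qed
  qed
  obtain s r where sr: "s \<in> polys_over K" "r \<in> polys_over K" "g = s * m + r" "degree r < degree m"
    using poly_division_monic[of K K m g] subfield_closed g m by blast
  hence "poly r x = poly g x" using m(4) by simp
  thus ?thesis using small[OF sr(2) _ sr(4)] g(2) by simp
qed

end

lemma finite_range_coeff: "finite (range (coeff p))"
proof (rule finite_subset)
  show "range (coeff p) \<subseteq> insert 0 (coeff p ` {..degree p})"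
  proof safe
    fix i assume "coeff p i \<notin> coeff p ` {..degree p}"
    hence "i > degree p" by (auto simp: not_le[symmetric])
    thus "coeff p i = 0" by (rule coeff_eq_0)
  qed
qed simp

lemma (in filtered_ring) coeff_mult_mem:
  assumes "\<And>l. coeff f l \<in> I (i l)" "\<And>l. coeff g l \<in> I (j l)" "\<And>l. l \<le> n \<Longrightarrow> k \<le> i l + j (n - l)"
  shows "coeff (f * g) n \<in> I k"
  unfolding coeff_mult
proof (rule sum)
  fix l assume "l \<in> {..n}"
  hence "I (i l + j (n - l)) \<subseteq> I k" using assms(3) by (intro antimono) auto
  thus "coeff f l * coeff g (n - l) \<in> I k" using mult[OF assms(1,2)] by blast
qed

text \<open>
Let \<open>R0\<close> be a filtered ring that contains the coefficients of the minimal polynomial \<open>m\<close> of \<open>x\<close> and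
of polynomial expressions for the elements of \<open>S\<close>. Then \<open>R0[x]\<close> is a free module over \<open>R0\<close> with
basis \<open>1, x, \<dots>, x^(degree m - 1)\<close>, and the filtration is taken coefficientwise.
\<close>
lemma has_filtrations_algebraic:
  assumes K: "complex_subfield K" "has_filtrations K"
    and p: "p \<in> polys_over K" "p \<noteq> 0" "poly p x = 0"
  shows "has_filtrations (field_adjoin K x)"
  unfolding has_filtrations_def
proof safe
  fix S assume S: "finite S" "S \<subseteq> field_adjoin K x"
  note closed = subfield_closed[OF K(1)] polys_over_closed[OF K(1)]
  obtain m0 where m0: "m0 \<in> polys_over K" "m0 \<noteq> 0" "poly m0 x = 0"
    and min0: "\<And>p. p \<in> polys_over K \<Longrightarrow> p \<noteq> 0 \<Longrightarrow> poly p x = 0 \<Longrightarrow> degree m0 \<le> degree p"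
    using ex_has_least_nat[of "\<lambda>p. p \<in> polys_over K \<and> p \<noteq> 0 \<and> poly p x = 0" p degree] p by blast
  define m where "m = smult (inverse (lead_coeff m0)) m0"
  have "lead_coeff m0 \<in> K" "lead_coeff m0 \<noteq> 0" using m0 by (auto simp: polys_over_def)
  hence m: "m \<in> polys_over K" "lead_coeff m = 1" "poly m x = 0" "degree m = degree m0"
    using m0 by (auto simp: m_def intro!: closed)
  have "degree m \<noteq> 0"
  proof
    assume "degree m = 0"
    then obtain b where "m = [:b:]" by (auto elim: degree_eq_zeroE)
    thus False using m by simp
  qed
  hence dm: "degree m > 0" by simp
  have min: "degree m \<le> degree p" if "p \<in> polys_over K" "p \<noteq> 0" "poly p x = 0" for p
    using min0[OF that] m(4) by simp
  have "\<exists>f\<in>polys_over K. y = poly f x" if y: "y \<in> S" for y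
  proof -
    obtain f g where fg: "f \<in> polys_over K" "g \<in> polys_over K" "poly g x \<noteq> 0" "y = poly f x / poly g x"
      using y S(2) unfolding field_adjoin_def[OF K(1)] by blast
    obtain h where h: "h \<in> polys_over K" "poly h x * poly g x = 1"
      using algebraic_inverse[OF K(1) m(1,2) dm m(3) min fg(2,3)] by blast
    have "y = poly f x * (poly h x * poly g x) / poly g x" using h fg by simp
    also have "\<dots> = poly (f * h) x" using fg(3) by simp
    finally show ?thesis using fg(1) h(1) by (intro bexI[of _ "f * h"] closed)
  qed
  then obtain F where F: "\<And>y. y \<in> S \<Longrightarrow> F y \<in> polys_over K" "\<And>y. y \<in> S \<Longrightarrow> y = poly (F y) x" by metis
  define C where "C = range (coeff m) \<union> (\<Union>y\<in>S. range (coeff (F y)))"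
  have "finite C" "C \<subseteq> K"
  proof -
    show "finite C" unfolding C_def using S(1) finite_range_coeff by blast
    show "C \<subseteq> K" unfolding C_def using m(1) F(1) unfolding polys_over_def by blast
  qed
  then obtain R0 I0 where RI: "filtered_ring R0 I0" "C \<subseteq> R0" "R0 \<subseteq> K"
    using K(2) unfolding has_filtrations_def by blast
  interpret F0: filtered_ring R0 I0 by (rule RI)
  define I where "I k = (\<lambda>f. poly f x) ` polys_over (I0 k)" for k
  have m': "m \<in> polys_over R0" using RI(2) by (auto simp: C_def polys_over_def)
  have reduce: "\<exists>r\<in>polys_over (I0 k). degree r < degree m \<and> y = poly r x" if y: "y \<in> I k" for y k
  proof -
    obtain f where f: "f \<in> polys_over (I0 k)" "y = poly f x" using y by (auto simp: I_def)
    obtain s r where "r \<in> polys_over (I0 k)" "f = s * m + r" "degree r < degree m"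
      using poly_division_monic[of "I0 k" R0 m f] F0.zero F0.diff F0.mult_R m' m(2) dm f(1)
      by (metis mult.commute)
    thus ?thesis using f m(3) by auto
  qed
  have "filtered_ring (I 0) I"
  proof
    have "1 \<in> polys_over (I0 0)" using F0.one F0.zero_R by (auto simp: polys_over_def F0.I0 coeff_1)
    thus "1 \<in> I 0" unfolding I_def by (intro image_eqI[of _ _ 1]) auto
    show "I 0 = I 0" ..
    show "0 \<in> I k" for k
      unfolding I_def using F0.zero by (intro image_eqI[of _ _ 0]) (auto simp: polys_over_def)
    show "I (Suc k) \<subseteq> I k" for k unfolding I_def using F0.Suc_subset by (intro image_mono) (auto simp: polys_over_def)
    show "a - b \<in> I k" if ab: "a \<in> I k" "b \<in> I k" for a b k
    proof -
      obtain f g where "f \<in> polys_over (I0 k)" "g \<in> polys_over (I0 k)" "a = poly f x" "b = poly g x"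
        using ab by (auto simp: I_def)
      thus ?thesis unfolding I_def by (intro image_eqI[of _ _ "f - g"]) (auto simp: polys_over_def intro: F0.diff)
    qed
    show "a * b \<in> I (i + j)" if ab: "a \<in> I i" "b \<in> I j" for a b i j
    proof -
      obtain f g where "f \<in> polys_over (I0 i)" "g \<in> polys_over (I0 j)" "a = poly f x" "b = poly g x"
        using ab by (auto simp: I_def)
      thus ?thesis unfolding I_def
        by (intro image_eqI[of _ _ "f * g"])
           (auto simp: polys_over_def intro: F0.coeff_mult_mem[of f "\<lambda>_. i" g "\<lambda>_. j"])
    qed
    show "a = 0" if a: "\<And>k. a \<in> I k" for a
    proof -
      obtain r where r: "\<And>k. r k \<in> polys_over (I0 k)" "\<And>k. degree (r k) < degree m" "\<And>k. a = poly (r k) x"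
        using reduce[OF a] by metis
      have rK: "r k \<in> polys_over K" for k
        using r(1)[of k] RI(3) F0.subset_R unfolding polys_over_def by blast
      \<comment> \<open>Representatives of degree less than \<open>degree m\<close> are unique over \<open>K\<close>, so one polynomial serves all \<open>k\<close>.\<close>
      have same: "r k = r 0" for k
      proof (rule ccontr)
        assume "r k \<noteq> r 0"
        moreover have "r k - r 0 \<in> polys_over K"
          using rK by (intro closed)
        moreover have "poly (r k - r 0) x = 0" using r(3)[of k] r(3)[of 0] by simp
        ultimately have "degree m \<le> degree (r k - r 0)" using min by auto
        moreover have "degree (r k - r 0) < degree m" using r(2) by (intro degree_diff_less)
        ultimately show False by simp
      qed
      have "coeff (r 0) i = 0" for i
      proof (rule F0.separated)
        fix k show "coeff (r 0) i \<in> I0 k" using r(1)[of k] same[of k] by (auto simp: polys_over_def)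
      qed
      hence "r 0 = 0" by (simp add: poly_eq_iff)
      thus ?thesis using r(3)[of 0] by simp
    qed
    show "\<exists>T. finite T \<and> T \<subseteq> I 0 \<and> (\<forall>a\<in>I 0. \<exists>t\<in>T. a - t \<in> I 1)"
    proof -
      obtain T0 where T0: "finite T0" "T0 \<subseteq> R0" "\<forall>a\<in>R0. \<exists>t\<in>T0. a - t \<in> I0 1"
        using F0.finite_residues by blast
      define P where "P t = (\<Sum>i<degree m. monom (t i) i)" for t :: "nat \<Rightarrow> complex"
      have cP: "coeff (P t) i = (if i < degree m then t i else 0)" for t i
        by (simp add: P_def coeff_sum)
      define T where "T = (\<lambda>t. poly (P t) x) ` ({..<degree m} \<rightarrow>\<^sub>E T0)"
      have "finite T" unfolding T_def using T0 by (intro finite_imageI finite_PiE) auto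
      moreover have "T \<subseteq> I 0" unfolding T_def I_def
      proof (rule image_subsetI)
        fix t assume "t \<in> {..<degree m} \<rightarrow>\<^sub>E T0"
        hence "P t \<in> polys_over (I0 0)" using T0(2) F0.zero_R by (auto simp: polys_over_def cP F0.I0)
        thus "poly (P t) x \<in> (\<lambda>f. poly f x) ` polys_over (I0 0)" by (rule imageI)
      qed
      moreover have "\<exists>t\<in>T. a - t \<in> I 1" if a: "a \<in> I 0" for a
      proof -
        obtain r where r: "r \<in> polys_over R0" "degree r < degree m" "a = poly r x"
          using reduce[OF a] F0.I0 by auto
        have "\<forall>i. \<exists>t\<in>T0. coeff r i - t \<in> I0 1" using T0(3) r(1) by (auto simp: polys_over_def)
        then obtain t where t: "\<And>i. t i \<in> T0" "\<And>i. coeff r i - t i \<in> I0 1" by metis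
        define t' where "t' = restrict t {..<degree m}"
        have "r - P t' \<in> polys_over (I0 1)"
          using t(2) r(2) F0.zero by (auto simp: polys_over_def cP t'_def coeff_eq_0)
        hence "poly (r - P t') x \<in> I 1" unfolding I_def by (rule imageI)
        moreover have "poly (P t') x \<in> T" unfolding T_def t'_def
          by (intro imageI restrict_PiE_iff[THEN iffD2] ballI t(1))
        ultimately show ?thesis using r(3) by auto
      qed
      ultimately show ?thesis by blast
    qed
  qed
  moreover have "S \<subseteq> I 0"
  proof
    fix y assume y: "y \<in> S"
    have "range (coeff (F y)) \<subseteq> R0" using y RI(2) unfolding C_def by blast
    hence "F y \<in> polys_over (I0 0)" by (auto simp: polys_over_def F0.I0)
    thus "y \<in> I 0" unfolding I_def using F(2)[OF y] by (intro image_eqI[of _ _ "F y"])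
  qed
  moreover have "I 0 \<subseteq> field_adjoin K x"
  proof -
    have "polys_over R0 \<subseteq> polys_over K" using RI(3) unfolding polys_over_def by blast
    thus ?thesis using poly_in_field_adjoin[OF K(1)] by (auto simp: I_def F0.I0)
  qed
  ultimately show "\<exists>R I. filtered_ring R I \<and> S \<subseteq> R \<and> R \<subseteq> field_adjoin K x" by blast
qed

section \<open>Existence of filtered rings\<close>

text \<open>
A separated filtration by ideals \<open>J k\<close> extends to the fractions with denominators in \<open>U\<close> as soon as
the elements of \<open>U\<close> are invertible for the filtration, which is the condition \<open>cancel\<close>. The two
instances have \<open>J 0\<close> the integers and \<open>J 0\<close> a polynomial ring.
\<close>
lemma filtered_ring_fractions:
  fixes J :: "nat \<Rightarrow> complex set" and U :: "complex set"
  assumes zero: "\<And>k. 0 \<in> J k" and Suc_subset: "\<And>k. J (Suc k) \<subseteq> J k"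
    and diff: "\<And>k x y. x \<in> J k \<Longrightarrow> y \<in> J k \<Longrightarrow> x - y \<in> J k"
    and mult: "\<And>i j x y. x \<in> J i \<Longrightarrow> y \<in> J j \<Longrightarrow> x * y \<in> J (i + j)"
    and separated: "\<And>x. (\<And>k. x \<in> J k) \<Longrightarrow> x = 0"
    and U: "1 \<in> U" "0 \<notin> U" "U \<subseteq> J 0" "\<And>x y. x \<in> U \<Longrightarrow> y \<in> U \<Longrightarrow> x * y \<in> U"
    and cancel: "\<And>k x y. x \<in> J 0 \<Longrightarrow> y \<in> U \<Longrightarrow> x * y \<in> J k \<Longrightarrow> x \<in> J k"
    and residues: "\<exists>T. finite T \<and> T \<subseteq> J 0 \<and> (\<forall>x\<in>J 0. \<forall>y\<in>U. \<exists>t\<in>T. x - t * y \<in> J 1)"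
  shows "filtered_ring {x / y | x y. x \<in> J 0 \<and> y \<in> U} (\<lambda>k. {x / y | x y. x \<in> J k \<and> y \<in> U})"
    (is "filtered_ring _ ?I")
proof
  have frac: "x / y \<in> ?I k" if "x \<in> J k" "y \<in> U" for x y k using that by blast
  have nz: "y \<noteq> 0" if "y \<in> U" for y using that U(2) by auto
  have mult0: "x * y \<in> J k" if "x \<in> J k" "y \<in> U" for x y k using mult[of x k y 0] that U(3) by auto
  show "1 \<in> {x / y | x y. x \<in> J 0 \<and> y \<in> U}" using frac[of 1 0 1] U by auto
  show "0 \<in> ?I k" for k using frac[OF zero U(1)] by simp
  show "?I (Suc k) \<subseteq> ?I k" for k using Suc_subset by blast
  show "a - b \<in> ?I k" if ab: "a \<in> ?I k" "b \<in> ?I k" for a b k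
  proof -
    obtain x y v w where *: "x \<in> J k" "y \<in> U" "a = x / y" "v \<in> J k" "w \<in> U" "b = v / w" using ab by blast
    have "a - b = (x * w - v * y) / (y * w)" unfolding *(3,6) by (rule diff_frac_eq[OF nz nz]) fact+
    also have "\<dots> \<in> ?I k" using * by (intro frac diff mult0 U(4))
    finally show ?thesis .
  qed
  show "a * b \<in> ?I (i + j)" if ab: "a \<in> ?I i" "b \<in> ?I j" for a b i j
  proof -
    obtain x y v w where *: "x \<in> J i" "y \<in> U" "a = x / y" "v \<in> J j" "w \<in> U" "b = v / w" using ab by blast
    have "(x * v) / (y * w) \<in> ?I (i + j)" using * by (intro frac mult U(4))
    thus ?thesis by (simp add: *(3,6))
  qed
  show "a = 0" if a: "\<And>k. a \<in> ?I k" for a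
  proof -
    obtain x y where xy: "x \<in> J 0" "y \<in> U" "a = x / y" using a[of 0] by blast
    have "x \<in> J k" for k
    proof -
      obtain v w where vw: "v \<in> J k" "w \<in> U" "a = v / w" using a[of k] by blast
      have "x * w = v * y" using xy(3) vw(3) nz[OF xy(2)] nz[OF vw(2)] by (simp add: frac_eq_eq)
      thus ?thesis using cancel[OF xy(1) vw(2)] mult0[OF vw(1) xy(2)] by simp
    qed
    thus ?thesis using separated xy(3) by simp
  qed
  obtain T where T: "finite T" "T \<subseteq> J 0" "\<forall>x\<in>J 0. \<forall>y\<in>U. \<exists>t\<in>T. x - t * y \<in> J 1" using residues by blast
  have "\<exists>t\<in>T. a - t \<in> ?I 1" if a: "a \<in> ?I 0" for a
  proof -
    obtain x y where xy: "x \<in> J 0" "y \<in> U" "a = x / y" using a by blast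
    obtain t where t: "t \<in> T" "x - t * y \<in> J 1" using T(3) xy by blast
    have eq: "a - t = (x - t * y) / y" using nz[OF xy(2)] xy(3) by (simp add: diff_divide_distrib)
    have "a - t \<in> ?I 1" unfolding eq by (rule frac[OF t(2) xy(2)])
    thus ?thesis using t(1) by blast
  qed
  moreover have "T \<subseteq> ?I 0" using frac[OF _ U(1)] T(2) by force
  ultimately show "\<exists>T. finite T \<and> T \<subseteq> {x / y | x y. x \<in> J 0 \<and> y \<in> U} \<and> (\<forall>a\<in>{x / y | x y. x \<in> J 0 \<and> y \<in> U}. \<exists>t\<in>T. a - t \<in> ?I 1)"
    using T(1) by (intro exI[of _ T] conjI ballI)
qed simp

text \<open>
The ring is the polynomial ring over \<open>R0\<close>, localized at the polynomials with constant coefficient 1.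
It embeds into the power series ring over \<open>R0\<close> in \<open>z\<close>, where \<open>z\<close> is given weight 1: the ideal with
index \<open>k\<close> consists of the series whose coefficient of \<open>z^j\<close> lies in \<open>I0 (k - j)\<close>. This condition can
be put on the numerator, because the denominators are units. The truncated difference \<open>k - j\<close> is
intended: from \<open>j = k\<close> on there is no condition beyond membership in \<open>R0 = I0 0\<close>.
\<close>
lemma filtered_ring_taylor:
  assumes R0: "filtered_ring R0 I0" and trans: "\<And>p. p \<in> polys_over R0 \<Longrightarrow> poly p z = 0 \<Longrightarrow> p = 0"
  shows "\<exists>I. filtered_ring {poly f z / poly g z | f g. f \<in> polys_over R0 \<and> g \<in> polys_over R0 \<and> coeff g 0 = 1} I"
proof -
  interpret F0: filtered_ring R0 I0 by (rule R0)
  define P where "P k = {f. \<forall>j. coeff f j \<in> I0 (k - j)}" for k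
  define V where "V = {g \<in> P 0. coeff g 0 = 1}"
  let ?e = "\<lambda>f. poly f z"
  have P0: "P 0 = polys_over R0" by (simp add: P_def polys_over_def F0.I0)
  have sub: "P k \<subseteq> polys_over R0" for k using F0.subset_R by (auto simp: P_def polys_over_def)
  have P_diff: "f - g \<in> P k" if "f \<in> P k" "g \<in> P k" for f g k using that by (auto simp: P_def intro: F0.diff)
  have P_mult: "f * g \<in> P (i + j)" if fg: "f \<in> P i" "g \<in> P j" for f g i j
    unfolding P_def
  proof safe
    fix n show "coeff (f * g) n \<in> I0 (i + j - n)"
      using fg by (intro F0.coeff_mult_mem[where i = "\<lambda>l. i - l" and j = "\<lambda>l. j - l"]) (auto simp: P_def)
  qed
  have eq: "f = g" if "f \<in> polys_over R0" "g \<in> polys_over R0" "?e f = ?e g" for f g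
    using trans[of "f - g"] P_diff[of f 0 g] that P0 by simp
  have const: "[:a:] \<in> P 0" if "a \<in> R0" for a
    using that by (auto simp: P_def F0.I0 coeff_pCons F0.zero_R split: nat.splits)
  have mem: "f \<in> P k" if "?e f \<in> ?e ` P k" "f \<in> polys_over R0" for f k using that eq sub by blast
  have fr: "filtered_ring {x / y | x y. x \<in> ?e ` P 0 \<and> y \<in> ?e ` V} (\<lambda>k. {x / y | x y. x \<in> ?e ` P k \<and> y \<in> ?e ` V})"
  proof (rule filtered_ring_fractions)
    show "0 \<in> ?e ` P k" for k by (rule image_eqI[of _ _ 0]) (auto simp: P_def F0.zero)
    have "P (Suc k) \<subseteq> P k" for k
      unfolding P_def using F0.antimono[OF diff_le_mono[OF le_SucI[OF order_refl]]] by blast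
    thus "?e ` P (Suc k) \<subseteq> ?e ` P k" for k by blast
    show "x - y \<in> ?e ` P k" if "x \<in> ?e ` P k" "y \<in> ?e ` P k" for x y k
      using that P_diff by (auto simp flip: poly_diff)
    show "x * y \<in> ?e ` P (i + j)" if "x \<in> ?e ` P i" "y \<in> ?e ` P j" for x y i j
      using that P_mult by (auto simp flip: poly_mult)
    show "x = 0" if x: "\<And>k. x \<in> ?e ` P k" for x
    proof -
      obtain f where f: "f \<in> polys_over R0" "x = ?e f" using x[of 0] P0 by auto
      have "f \<in> P k" for k using mem[OF _ f(1)] x f(2) by blast
      hence "coeff f j \<in> I0 (k + j - j)" for k j unfolding P_def by blast
      hence "coeff f j = 0" for j by (intro F0.separated) simp
      hence "f = 0" by (simp add: poly_eq_iff)
      thus ?thesis using f(2) by simp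
    qed
    show "1 \<in> ?e ` V" using const[OF F0.one] by (intro image_eqI[of _ _ 1]) (auto simp: V_def one_pCons)
    show "0 \<notin> ?e ` V"
    proof
      assume "0 \<in> ?e ` V"
      then obtain g where g: "g \<in> V" "?e g = 0" by auto
      hence "g = 0" using trans[of g] P0 by (auto simp: V_def)
      thus False using g(1) by (simp add: V_def)
    qed
    show "?e ` V \<subseteq> ?e ` P 0" by (auto simp: V_def)
    have "f * g \<in> V" if "f \<in> V" "g \<in> V" for f g
      using that P_mult[of f 0 g 0] by (auto simp: V_def coeff_mult)
    thus "x * y \<in> ?e ` V" if "x \<in> ?e ` V" "y \<in> ?e ` V" for x y
      using that by (auto simp flip: poly_mult)
    show "x \<in> ?e ` P k" if xy: "x \<in> ?e ` P 0" "y \<in> ?e ` V" "x * y \<in> ?e ` P k" for x y k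
    proof -
      obtain f g where fg: "f \<in> P 0" "g \<in> V" "x = ?e f" "y = ?e g" using xy(1,2) by blast
      have "f * g \<in> P 0" using P_mult[of f 0 g 0] fg(1,2) by (simp add: V_def)
      hence fgk: "f * g \<in> P k" using mem[of "f * g" k] xy(3) fg(3,4) P0 by simp
      \<comment> \<open>Division of power series by \<open>g\<close>, whose constant coefficient is 1: the coefficients are found recursively.\<close>
      have "coeff f n \<in> I0 (k - n)" for n
      proof (induction n rule: less_induct)
        case (less n)
        have "coeff (f * g) n = (\<Sum>i<n. coeff f i * coeff g (n - i)) + coeff f n"
          using fg(2) by (simp add: coeff_mult V_def lessThan_Suc_atMost[symmetric])
        hence "coeff f n = coeff (f * g) n - (\<Sum>i<n. coeff f i * coeff g (n - i))" by simp
        moreover have "coeff f i * coeff g (n - i) \<in> I0 (k - n)" if i: "i < n" for i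
        proof -
          have "coeff f i \<in> I0 (k - n)" using less[OF i] F0.antimono[OF diff_le_mono2[OF less_imp_le[OF i], of k]] by blast
          moreover have "coeff g (n - i) \<in> R0" using fg(2) by (simp add: V_def P_def F0.I0)
          ultimately show ?thesis using F0.mult_R by (metis mult.commute)
        qed
        moreover have "coeff (f * g) n \<in> I0 (k - n)" using fgk by (simp add: P_def)
        ultimately show ?case by (auto intro!: F0.diff F0.sum)
      qed
      thus ?thesis using fg(3) by (auto simp: P_def)
    qed
    obtain T where T: "finite T" "T \<subseteq> R0" "\<forall>a\<in>R0. \<exists>t\<in>T. a - t \<in> I0 1" using F0.finite_residues by blast
    have "\<exists>t\<in>T. x - t * y \<in> ?e ` P 1" if xy: "x \<in> ?e ` P 0" "y \<in> ?e ` V" for x y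
    proof -
      obtain f g where fg: "f \<in> P 0" "g \<in> V" "x = ?e f" "y = ?e g" using xy by blast
      have "coeff f 0 \<in> R0" using fg(1) by (simp add: P_def F0.I0)
      then obtain t where t: "t \<in> T" "coeff f 0 - t \<in> I0 1" using T(3) by blast
      have "[:t:] * g \<in> P (0 + 0)" using const[of t] t(1) T(2) fg(2) by (intro P_mult) (auto simp: V_def)
      hence f0: "f - smult t g \<in> P 0" using P_diff[OF fg(1)] by simp
      have "coeff (f - smult t g) j \<in> I0 (1 - j)" for j
        using t(2) f0 fg(2) by (cases j) (auto simp: P_def V_def)
      hence "f - smult t g \<in> P 1" by (simp add: P_def)
      moreover have "x - t * y = ?e (f - smult t g)" using fg(3,4) by simp
      ultimately show ?thesis using t(1) by blast
    qed
    moreover have "T \<subseteq> ?e ` P 0"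
    proof
      fix t assume "t \<in> T"
      thus "t \<in> ?e ` P 0" using const T(2) by (intro image_eqI[of _ _ "[:t:]"]) auto
    qed
    ultimately show "\<exists>T. finite T \<and> T \<subseteq> ?e ` P 0 \<and> (\<forall>x\<in>?e ` P 0. \<forall>y\<in>?e ` V. \<exists>t\<in>T. x - t * y \<in> ?e ` P 1)"
      using T(1) by (intro exI[of _ T] conjI ballI)
  qed
  have "{x / y | x y. x \<in> ?e ` P 0 \<and> y \<in> ?e ` V} =
      {poly f z / poly g z | f g. f \<in> polys_over R0 \<and> g \<in> polys_over R0 \<and> coeff g 0 = 1}"
    unfolding V_def P0 by auto
  thus ?thesis using fr by metis
qed

text \<open>
Replace \<open>x\<close> by \<open>z = x - c\<close>, where the integer \<open>c\<close> is a zero of none of the denominators of the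
elements of \<open>S\<close>. Then these denominators can be scaled to have constant coefficient 1 in \<open>z\<close>.
\<close>
lemma has_filtrations_transcendental:
  assumes K: "complex_subfield K" "has_filtrations K"
    and trans: "\<And>p. p \<in> polys_over K \<Longrightarrow> poly p x = 0 \<Longrightarrow> p = 0"
  shows "has_filtrations (field_adjoin K x)"
  unfolding has_filtrations_def
proof safe
  fix S assume S: "finite S" "S \<subseteq> field_adjoin K x"
  note closed = subfield_closed[OF K(1)] polys_over_closed[OF K(1)]
  have "\<exists>f g. f \<in> polys_over K \<and> g \<in> polys_over K \<and> poly g x \<noteq> 0 \<and> y = poly f x / poly g x" if y: "y \<in> S" for y
    using y S(2) unfolding field_adjoin_def[OF K(1)] by blast
  then obtain F G where FG: "\<And>y. y \<in> S \<Longrightarrow> F y \<in> polys_over K" "\<And>y. y \<in> S \<Longrightarrow> G y \<in> polys_over K"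
    "\<And>y. y \<in> S \<Longrightarrow> poly (G y) x \<noteq> 0" "\<And>y. y \<in> S \<Longrightarrow> y = poly (F y) x / poly (G y) x" by metis
  obtain c where c: "c \<in> K" "\<And>y. y \<in> S \<Longrightarrow> poly (G y) c \<noteq> 0"
  proof -
    have "G y \<noteq> 0" if "y \<in> S" for y using FG(3)[OF that] by auto
    hence "finite (\<Union>y\<in>S. {z. poly (G y) z = 0})" using S(1) by (intro finite_UN_I poly_roots_finite)
    moreover have "infinite (range (of_nat :: nat \<Rightarrow> complex))" using infinite_UNIV_char_0
      by (metis finite_imageD inj_of_nat infinite_UNIV_nat)
    ultimately obtain n where "(of_nat n :: complex) \<notin> (\<Union>y\<in>S. {z. poly (G y) z = 0})"
      by (meson finite_subset image_subsetI)
    thus ?thesis using that[of "of_nat n"] subfield_of_nat[OF K(1)] by blast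
  qed
  define z where "z = x - c"
  have lin: "[:c, 1:] \<in> polys_over K" "[:-c, 1:] \<in> polys_over K" using c(1) by (auto intro!: closed)
  have trans_z: "p = 0" if p: "p \<in> polys_over K" "poly p z = 0" for p
  proof -
    have "poly (pcompose p [:-c, 1:]) x = 0" using p(2) by (simp add: poly_pcompose z_def)
    hence "pcompose p [:-c, 1:] = 0" using trans polys_over_pcompose[OF K(1) p(1) lin(2)] by blast
    thus ?thesis by (simp add: pcompose_eq_0_iff)
  qed
  define F' where "F' y = smult (inverse (poly (G y) c)) (pcompose (F y) [:c, 1:])" for y
  define G' where "G' y = smult (inverse (poly (G y) c)) (pcompose (G y) [:c, 1:])" for y
  have G_c: "poly (G y) c \<in> K" if "y \<in> S" for y
    unfolding poly_altdef using FG(2)[OF that] c(1)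
    by (intro subfield_sum[OF K(1)] closed subfield_power[OF K(1)]) (auto simp: polys_over_def)
  have F'G': "F' y \<in> polys_over K" "G' y \<in> polys_over K" "coeff (G' y) 0 = 1" "y = poly (F' y) z / poly (G' y) z"
    if y: "y \<in> S" for y
  proof -
    show "F' y \<in> polys_over K" "G' y \<in> polys_over K"
      unfolding F'_def G'_def using FG y lin G_c by (auto intro!: closed polys_over_pcompose[OF K(1)])
    show "coeff (G' y) 0 = 1" using c(2)[OF y] by (simp add: G'_def poly_0_coeff_0[symmetric] poly_pcompose)
    show "y = poly (F' y) z / poly (G' y) z"
      using FG(4)[OF y] c(2)[OF y] by (simp add: F'_def G'_def poly_pcompose z_def)
  qed
  define C where "C = (\<Union>y\<in>S. range (coeff (F' y)) \<union> range (coeff (G' y)))"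
  have "finite C" unfolding C_def using S(1) finite_range_coeff by blast
  moreover have "C \<subseteq> K" unfolding C_def using F'G'(1,2) unfolding polys_over_def by blast
  ultimately obtain R0 I0 where RI: "filtered_ring R0 I0" "C \<subseteq> R0" "R0 \<subseteq> K"
    using K(2) unfolding has_filtrations_def by blast
  have sub: "polys_over R0 \<subseteq> polys_over K" using RI(3) unfolding polys_over_def by blast
  define L where "L = {poly f z / poly g z | f g. f \<in> polys_over R0 \<and> g \<in> polys_over R0 \<and> coeff g 0 = 1}"
  obtain I where "filtered_ring L I"
    unfolding L_def using filtered_ring_taylor[OF RI(1), of z] trans_z sub by blast
  moreover have "S \<subseteq> L"
  proof
    fix y assume y: "y \<in> S"
    have "range (coeff (F' y)) \<subseteq> R0" "range (coeff (G' y)) \<subseteq> R0" using y RI(2) unfolding C_def by blast+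
    hence "F' y \<in> polys_over R0" "G' y \<in> polys_over R0" by (auto simp: polys_over_def)
    thus "y \<in> L" unfolding L_def using F'G'(3,4)[OF y] by blast
  qed
  moreover have "L \<subseteq> field_adjoin K x"
  proof
    fix a assume "a \<in> L"
    then obtain f g where fg: "f \<in> polys_over K" "g \<in> polys_over K" "coeff g 0 = 1" "a = poly f z / poly g z"
      unfolding L_def using sub by blast
    have shift: "poly p z = poly (pcompose p [:-c, 1:]) x" for p by (simp add: poly_pcompose z_def)
    have "poly g z \<noteq> 0" using trans_z[OF fg(2)] fg(3) by auto
    thus "a \<in> field_adjoin K x" unfolding fg(4) shift
      using fg(1,2) lin by (intro field_adjoinI[OF K(1)] polys_over_pcompose[OF K(1)])
  qed
  ultimately show "\<exists>R I. filtered_ring R I \<and> S \<subseteq> R \<and> R \<subseteq> field_adjoin K x" by blast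
qed

lemma complex_subfield_Rats: "complex_subfield \<rat>"
  by (auto simp: complex_subfield_def)

text \<open>
The localization of the integers at a prime \<open>l\<close> that divides none of the denominators in \<open>S\<close>,
filtered by the powers of \<open>l\<close>.
\<close>
lemma has_filtrations_Rats: "has_filtrations \<rat>"
  unfolding has_filtrations_def
proof safe
  fix S :: "complex set" assume S: "finite S" "S \<subseteq> \<rat>"
  have "\<exists>d::nat. d > 0 \<and> (\<forall>x\<in>S. \<exists>a::int. x = of_int a / of_nat d)"
    using S
  proof (induction S rule: finite_induct)
    case (insert x S)
    then obtain d where d: "d > 0" "\<forall>x\<in>S. \<exists>a::int. x = of_int a / of_nat d" by auto
    obtain a b :: int where ab: "b > 0" "x = of_int a / of_int b"
      using insert.prems by (auto elim!: Rats_cases')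
    define e where "e = d * nat b"
    have e: "(of_nat e :: complex) = of_nat d * of_int b" using ab(1) by (simp add: e_def)
    have "\<exists>a::int. y = of_int a / of_nat e" if y: "y \<in> insert x S" for y
    proof (cases "y = x")
      case True
      thus ?thesis using ab(2) d(1) by (intro exI[of _ "a * int d"]) (simp add: e)
    next
      case False
      then obtain a' :: int where "y = of_int a' / of_nat d" using y d(2) by auto
      thus ?thesis using ab(1) by (intro exI[of _ "a' * b"]) (simp add: e)
    qed
    moreover have "e > 0" using d(1) ab(1) by (simp add: e_def)
    ultimately show ?case by blast
  qed (auto intro: exI[of _ 1])
  then obtain d :: nat where d: "d > 0" "\<And>x. x \<in> S \<Longrightarrow> \<exists>a::int. x = of_int a / of_nat d" by blast
  obtain l0 where l0: "prime l0" "l0 > d" using bigger_prime by blast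
  define l where "l = int l0"
  have l: "prime l" "l > 1" "\<not> l dvd int d"
    using l0 d(1) by (auto simp: l_def prime_gt_Suc_0_nat dest: dvd_imp_le)
  define J :: "nat \<Rightarrow> complex set" where "J k = {of_int a | a. l ^ k dvd a}" for k
  define U :: "complex set" where "U = {of_int b | b. \<not> l dvd b}"
  have J_iff: "of_int a \<in> J k \<longleftrightarrow> l ^ k dvd a" for a k
    by (simp add: J_def)
  have J_int: "\<exists>a. x = of_int a \<and> l ^ k dvd a" if "x \<in> J k" for x k
    using that unfolding J_def by blast
  have fr: "filtered_ring {x / y | x y. x \<in> J 0 \<and> y \<in> U} (\<lambda>k. {x / y | x y. x \<in> J k \<and> y \<in> U})"
  proof (rule filtered_ring_fractions)
    show "0 \<in> J k" for k using J_iff[of 0] by simp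
    show "J (Suc k) \<subseteq> J k" for k using J_int J_iff by (metis dvd_mult_right power_Suc subsetI)
    show "x - y \<in> J k" if xy: "x \<in> J k" "y \<in> J k" for x y k
    proof -
      obtain a b where ab: "x = of_int a" "l ^ k dvd a" "y = of_int b" "l ^ k dvd b"
        using xy unfolding J_def by blast
      hence "of_int (a - b) \<in> J k" by (simp only: J_iff dvd_diff)
      thus ?thesis by (simp add: ab(1,3))
    qed
    show "x * y \<in> J (i + j)" if xy: "x \<in> J i" "y \<in> J j" for x y i j
    proof -
      obtain a b where ab: "x = of_int a" "l ^ i dvd a" "y = of_int b" "l ^ j dvd b"
        using xy unfolding J_def by blast
      hence "of_int (a * b) \<in> J (i + j)" by (simp only: J_iff mult_dvd_mono power_add)
      thus ?thesis by (simp add: ab(1,3))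
    qed
    show "x = 0" if x: "\<And>k. x \<in> J k" for x
    proof -
      obtain a where a: "x = of_int a" using J_int[OF x] by blast
      have ldvd: "l ^ k dvd a" for k using x[of k] J_iff a by simp
      have "a = 0"
      proof (rule ccontr)
        assume a: "a \<noteq> 0"
        define k where "k = nat \<bar>a\<bar>"
        have "0 \<le> l ^ k" using l(2) by simp
        hence "l ^ k \<le> \<bar>a\<bar>" using dvd_imp_le_int[OF a ldvd[of k]] by linarith
        moreover have "k < l0 ^ k" using l0(1) by (intro power_gt_expt) (simp add: prime_gt_Suc_0_nat)
        hence "int k < l ^ k" by (simp add: l_def flip: of_nat_power)
        ultimately show False by (simp add: k_def)
      qed
      thus ?thesis using a by simp
    qed
    have "\<not> l dvd 1" using l by auto
    hence "of_int 1 \<in> U" unfolding U_def by blast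
    thus "1 \<in> U" by simp
    show "0 \<notin> U" by (auto simp: U_def)
    show "U \<subseteq> J 0" by (auto simp: U_def J_iff)
    show "x * y \<in> U" if "x \<in> U" "y \<in> U" for x y
      using that l(1) unfolding U_def by (auto simp: prime_dvd_mult_iff simp flip: of_int_mult)
    show "x \<in> J k" if xy: "x \<in> J 0" "y \<in> U" "x * y \<in> J k" for x y k
    proof -
      obtain a b where ab: "x = of_int a" "\<not> l dvd b" "y = of_int b" using xy(1,2) J_int[of x 0] by (auto simp: U_def)
      hence "l ^ k dvd a * b" using xy(3) J_iff by (metis of_int_mult)
      moreover have "coprime (l ^ k) b" using l(1) ab(2) by (simp add: prime_imp_coprime)
      ultimately show ?thesis using ab(1) J_iff by (simp add: coprime_dvd_mult_left_iff)
    qed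
    have "\<exists>t\<in>of_int ` {0..<l}. x - t * y \<in> J 1" if xy: "x \<in> J 0" "y \<in> U" for x y
    proof -
      obtain a b where ab: "x = of_int a" "\<not> l dvd b" "y = of_int b" using xy J_int[of x 0] by (auto simp: U_def)
      have "coprime b l" using prime_imp_coprime[OF l(1) ab(2)] by (simp add: coprime_commute)
      then obtain c where c: "[b * c = 1] (mod l)" using cong_solve_coprime_int by blast
      define t where "t = a * c mod l"
      have "[b * t = b * (a * c)] (mod l)" unfolding t_def by (intro cong_scalar_left) simp
      also have "b * (a * c) = a * (b * c)" by simp
      also have "[a * (b * c) = a * 1] (mod l)" by (rule cong_scalar_left[OF c])
      finally have "l dvd b * t - a" by (simp add: cong_iff_dvd_diff)
      hence "l dvd a - t * b" by (simp add: dvd_diff_commute mult.commute)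
      hence "of_int (a - t * b) \<in> J 1" by (simp add: J_iff del: of_int_diff)
      moreover have "t \<in> {0..<l}" using l by (simp add: t_def)
      ultimately show ?thesis using ab by auto
    qed
    thus "\<exists>T. finite T \<and> T \<subseteq> J 0 \<and> (\<forall>x\<in>J 0. \<forall>y\<in>U. \<exists>t\<in>T. x - t * y \<in> J 1)"
      by (intro exI[of _ "of_int ` {0..<l}"]) (auto simp: J_iff)
  qed
  moreover have "S \<subseteq> {x / y | x y. x \<in> J 0 \<and> y \<in> U}"
  proof
    fix x assume "x \<in> S"
    then obtain a :: int where "x = of_int a / of_int (int d)" using d(2) by fastforce
    moreover have "of_int a \<in> J 0" "of_int (int d) \<in> U" using l(3) J_iff[of a 0] unfolding U_def by (simp_all only: power_0 one_dvd, blast)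
    ultimately show "x \<in> {x / y | x y. x \<in> J 0 \<and> y \<in> U}" by blast
  qed
  moreover have "{x / y | x y. x \<in> J 0 \<and> y \<in> U} \<subseteq> \<rat>" unfolding J_def U_def by auto
  ultimately show "\<exists>R I. filtered_ring R I \<and> S \<subseteq> R \<and> R \<subseteq> \<rat>" by blast
qed

theorem filtered_ring_containing:
  assumes "finite S"
  obtains R I where "filtered_ring R I" "S \<subseteq> R"
proof -
  have "\<exists>K. complex_subfield K \<and> has_filtrations K \<and> S \<subseteq> K"
    using assms
  proof (induction S rule: finite_induct)
    case empty
    show ?case using complex_subfield_Rats has_filtrations_Rats by blast
  next
    case (insert x S)
    then obtain K where K: "complex_subfield K" "has_filtrations K" "S \<subseteq> K" by blast
    have "has_filtrations (field_adjoin K x)"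
      using has_filtrations_algebraic[OF K(1,2), of _ x] has_filtrations_transcendental[OF K(1,2), of x] by blast
    thus ?case using K complex_subfield_field_adjoin[OF K(1), of x] field_adjoin_contains[OF K(1), of x] by blast
  qed
  then obtain K where "has_filtrations K" "S \<subseteq> K" by blast
  hence "\<exists>R I. filtered_ring R I \<and> S \<subseteq> R \<and> R \<subseteq> K"
    using assms by (simp add: has_filtrations_def)
  then obtain R I where "filtered_ring R I" "S \<subseteq> R" by (elim exE conjE)
  thus ?thesis by (rule that)
qed

section \<open>Periodicity of the coefficients of a rational series\<close>

context filtered_ring
begin

lemma cong_pigeonhole:
  assumes "\<And>n::nat. s n \<in> R"
  obtains i j where "i < j" "s j - s i \<in> I 1"
proof -
  obtain T where T: "finite T" "\<forall>x\<in>R. \<exists>t\<in>T. x - t \<in> I 1" using finite_residues by blast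
  hence "\<forall>n. \<exists>t\<in>T. s n - t \<in> I 1" using assms by blast
  then obtain t where t: "\<And>n. t n \<in> T" "\<And>n. s n - t n \<in> I 1" by metis
  have "\<not> inj t" using T(1) t(1) by (metis finite_imageD finite_subset image_subsetI infinite_UNIV_nat)
  then obtain i j where ij: "t i = t j" "i \<noteq> j" by (auto simp: inj_on_def)
  have *: "s j - s i \<in> I 1" if "t i = t j" for i j
    using diff[OF t(2)[of j] t(2)[of i]] that by simp
  show ?thesis using ij *[of i j] *[of j i] that[of i j] that[of j i] by (cases "i < j") auto
qed

lemma of_nat_in_I1: obtains l where "l > 0" "of_nat l \<in> I 1"
proof -
  obtain i j :: nat where "i < j" "of_nat j - of_nat i \<in> I 1" using cong_pigeonhole[of of_nat] of_nat_R by blast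
  thus ?thesis using that[of "j - i"] by (simp add: of_nat_diff)
qed

lemma power_sub_1_mult:
  assumes "u \<in> R" "u ^ N - 1 \<in> I k"
  shows "u ^ (N * q) - 1 \<in> I k"
proof -
  have "u ^ (N * q) - 1 = (\<Sum>i<q. (u ^ N) ^ i) * (u ^ N - 1)"
    by (simp add: power_mult power_diff_1_eq mult.commute)
  also have "\<dots> \<in> I k" using assms
    by (intro mult_R) (auto intro!: sum[where k = 0, unfolded I0] power_R)
  finally show ?thesis .
qed

lemma unit_power_near_1:
  assumes "u \<in> R" "v \<in> R" "u * v = 1"
  obtains N where "N > 0" "u ^ N - 1 \<in> I 1"
proof -
  obtain i j where ij: "i < j" "u ^ j - u ^ i \<in> I 1" using cong_pigeonhole[of "\<lambda>n. u ^ n"] power_R[OF assms(1)] by blast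
  have "v ^ i * (u ^ j - u ^ i) \<in> I 1" using ij(2) power_R[OF assms(2)] by (intro mult_R)
  also have "v ^ i * (u ^ j - u ^ i) = (u * v) ^ i * (u ^ (j - i) - 1)"
    using ij(1) by (simp add: power_mult_distrib algebra_simps flip: power_add)
  finally have "u ^ (j - i) - 1 \<in> I 1" using assms(3) by simp
  thus ?thesis using that[of "j - i"] ij(1) by simp
qed

lemma units_power_near_1:
  assumes "finite U" "\<And>u. u \<in> U \<Longrightarrow> u \<in> R \<and> (\<exists>v\<in>R. u * v = 1)"
  shows "\<exists>N>0. \<forall>u\<in>U. u ^ N - 1 \<in> I 1"
  using assms
proof (induction U rule: finite_induct)
  case empty
  show ?case by (intro exI[of _ 1]) simp
next
  case (insert u U)
  then obtain N where N: "N > 0" "\<forall>u\<in>U. u ^ N - 1 \<in> I 1" by auto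
  obtain M where M: "M > 0" "u ^ M - 1 \<in> I 1" using unit_power_near_1 insert.prems by (metis insertI1)
  have "w ^ (N * M) - 1 \<in> I 1" if w: "w \<in> insert u U" for w
  proof (cases "w = u")
    case True
    have "u \<in> R" using insert.prems by blast
    thus ?thesis using power_sub_1_mult[OF _ M(2), of N] True by (simp add: mult.commute)
  next
    case False
    hence "w \<in> R" "w ^ N - 1 \<in> I 1" using insert.prems N(2) w by auto
    thus ?thesis by (rule power_sub_1_mult)
  qed
  thus ?case using N(1) M(1) by (intro exI[of _ "N * M"]) auto
qed

text \<open>
If \<open>w \<equiv> 1\<close> modulo \<open>I (e + 1)\<close>, then \<open>w^l - 1 = (w - 1) * (1 + w + \<dots> + w^(l - 1))\<close>, and the second
factor is congruent to \<open>l \<equiv> 0\<close> modulo \<open>I 1\<close>.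
\<close>
lemma lift_power_near_1:
  assumes "of_nat l \<in> I 1" "u \<in> R" "u ^ N - 1 \<in> I 1"
  shows "u ^ (N * l ^ e) - 1 \<in> I (Suc e)"
proof (induction e)
  case (Suc e)
  define w where "w = u ^ (N * l ^ e)"
  have w: "w \<in> R" "w - 1 \<in> I (Suc e)" using Suc assms(2) by (auto simp: w_def power_R)
  have "w - 1 \<in> I 1" using w(2) antimono[of 1 "Suc e"] by auto
  hence "w ^ i - 1 \<in> I 1" for i using power_sub_1_mult[OF w(1), of 1 1 i] by simp
  hence "(\<Sum>i<l. w ^ i - 1) + of_nat l \<in> I 1" using assms(1) by (intro add sum)
  hence "(\<Sum>i<l. w ^ i) \<in> I 1" by (simp add: sum_subtractf)
  hence "(w - 1) * (\<Sum>i<l. w ^ i) \<in> I (Suc e + 1)" by (rule mult[OF w(2)])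
  also have "(w - 1) * (\<Sum>i<l. w ^ i) = u ^ (N * l ^ Suc e) - 1"
  proof -
    have "w ^ l = u ^ (N * l ^ Suc e)" by (simp add: w_def power_mult[symmetric] mult_ac)
    thus ?thesis by (simp only: power_diff_1_eq[symmetric])
  qed
  finally show ?case by simp
qed (use assms in simp)

lemma of_nat_power_in_I: "of_nat l \<in> I 1 \<Longrightarrow> of_nat (l ^ k) \<in> I k"
proof (induction k)
  case (Suc k)
  thus ?case using mult[of "of_nat l" 1 "of_nat (l ^ k)" k] by simp
qed (simp add: I0 one)

definition periodic_mod :: "nat \<Rightarrow> nat \<Rightarrow> nat \<Rightarrow> (nat \<Rightarrow> complex) \<Rightarrow> bool" where
  "periodic_mod n0 T k s \<longleftrightarrow> (\<forall>n. s n \<in> R) \<and> (\<forall>n\<ge>n0. s (n + T) - s n \<in> I k)"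

lemma periodic_mod_mult:
  assumes "periodic_mod n0 T k s"
  shows "periodic_mod n0 (T * q) k s"
proof -
  have "s (n + T * q) - s n \<in> I k" if "n \<ge> n0" for n
  proof (induction q)
    case (Suc q)
    have "s (n + T * q + T) - s (n + T * q) \<in> I k"
      using assms that by (auto simp: periodic_mod_def)
    from add[OF this Suc] show ?case by (simp add: algebra_simps)
  qed (simp add: zero)
  thus ?thesis using assms by (auto simp: periodic_mod_def)
qed

text \<open>
The exponent \<open>e\<close> may depend on \<open>k\<close>, whereas the prime divisors of the period do not, and neither does
the starting point \<open>n0\<close>.
\<close>
definition eventually_periodic :: "nat \<Rightarrow> nat \<Rightarrow> nat \<Rightarrow> nat \<Rightarrow> (nat \<Rightarrow> complex) \<Rightarrow> bool" where
  "eventually_periodic N l n0 k s \<longleftrightarrow> (\<exists>e. periodic_mod n0 (N * l ^ e) k s)"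

lemma eventually_periodic_mult_power:
  assumes s: "eventually_periodic N l n0 k s" and l: "of_nat l \<in> I 1" and u: "u \<in> R" "u ^ N - 1 \<in> I 1"
  shows "eventually_periodic N l n0 k (\<lambda>n. u ^ n * s n)"
proof -
  obtain e where e: "periodic_mod n0 (N * l ^ e) k s" using s by (auto simp: eventually_periodic_def)
  define T where "T = N * l ^ (e + k)"
  have per: "periodic_mod n0 T k s"
    using periodic_mod_mult[OF e, of "l ^ k"] by (simp add: T_def power_add mult_ac)
  have uT: "u ^ T - 1 \<in> I k"
    using lift_power_near_1[OF l u, of "e + k"] antimono[of k "Suc (e + k)"] by (auto simp: T_def)
  have "u ^ (n + T) * s (n + T) - u ^ n * s n \<in> I k" if n: "n \<ge> n0" for n
  proof -
    have "u ^ (n + T) * (s (n + T) - s n) + (u ^ n * s n) * (u ^ T - 1) \<in> I k"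
      using per n uT u(1) by (intro add mult_R times_R power_R) (auto simp: periodic_mod_def)
    thus ?thesis by (simp add: algebra_simps power_add)
  qed
  hence "periodic_mod n0 T k (\<lambda>n. u ^ n * s n)"
    using per u(1) by (auto simp: periodic_mod_def intro!: times_R power_R)
  thus ?thesis unfolding eventually_periodic_def T_def by blast
qed

text \<open>
If \<open>w\<close> has period \<open>T\<close> modulo \<open>I k\<close>, then the partial sums grow over each period by the same amount
\<open>\<sigma>\<close> modulo \<open>I k\<close>, and over \<open>l^k\<close> periods by \<open>l^k * \<sigma> \<equiv> 0\<close>.
\<close>
lemma eventually_periodic_partial_sums:
  assumes w: "eventually_periodic N l n0 k w" and l: "of_nat l \<in> I 1"
    and s: "\<And>n. s n \<in> R" "\<And>n. s (Suc n) = s n + w (Suc n)"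
  shows "eventually_periodic N l n0 k s"
proof -
  obtain e where e: "periodic_mod n0 (N * l ^ e) k w" using w by (auto simp: eventually_periodic_def)
  define T where "T = N * l ^ e"
  define \<sigma> where "\<sigma> n = s (n + T) - s n" for n
  have "\<sigma> (Suc n) - \<sigma> n \<in> I k" if "n \<ge> n0" for n
  proof -
    have "\<sigma> (Suc n) - \<sigma> n = w (Suc n + T) - w (Suc n)" by (simp add: \<sigma>_def s(2))
    also have "\<dots> \<in> I k" using e that unfolding periodic_mod_def T_def by (metis le_SucI)
    finally show ?thesis .
  qed
  hence \<sigma>: "\<sigma> (n + j) - \<sigma> n \<in> I k" if "n \<ge> n0" for n j
  proof (induction j)
    case (Suc j)
    have "(\<sigma> (Suc (n + j)) - \<sigma> (n + j)) + (\<sigma> (n + j) - \<sigma> n) \<in> I k"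
      using Suc \<open>\<And>n. n \<ge> n0 \<Longrightarrow> \<sigma> (Suc n) - \<sigma> n \<in> I k\<close> that by (intro add) auto
    thus ?case by simp
  qed (simp add: zero)
  have "s (n + T * l ^ k) - s n \<in> I k" if n: "n \<ge> n0" for n
  proof -
    have *: "s (n + T * q) - s n - of_nat q * \<sigma> n \<in> I k" for q
    proof (induction q)
      case (Suc q)
      have "(\<sigma> (n + T * q) - \<sigma> n) + (s (n + T * q) - s n - of_nat q * \<sigma> n) \<in> I k"
        by (rule add[OF \<sigma>[OF n] Suc])
      also have "(\<sigma> (n + T * q) - \<sigma> n) + (s (n + T * q) - s n - of_nat q * \<sigma> n) =
          s (n + T * Suc q) - s n - of_nat (Suc q) * \<sigma> n"
        by (simp add: \<sigma>_def algebra_simps)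
      finally show ?case .
    qed (simp add: zero)
    have "\<sigma> n * of_nat (l ^ k) \<in> I k"
      unfolding \<sigma>_def using s(1) by (intro mult_R diff_R of_nat_power_in_I[OF l])
    from add[OF * this, of "l ^ k"] show ?thesis by (simp add: mult.commute)
  qed
  hence "periodic_mod n0 (N * l ^ (e + k)) k s"
    using s(1) by (simp add: periodic_mod_def T_def power_add mult_ac)
  thus ?thesis unfolding eventually_periodic_def by blast
qed

text \<open>
Multiplying by the powers of the inverse \<open>v\<close> of \<open>u\<close> turns the recurrence into the formation of
partial sums.
\<close>
lemma eventually_periodic_recurrence:
  assumes h: "eventually_periodic N l n0 k h" and l: "of_nat l \<in> I 1"
    and u: "u \<in> R" "v \<in> R" "u * v = 1" "u ^ N - 1 \<in> I 1"
    and g: "\<And>n. g n \<in> R" "\<And>n. g (Suc n) = u * g n + h (Suc n)"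
  shows "eventually_periodic N l n0 k g"
proof -
  have "- (v ^ N * (u ^ N - 1)) \<in> I 1" using u by (intro uminus mult_R power_R)
  also have "- (v ^ N * (u ^ N - 1)) = v ^ N - (u * v) ^ N" by (simp add: power_mult_distrib algebra_simps)
  finally have v: "v ^ N - 1 \<in> I 1" using u(3) by simp
  have uv: "u ^ n * v ^ n = 1" for n using u(3) by (simp flip: power_mult_distrib)
  have "eventually_periodic N l n0 k (\<lambda>n. v ^ n * g n)"
  proof (rule eventually_periodic_partial_sums[OF _ l])
    show "eventually_periodic N l n0 k (\<lambda>n. v ^ n * h n)" by (rule eventually_periodic_mult_power[OF h l u(2) v])
    show "v ^ n * g n \<in> R" for n using u(2) g(1) by (intro times_R power_R)
    show "v ^ Suc n * g (Suc n) = v ^ n * g n + v ^ Suc n * h (Suc n)" for n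
    proof -
      have "v ^ Suc n * g (Suc n) = v ^ n * (u * v) * g n + v ^ Suc n * h (Suc n)"
        by (simp add: g(2) algebra_simps)
      thus ?thesis using u(3) by simp
    qed
  qed
  from eventually_periodic_mult_power[OF this l u(1,4)]
  show ?thesis by (simp add: mult.assoc[symmetric] uv)
qed

end

lemma fps_mult_linear_nth:
  fixes F :: "complex fps"
  shows
  "fps_nth (F * fps_of_poly [:1, -u:]) 0 = fps_nth F 0"
  "fps_nth (F * fps_of_poly [:1, -u:]) (Suc n) = fps_nth F (Suc n) - u * fps_nth F n"
proof -
  have "F * fps_of_poly [:1, -u:] = F - fps_const u * (F * fps_X)"
  proof -
    have "fps_of_poly [:1, -u:] = 1 - fps_const u * fps_X"
      by (rule fps_ext) (auto simp: coeff_pCons split: nat.splits)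
    thus ?thesis by (simp only: right_diff_distrib mult_1_right mult.left_commute)
  qed
  thus "fps_nth (F * fps_of_poly [:1, -u:]) 0 = fps_nth F 0"
    "fps_nth (F * fps_of_poly [:1, -u:]) (Suc n) = fps_nth F (Suc n) - u * fps_nth F n"
    by simp_all
qed

definition linear_product :: "complex list \<Rightarrow> complex poly" where
  "linear_product us = prod_list (map (\<lambda>u. [:1, -u:]) us)"

lemma linear_product_Cons: "linear_product (u # us) = [:1, -u:] * linear_product us"
  unfolding linear_product_def list.map prod_list.Cons ..

lemma (in filtered_ring) rational_coeffs_periodic:
  assumes l: "of_nat l \<in> I 1" and p: "\<And>n. coeff p n \<in> R"
    and us: "\<And>u. u \<in> set us \<Longrightarrow> u \<in> R \<and> (\<exists>v\<in>R. u * v = 1) \<and> u ^ N - 1 \<in> I 1"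
    and F: "F * fps_of_poly (linear_product us) = fps_of_poly p"
  shows "(\<forall>n. fps_nth F n \<in> R) \<and> eventually_periodic N l (Suc (degree p)) k (fps_nth F)"
  using us F
proof (induction us arbitrary: F)
  case Nil
  hence F: "fps_nth F n = coeff p n" for n by (simp add: linear_product_def)
  have "periodic_mod (Suc (degree p)) (N * l ^ 0) k (fps_nth F)"
    using p zero by (auto simp: periodic_mod_def F coeff_eq_0)
  thus ?case using p F unfolding eventually_periodic_def by (metis (full_types))
next
  case (Cons u us)
  define H where "H = F * fps_of_poly [:1, -u:]"
  have "H * fps_of_poly (linear_product us) = fps_of_poly p"
    using Cons.prems(2) by (simp only: H_def linear_product_Cons fps_of_poly_mult mult.assoc)
  hence H: "\<And>n. fps_nth H n \<in> R" "eventually_periodic N l (Suc (degree p)) k (fps_nth H)"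
    using Cons.IH Cons.prems(1) by auto
  have rec: "fps_nth F 0 = fps_nth H 0" "fps_nth F (Suc n) = u * fps_nth F n + fps_nth H (Suc n)" for n
    using fps_mult_linear_nth[of F u] by (simp_all add: H_def)
  obtain v where uv: "u \<in> R" "v \<in> R" "u * v = 1" "u ^ N - 1 \<in> I 1" using Cons.prems(1)[of u] by auto
  have FR: "fps_nth F n \<in> R" for n
    by (induction n) (use rec H(1) uv(1) in \<open>auto intro: add_R times_R\<close>)
  show ?case using FR eventually_periodic_recurrence[OF H(2) l uv FR rec(2)] by blast
qed

lemma linear_product_exists:
  assumes "coeff q 0 = 1"
  shows "\<exists>us. q = linear_product us \<and> 0 \<notin> set us"
  using assms
proof (induction "degree q" arbitrary: q rule: less_induct)
  case (less q)
  show ?case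
  proof (cases "degree q = 0")
    case True
    then obtain c where "q = [:c:]" by (auto elim: degree_eq_zeroE)
    hence "q = linear_product []" using less.prems by (simp add: linear_product_def one_pCons)
    thus ?thesis by (intro exI[of _ "[]"]) simp
  next
    case False
    hence "\<not> constant (poly q)" by (simp add: constant_degree)
    then obtain z where z: "poly q z = 0" using fundamental_theorem_of_algebra by blast
    have z0: "z \<noteq> 0" using z less.prems by (auto simp: poly_0_coeff_0)
    obtain r where r: "q = [:-z, 1:] * r" using z by (auto simp: poly_eq_0_iff_dvd)
    define r' where "r' = smult (-z) r"
    have "[:-z, 1:] = smult (-z) [:1, -(1 / z):]" using z0 by simp
    hence q: "q = [:1, -(1 / z):] * r'" unfolding r r'_def by (simp only: mult_smult_left mult_smult_right)
    have r0: "r \<noteq> 0" using r less.prems by auto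
    hence "degree q = Suc (degree r)" unfolding r by (subst degree_mult_eq) auto
    hence "degree r' < degree q" by (simp add: r'_def z0)
    moreover have "coeff r' 0 = 1" using less.prems by (simp add: r r'_def)
    ultimately obtain us where us: "r' = linear_product us" "0 \<notin> set us" using less.hyps by blast
    have "q = linear_product (1 / z # us)" using q us(1) by (simp only: linear_product_Cons)
    thus ?thesis using us(2) z0 by (intro exI[of _ "1 / z # us"]) auto
  qed
qed

text \<open>
Since a power series has no pole at 0, the denominator can be normalized to have constant
coefficient 1, hence to be a product of factors \<open>1 - u * z\<close>.
\<close>
definition is_rational :: "complex fps \<Rightarrow> bool" where
  "is_rational F \<longleftrightarrow> (\<exists>p q. coeff q 0 = 1 \<and> F * fps_of_poly q = fps_of_poly p)"

text \<open>
A coefficient at an exponent \<open>n\<close> coprime to \<open>N * l\<close> agrees modulo each \<open>I k\<close> with one at a large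
prime, so it lies in all \<open>I k\<close>. The factor 2 in the modulus only ensures that it exceeds 1.
\<close>
theorem coprime_coeffs_vanish:
  assumes F: "is_rational F" and primes: "\<And>p. prime p \<Longrightarrow> p \<ge> N0 \<Longrightarrow> fps_nth F p = 0"
  shows "\<exists>M>1. \<exists>n0. \<forall>n\<ge>n0. coprime n M \<longrightarrow> fps_nth F n = 0"
proof -
  obtain p q where pq: "coeff q 0 = 1" "F * fps_of_poly q = fps_of_poly p" using F by (auto simp: is_rational_def)
  obtain us where us: "q = linear_product us" "0 \<notin> set us" using linear_product_exists[OF pq(1)] by blast
  have "finite (set us \<union> inverse ` set us \<union> range (coeff p))" using finite_range_coeff by simp
  from filtered_ring_containing[OF this] obtain R I
    where RI: "filtered_ring R I" "set us \<union> inverse ` set us \<union> range (coeff p) \<subseteq> R" .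
  interpret filtered_ring R I by (rule RI)
  have units: "u \<in> R \<and> (\<exists>v\<in>R. u * v = 1)" if u: "u \<in> set us" for u
  proof -
    have "u \<noteq> 0" using u us(2) by auto
    thus ?thesis using u RI(2) by (intro conjI bexI[of _ "inverse u"]) auto
  qed
  obtain N where N: "N > 0" "\<forall>u\<in>set us. u ^ N - 1 \<in> I 1"
    using units_power_near_1[of "set us"] units by blast
  obtain l where l: "l > 0" "of_nat l \<in> I 1" by (rule of_nat_in_I1)
  have per: "(\<forall>n. fps_nth F n \<in> R) \<and> eventually_periodic N l (Suc (degree p)) k (fps_nth F)" for k
    using units N(2) RI(2) pq(2) us(1) by (intro rational_coeffs_periodic[OF l(2)]) auto
  have "fps_nth F n = 0" if n: "n \<ge> Suc (degree p)" "coprime n (2 * N * l)" for n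
  proof (rule separated)
    fix k
    obtain e where e: "periodic_mod (Suc (degree p)) (N * l ^ e) k (fps_nth F)"
      using per[of k] by (auto simp: eventually_periodic_def)
    define T where "T = N * l ^ e"
    have T: "T > 0" "coprime n T" using N(1) l(1) n(2) by (auto simp: T_def)
    have "infinite {p. prime p \<and> [p = n] (mod T)}" by (rule dirichlet_primes_in_progression[OF T])
    then obtain r where r: "prime r" "[r = n] (mod T)" "r \<ge> max n N0"
      using infinite_nat_iff_unbounded_le by (metis (mono_tags, lifting) mem_Collect_eq)
    then obtain j where j: "r = n + T * j"
      by (metis cong_sym cong_le_nat max.boundedE mult.commute add.commute)
    have "fps_nth F (n + T * j) - fps_nth F n \<in> I k"
      using periodic_mod_mult[OF e, of j] n(1) by (simp add: periodic_mod_def T_def)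
    hence "- (0 - fps_nth F n) \<in> I k" using primes[OF r(1)] r(3) j by (intro uminus) simp
    thus "fps_nth F n \<in> I k" by simp
  qed
  moreover have "2 * N * l > 1" using N(1) l(1) by (cases N; cases l) auto
  ultimately show ?thesis by blast
qed

section \<open>Decomposition of a rational power series\<close>

lemma fps_to_fls_eq_fls_of_ratfun:
  assumes "coeff q 0 = 1" "F * fps_of_poly q = fps_of_poly p"
  shows "fps_to_fls F = fls_of_ratfun (Fract p q)"
proof -
  have q: "q \<noteq> 0" using assms(1) by auto
  hence "fps_to_fls (fps_of_poly q) \<noteq> 0" using fps_of_poly_eq_iff[of q 0] by auto
  moreover have "fps_to_fls F * fps_to_fls (fps_of_poly q) = fps_to_fls (fps_of_poly p)"
    using assms(2) by (simp flip: fls_times_fps_to_fls)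
  ultimately show ?thesis unfolding fls_of_ratfun_Fract[OF q] by (simp add: eq_divide_eq)
qed

lemma is_rational_normalize:
  assumes "q \<noteq> 0" "F * fps_of_poly q = fps_of_poly p"
  shows "is_rational F"
  using assms
proof (induction q arbitrary: p)
  case (pCons c q)
  show ?case
  proof (cases "c = 0")
    case True
    hence q: "q \<noteq> 0" using pCons.prems by simp
    obtain b p' where p: "p = pCons b p'" by (cases p)
    have eq: "F * fps_of_poly q * fps_X = fps_const b + fps_of_poly p' * fps_X"
      using pCons.prems(2) True by (simp add: p fps_of_poly_pCons mult.assoc)
    have "fps_nth (F * fps_of_poly q * fps_X) 0 = fps_nth (fps_const b + fps_of_poly p' * fps_X) 0"
      by (simp only: eq)
    hence "b = 0" by simp
    hence "F * fps_of_poly q * fps_X = fps_of_poly p' * fps_X" using eq by simp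
    hence "F * fps_of_poly q = fps_of_poly p'" by simp
    thus ?thesis by (rule pCons.IH[OF q])
  next
    case False
    have "F * fps_of_poly (smult (inverse c) (pCons c q)) = fps_const (inverse c) * (F * fps_of_poly (pCons c q))"
      unfolding fps_of_poly_smult by (rule mult.left_commute)
    also have "\<dots> = fps_of_poly (smult (inverse c) p)" unfolding pCons.prems(2) fps_of_poly_smult ..
    finally have "F * fps_of_poly (smult (inverse c) (pCons c q)) = fps_of_poly (smult (inverse c) p)" .
    moreover have "coeff (smult (inverse c) (pCons c q)) 0 = 1" using False by simp
    ultimately show ?thesis unfolding is_rational_def by blast
  qed
qed simp

lemma rational_fps_iff: "rational_fps F \<longleftrightarrow> is_rational F"
proof
  assume "is_rational F"
  thus "rational_fps F" unfolding is_rational_def rational_fps_def using fps_to_fls_eq_fls_of_ratfun by blast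
next
  assume "rational_fps F"
  then obtain r where r: "fps_to_fls F = fls_of_ratfun r" by (auto simp: rational_fps_def)
  obtain p q where pq: "r = Fract p q" "q \<noteq> 0" by (cases r)
  have "fps_to_fls (fps_of_poly q) \<noteq> 0" using pq(2) fps_of_poly_eq_iff[of q 0] by auto
  hence "fps_to_fls F * fps_to_fls (fps_of_poly q) = fps_to_fls (fps_of_poly p)"
    using r fls_of_ratfun_Fract[OF pq(2), of p] pq(1) by simp
  hence "F * fps_of_poly q = fps_of_poly p" by (simp flip: fls_times_fps_to_fls)
  thus "is_rational F" by (rule is_rational_normalize[OF pq(2)])
qed

lemma is_rational_poly: "is_rational (fps_of_poly p)"
  unfolding is_rational_def by (intro exI[of _ p] exI[of _ 1]) simp

lemma is_rational_add:
  assumes "is_rational F" "is_rational G"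
  shows "is_rational (F + G)"
proof -
  obtain p q p' q' where *: "coeff q 0 = 1" "F * fps_of_poly q = fps_of_poly p"
    "coeff q' 0 = 1" "G * fps_of_poly q' = fps_of_poly p'" using assms unfolding is_rational_def by blast
  have "(F + G) * fps_of_poly (q * q') = (F * fps_of_poly q) * fps_of_poly q' + (G * fps_of_poly q') * fps_of_poly q"
    by (simp add: fps_of_poly_mult algebra_simps)
  also have "\<dots> = fps_of_poly (p * q' + p' * q)" by (simp add: * fps_of_poly_mult fps_of_poly_add)
  finally show ?thesis using *(1,3) unfolding is_rational_def by (intro exI conjI) (auto simp: coeff_mult_0)
qed

lemma is_rational_mult:
  assumes "is_rational F" "is_rational G"
  shows "is_rational (F * G)"
proof -
  obtain p q p' q' where *: "coeff q 0 = 1" "F * fps_of_poly q = fps_of_poly p"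
    "coeff q' 0 = 1" "G * fps_of_poly q' = fps_of_poly p'" using assms unfolding is_rational_def by blast
  have "(F * G) * fps_of_poly (q * q') = (F * fps_of_poly q) * (G * fps_of_poly q')"
    by (simp add: fps_of_poly_mult algebra_simps)
  also have "\<dots> = fps_of_poly (p * p')" by (simp add: * fps_of_poly_mult)
  finally show ?thesis using *(1,3) unfolding is_rational_def by (intro exI conjI) (auto simp: coeff_mult_0)
qed

lemma is_rational_sum: "(\<And>i. i \<in> A \<Longrightarrow> is_rational (f i)) \<Longrightarrow> is_rational (sum f A)"
  using is_rational_poly[of 0]
  by (induction A rule: infinite_finite_induct) (auto intro: is_rational_add)

lemma is_rational_cancel:
  assumes "is_rational (F * fps_of_poly r)" "coeff r 0 = 1"
  shows "is_rational F"
proof -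
  obtain p q where "coeff q 0 = 1" "F * fps_of_poly r * fps_of_poly q = fps_of_poly p"
    using assms(1) unfolding is_rational_def by blast
  thus ?thesis unfolding is_rational_def using assms(2)
    by (intro exI[of _ p] exI[of _ "r * q"]) (simp add: fps_of_poly_mult coeff_mult_0 mult.assoc)
qed

lemma is_rational_compose_power:
  assumes "is_rational F" "e > 0"
  shows "is_rational (F oo fps_X ^ e)"
proof -
  obtain p q where pq: "coeff q 0 = 1" "F * fps_of_poly q = fps_of_poly p"
    using assms(1) unfolding is_rational_def by blast
  have X0: "fps_nth (fps_X ^ e :: complex fps) 0 = 0" using assms(2) by simp
  have comp: "fps_of_poly r oo fps_X ^ e = fps_of_poly (pcompose r (monom 1 e))" for r :: "complex poly"
    using assms(2) by (subst fps_of_poly_pcompose) (auto simp: fps_of_poly_monom')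
  have "(F oo fps_X ^ e) * fps_of_poly (pcompose q (monom 1 e)) = (F * fps_of_poly q) oo fps_X ^ e"
    unfolding fps_compose_mult_distrib[OF X0] comp ..
  also have "\<dots> = fps_of_poly (pcompose p (monom 1 e))" by (simp add: pq(2) comp)
  finally have "(F oo fps_X ^ e) * fps_of_poly (pcompose q (monom 1 e)) = fps_of_poly (pcompose p (monom 1 e))" .
  moreover have "coeff (pcompose q (monom 1 e)) 0 = 1"
  proof -
    have "coeff (pcompose q (monom 1 e)) 0 = poly q (poly (monom 1 e) 0)"
      by (simp only: poly_0_coeff_0[symmetric] poly_pcompose)
    thus ?thesis using assms(2) pq(1) by (simp add: poly_monom poly_0_coeff_0)
  qed
  ultimately show ?thesis unfolding is_rational_def by blast
qed

definition decimation :: "nat \<Rightarrow> nat \<Rightarrow> complex fps \<Rightarrow> complex fps" where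
  "decimation M r F = Abs_fps (\<lambda>k. fps_nth F (M * k + r))"

lemma iterate_recurrence:
  fixes a h :: "nat \<Rightarrow> complex"
  assumes "\<And>n. a (Suc n) = u * a n + h (Suc n)"
  shows "a (n + M) = u ^ M * a n + (\<Sum>i=1..M. u ^ (M - i) * h (n + i))"
proof (induction M)
  case (Suc M)
  have "(\<Sum>i=1..Suc M. u ^ (Suc M - i) * h (n + i)) = (\<Sum>i=1..M. u * (u ^ (M - i) * h (n + i))) + h (Suc (n + M))"
    by (simp add: Suc_diff_le mult.assoc)
  also have "\<dots> = u * (\<Sum>i=1..M. u ^ (M - i) * h (n + i)) + h (Suc (n + M))" by (simp add: sum_distrib_left)
  finally show ?case using assms[of "n + M"] Suc by (simp add: algebra_simps)
qed simp

text \<open>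
Induction on the number of linear factors of the denominator. If \<open>a\<close> satisfies
\<open>a (n + 1) = u * a n + h (n + 1)\<close>, then along the progression it satisfies a recurrence with \<open>u^M\<close> in
place of \<open>u\<close>, whose inhomogeneous part is a combination of the decimations of \<open>h\<close> with offsets
\<open>r + 1, \<dots>, r + M\<close>. So the offset is arbitrary in the induction, not only less than \<open>M\<close>.
\<close>
lemma is_rational_decimation:
  assumes "is_rational F" "M > 0"
  shows "is_rational (decimation M r F)"
proof -
  have "is_rational (decimation M r F)" if "F * fps_of_poly (linear_product us) = fps_of_poly p" for F us p r
    using that
  proof (induction us arbitrary: F r)
    case Nil
    hence F: "F = fps_of_poly p" by (simp add: linear_product_def)
    have "decimation M r F = fps_of_poly (Abs_poly (\<lambda>k. coeff p (M * k + r)))"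
    proof (rule fps_ext)
      fix k
      have "\<forall>\<^sub>\<infinity>k. coeff p (M * k + r) = 0"
      proof (unfold MOST_nat, intro exI allI impI)
        fix k assume "degree p < k"
        moreover have "k \<le> M * k" using assms(2) by simp
        ultimately show "coeff p (M * k + r) = 0" by (intro coeff_eq_0) linarith
      qed
      thus "fps_nth (decimation M r F) k = fps_nth (fps_of_poly (Abs_poly (\<lambda>k. coeff p (M * k + r)))) k"
        by (simp add: decimation_def F Abs_poly_inverse)
    qed
    thus ?case by (simp add: is_rational_poly)
  next
    case (Cons u us)
    define H where "H = F * fps_of_poly [:1, -u:]"
    have "H * fps_of_poly (linear_product us) = fps_of_poly p"
      using Cons.prems by (simp only: H_def linear_product_Cons fps_of_poly_mult mult.assoc)
    hence rat: "is_rational (decimation M r H)" for r by (rule Cons.IH)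
    have rec: "fps_nth F (Suc n) = u * fps_nth F n + fps_nth H (Suc n)" for n
      using fps_mult_linear_nth(2)[of F u n] by (simp add: H_def)
    have eq: "decimation M r F * fps_of_poly [:1, -(u ^ M):] =
        fps_of_poly [:fps_nth F r:] + fps_of_poly [:0, 1:] *
          (\<Sum>i=1..M. fps_of_poly [:u ^ (M - i):] * decimation M (r + i) H)" (is "?L = ?R")
    proof (rule fps_ext)
      fix k show "fps_nth ?L k = fps_nth ?R k"
      proof (cases k)
        case 0
        thus ?thesis by (simp add: fps_mult_linear_nth(1) fps_of_poly_pCons decimation_def)
      next
        case (Suc j)
        have "fps_nth F (M * Suc j + r) = fps_nth F ((M * j + r) + M)" by (simp add: algebra_simps)
        also have "\<dots> = u ^ M * fps_nth F (M * j + r) + (\<Sum>i=1..M. u ^ (M - i) * fps_nth H (M * j + r + i))"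
          by (rule iterate_recurrence[where a = "fps_nth F" and h = "fps_nth H", OF rec])
        finally have "fps_nth ?L (Suc j) = (\<Sum>i=1..M. u ^ (M - i) * fps_nth H (M * j + r + i))"
          by (simp only: fps_mult_linear_nth(2)) (simp add: decimation_def)
        also have "\<dots> = fps_nth ?R (Suc j)"
          by (simp add: fps_of_poly_pCons decimation_def fps_sum_nth add.assoc)
        finally show ?thesis using Suc by simp
      qed
    qed
    have "is_rational ?R"
      by (intro is_rational_add is_rational_mult is_rational_sum is_rational_poly rat)
    thus ?case unfolding eq[symmetric] by (rule is_rational_cancel) simp
  qed
  moreover obtain p q where pq: "coeff q 0 = 1" "F * fps_of_poly q = fps_of_poly p"
    using assms(1) unfolding is_rational_def by blast
  moreover obtain us where "q = linear_product us" using linear_product_exists[OF pq(1)] by blast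
  ultimately show ?thesis by blast
qed

text \<open>
The series \<open>h\<close> such that \<open>h(z^g)\<close> is the part of \<open>F\<close> with exponents congruent to \<open>r\<close> modulo \<open>M\<close>,
where \<open>g = gcd r M\<close>: with \<open>G\<close> the decimation, this part is
\<open>z^r * G(z^M) = (z^g)^(r div g) * G((z^g)^(M div g))\<close>.
\<close>
definition progression_part :: "nat \<Rightarrow> nat \<Rightarrow> complex fps \<Rightarrow> complex fps" where
  "progression_part M r F = (let g = gcd r M in
     fps_X ^ (r div g) * (decimation M r F oo fps_X ^ (M div g)))"

lemma progression_part_compose:
  assumes "M > 0" "r < M"
  shows "fps_nth (progression_part M r F oo fps_X ^ gcd r M) n = (if n mod M = r then fps_nth F n else 0)"
proof -
  define g where "g = gcd r M"
  have g: "g > 0" "g dvd r" "g dvd M" using assms(1) by (auto simp: g_def)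
  have "progression_part M r F oo fps_X ^ g = (fps_X ^ (r div g) oo fps_X ^ g) * ((decimation M r F oo fps_X ^ (M div g)) oo fps_X ^ g)"
    unfolding progression_part_def Let_def g_def[symmetric] using g by (intro fps_compose_mult_distrib) simp
  also have "fps_X ^ (r div g) oo fps_X ^ g = (fps_X ^ r :: complex fps)"
    using g by (simp add: fps_X_power_compose flip: power_mult)
  also have "(decimation M r F oo fps_X ^ (M div g)) oo fps_X ^ g = decimation M r F oo fps_X ^ M"
  proof (rule fps_ext)
    fix n
    obtain e where e: "M = g * e" using g(3) by blast
    have "e > 0" using e assms(1) by (intro Nat.gr0I) auto
    thus "fps_nth ((decimation M r F oo fps_X ^ (M div g)) oo fps_X ^ g) n = fps_nth (decimation M r F oo fps_X ^ M) n"
      using g(1) by (auto simp: fps_nth_compose_X_power e elim!: dvdE)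
  qed
  finally have "fps_nth (progression_part M r F oo fps_X ^ g) n = fps_nth (fps_X ^ r * (decimation M r F oo fps_X ^ M)) n"
    by simp
  also have "\<dots> = (if n < r then 0 else if M dvd n - r then fps_nth F (M * ((n - r) div M) + r) else 0)"
    by (simp add: fps_X_power_mult_nth fps_nth_compose_X_power decimation_def)
  also have "\<dots> = (if n mod M = r then fps_nth F n else 0)"
  proof (cases "n < r")
    case True
    thus ?thesis using assms(2) by auto
  next
    case False
    hence "M dvd n - r \<longleftrightarrow> n mod M = r mod M" by (metis mod_eq_dvd_iff_nat not_le)
    thus ?thesis using False assms(2) by auto
  qed
  finally show ?thesis by (simp add: g_def)
qed

lemma fps_to_fls_sum: "fps_to_fls (sum f A) = (\<Sum>i\<in>A. fps_to_fls (f i :: complex fps))"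
  by (induction A rule: infinite_finite_induct) auto

text \<open>
The exponents not coprime to \<open>M\<close> are those whose residue \<open>r\<close> satisfies \<open>gcd r M > 1\<close>; the residue
\<open>r = 0\<close> is among them, with \<open>gcd 0 M = M\<close>. What remains has finitely many nonzero coefficients.
\<close>
theorem coprime_vanishing_decomposition:
  assumes F: "is_rational F" and M: "M > 1" and van: "\<And>n. n \<ge> n0 \<Longrightarrow> coprime n M \<Longrightarrow> fps_nth F n = 0"
  shows "\<exists>(P :: complex poly) (m :: nat) (d :: nat \<Rightarrow> nat) (H :: nat \<Rightarrow> complex poly fract).
               (\<forall>j\<in>{1..m}. d j > 1) \<and>
               fps_to_fls F = fps_to_fls (fps_of_poly P) +
                 (\<Sum>j=1..m. fls_compose_power (fls_of_ratfun (H j)) (d j))"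
proof -
  define A where "A = {r. r < M \<and> \<not> coprime r M}"
  have fin: "finite A" by (simp add: A_def)
  have M0: "M > 0" using M by simp
  define h where "h r = progression_part M r F" for r
  have "is_rational (h r)" if r: "r \<in> A" for r
  proof -
    have "gcd r M > 0" using M0 by simp
    hence "M div gcd r M > 0" using M0 by (simp add: div_greater_zero_iff dvd_imp_le)
    thus ?thesis unfolding h_def progression_part_def Let_def fps_of_poly_monom'[symmetric]
      unfolding fps_of_poly_monom'[of "M div gcd r M"]
      by (intro is_rational_mult is_rational_poly is_rational_compose_power is_rational_decimation F M0)
  qed
  hence "\<forall>r\<in>A. \<exists>G. fps_to_fls (h r) = fls_of_ratfun G" using rational_fps_iff by (simp add: rational_fps_def)
  then obtain G where G: "\<And>r. r \<in> A \<Longrightarrow> fps_to_fls (h r) = fls_of_ratfun (G r)" by metis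
  define P where "P = (\<Sum>n<n0. monom (if coprime n M then fps_nth F n else 0) n)"
  have cP: "coeff P n = (if coprime n M then fps_nth F n else 0)" for n
  proof -
    have "coeff P n = (if n < n0 then if coprime n M then fps_nth F n else 0 else 0)"
      by (simp add: P_def coeff_sum)
    thus ?thesis using van[of n] by (cases "n < n0") auto
  qed
  have dec: "F = fps_of_poly P + (\<Sum>r\<in>A. h r oo fps_X ^ gcd r M)"
  proof (rule fps_ext)
    fix n
    have "fps_nth (\<Sum>r\<in>A. h r oo fps_X ^ gcd r M) n = (\<Sum>r\<in>A. if n mod M = r then fps_nth F n else 0)"
      unfolding fps_sum_nth h_def by (intro sum.cong refl progression_part_compose M0) (simp add: A_def)
    also have "\<dots> = (if n mod M \<in> A then fps_nth F n else 0)" using fin by (simp add: sum.delta')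
    also have "n mod M \<in> A \<longleftrightarrow> \<not> coprime n M" using M0 by (simp add: A_def coprime_mod_left_iff)
    finally show "fps_nth F n = fps_nth (fps_of_poly P + (\<Sum>r\<in>A. h r oo fps_X ^ gcd r M)) n"
      by (simp add: cP)
  qed
  have gcd1: "gcd r M > 1" if "r \<in> A" for r
  proof -
    have "gcd r M > 0" using M0 by simp
    moreover have "gcd r M \<noteq> 1" using that coprime_iff_gcd_eq_1[of r M] unfolding A_def by blast
    ultimately show ?thesis by linarith
  qed
  have "fps_to_fls F = fps_to_fls (fps_of_poly P) + (\<Sum>r\<in>A. fps_to_fls (h r oo fps_X ^ gcd r M))"
    by (subst dec) (simp add: fps_to_fls_sum)
  also have "(\<Sum>r\<in>A. fps_to_fls (h r oo fps_X ^ gcd r M)) = (\<Sum>r\<in>A. fls_compose_power (fls_of_ratfun (G r)) (gcd r M))"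
    using M0 by (intro sum.cong refl) (simp add: G[symmetric] fls_compose_power_fps_to_fls)
  finally have eq: "fps_to_fls F = fps_to_fls (fps_of_poly P) + (\<Sum>r\<in>A. fls_compose_power (fls_of_ratfun (G r)) (gcd r M))" .
  obtain \<pi> where \<pi>: "bij_betw \<pi> {1..card A} A" using ex_bij_betw_nat_finite_1[OF fin] by blast
  have "(\<Sum>r\<in>A. fls_compose_power (fls_of_ratfun (G r)) (gcd r M)) =
      (\<Sum>j=1..card A. fls_compose_power (fls_of_ratfun (G (\<pi> j))) (gcd (\<pi> j) M))"
    by (rule sum.reindex_bij_betw[OF \<pi>, symmetric])
  moreover have "\<forall>j\<in>{1..card A}. gcd (\<pi> j) M > 1" using \<pi> gcd1 by (auto dest: bij_betwE)
  ultimately show ?thesis using eq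
    by (intro exI[of _ P] exI[of _ "card A"] exI[of _ "\<lambda>j. gcd (\<pi> j) M"] exI[of _ "\<lambda>j. G (\<pi> j)"]) simp
qed

lemma single_modulus_divides:
  assumes "fps_to_fls F = fps_to_fls (fps_of_poly P) + fls_compose_power (fls_of_ratfun G) d"
    and "d > 1" "n > degree P" "fps_nth F n \<noteq> 0"
  shows "d dvd n"
proof -
  have "fps_nth F n = fls_nth (fps_to_fls F) (int n)" by simp
  also have "\<dots> = fls_nth (fls_compose_power (fls_of_ratfun G) d) (int n)"
    unfolding assms(1) using assms(3) by (simp add: coeff_eq_0)
  finally have "fls_nth (fls_compose_power (fls_of_ratfun G) d) (int n) \<noteq> 0" using assms(4) by simp
  thus ?thesis using assms(2) by (auto simp: fls_nth_compose_power split: if_splits)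
qed

theorem proposition3p1:
  shows "(\<forall>F :: complex fps.
            rational_fps F \<and> (\<exists>N. \<forall>p::nat. prime p \<and> p \<ge> N \<longrightarrow> fps_nth F p = 0) \<longrightarrow>
            (\<exists>(P :: complex poly) (m :: nat) (d :: nat \<Rightarrow> nat) (H :: nat \<Rightarrow> complex poly fract).
               (\<forall>j\<in>{1..m}. d j > 1) \<and>
               fps_to_fls F = fps_to_fls (fps_of_poly P) +
                 (\<Sum>j=1..m. fls_compose_power (fls_of_ratfun (H j)) (d j)))) \<and>
         (\<exists>F :: complex fps.
            rational_fps F \<and> (\<exists>N. \<forall>p::nat. prime p \<and> p \<ge> N \<longrightarrow> fps_nth F p = 0) \<and>
            \<not> (\<exists>(P :: complex poly) (G :: complex poly fract) (d :: nat). d > 1 \<and>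
                 fps_to_fls F = fps_to_fls (fps_of_poly P) +
                   fls_compose_power (fls_of_ratfun G) d))"
proof (intro conjI allI impI)
  fix F :: "complex fps"
  assume F: "rational_fps F \<and> (\<exists>N. \<forall>p::nat. prime p \<and> p \<ge> N \<longrightarrow> fps_nth F p = 0)"
  hence rat: "is_rational F" by (simp add: rational_fps_iff)
  from F obtain N where "\<And>p. prime p \<Longrightarrow> p \<ge> N \<Longrightarrow> fps_nth F p = 0" by blast
  from coprime_coeffs_vanish[OF rat this] obtain M n0
    where "M > 1" "\<And>n. n \<ge> n0 \<Longrightarrow> coprime n M \<Longrightarrow> fps_nth F n = 0" by blast
  from coprime_vanishing_decomposition[OF rat this]
  show "\<exists>(P :: complex poly) (m :: nat) (d :: nat \<Rightarrow> nat) (H :: nat \<Rightarrow> complex poly fract).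
               (\<forall>j\<in>{1..m}. d j > 1) \<and>
               fps_to_fls F = fps_to_fls (fps_of_poly P) +
                 (\<Sum>j=1..m. fls_compose_power (fls_of_ratfun (H j)) (d j))" .
next
  define E :: "complex fps" where "E = Abs_fps (\<lambda>_. 1)"
  define F where "F = (E oo fps_X ^ 2) + (E oo fps_X ^ 3)"
  have "E * fps_of_poly [:1, -1:] = fps_of_poly 1"
  proof (rule fps_ext)
    fix n show "fps_nth (E * fps_of_poly [:1, -1:]) n = fps_nth (fps_of_poly 1) n"
      using fps_mult_linear_nth[of E 1] by (cases n) (auto simp: E_def)
  qed
  hence E: "is_rational E" unfolding is_rational_def by (intro exI[of _ 1] exI[of _ "[:1, -1:]"]) simp
  have nth: "fps_nth F n = (if 2 dvd n then 1 else 0) + (if 3 dvd n then 1 else 0)" for n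
    by (simp add: F_def fps_nth_compose_X_power E_def)
  have "is_rational F" unfolding F_def by (intro is_rational_add is_rational_compose_power E) auto
  moreover have "fps_nth F p = 0" if "prime p \<and> p \<ge> 4" for p
  proof -
    have "\<not> 2 dvd p" "\<not> 3 dvd p" using that by (auto simp: prime_nat_iff)
    thus ?thesis by (simp add: nth)
  qed
  moreover have "\<not> (d > 1 \<and> fps_to_fls F = fps_to_fls (fps_of_poly P) + fls_compose_power (fls_of_ratfun G) d)"
    for P :: "complex poly" and G d
  proof
    assume *: "d > 1 \<and> fps_to_fls F = fps_to_fls (fps_of_poly P) + fls_compose_power (fls_of_ratfun G) d"
    \<comment> \<open>Any exponent that takes \<open>2^k\<close> and \<open>3^k\<close> beyond the degree of \<open>P\<close> will do.\<close>
    define k where "k = Suc (degree P)"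
    have nz: "fps_nth F (2 ^ k) \<noteq> 0" "fps_nth F (3 ^ k) \<noteq> 0" by (auto simp: nth k_def)
    have big: "degree P < 2 ^ k" "degree P < 3 ^ k"
      using power_gt_expt[of 2 k] power_gt_expt[of 3 k] by (simp_all add: k_def)
    have "d dvd 2 ^ k" "d dvd 3 ^ k"
      using single_modulus_divides[of F P G d] * nz big by blast+
    moreover have "coprime (2 ^ k :: nat) (3 ^ k)" by simp
    ultimately have "d dvd 1" by (meson coprime_common_divisor)
    thus False using * by simp
  qed
  ultimately show "\<exists>F :: complex fps.
            rational_fps F \<and> (\<exists>N. \<forall>p::nat. prime p \<and> p \<ge> N \<longrightarrow> fps_nth F p = 0) \<and>
            \<not> (\<exists>(P :: complex poly) (G :: complex poly fract) (d :: nat). d > 1 \<and>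
                 fps_to_fls F = fps_to_fls (fps_of_poly P) +
                   fls_compose_power (fls_of_ratfun G) d)"
    unfolding rational_fps_iff by blast
qed

end
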